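(* Let $0\le\rho\le1$, $\delta\in[0,1]$, $m<n(\rho-1)$ and $a\in L^\infty A^m_{\rho,\delta}$. Then: (i) $T_a$ is bounded on $L^p(w)$ for all $1<p<\infty$ and $w\in A_p^\infty$; (ii) for each $b\in BMO_\infty$, the commutator $[b,T_a]$ is bounded on $L^p(w)$ for all $1<p<\infty$ and $w\in A_p^\infty$.
   Context: Write $\langle \xi\rangle=(1+|\xi|^2)^{1/2}$. For $m\in\mathbb{R}$, $\rho,\delta\in[0,1]$, an amplitude $a:\mathbb{R}^n\times\mathbb{R}^n\times\mathbb{R}^n\to\mathbb{C}$ belongs to $L^\infty A^m_{\rho,\delta}$ if for each pair of multi-indices $\alpha,\beta$ there is a constant $C$ such that $\|\partial_\xi^\alpha\partial_y^\beta a(\cdot,y,\xi)\|_{L^\infty}\le C\langle\xi\rangle^{m-\rho|\alpha|+\delta|\beta|}$ for all $y,\xi\in\mathbb{R}^n$ (here $a(x,y,\xi)$ is smooth in $(y,\xi)$ and the $L^\infty$ norm is in the $x$ variable). The pseudo-differential operator $T_a$ is given formally, for $f\in C_0^\infty(\mathbb{R}^n)$, by $$T_af(x)=\frac{1}{(2\pi)^n}\int_{\mathbb{R}^n}\int_{\mathbb{R}^n}a(x,y,\xi)e^{i\langle x-y,\xi\rangle}f(y)\,dy\,d\xi .$$ The commutator is $[b,T_a]f=b\,T_af-T_a(bf)$. For $1<p<\infty$ and $\theta\ge 0$, $A_p^\theta$ is the set of weights $w$ (nonnegative locally integrable functions) for which there is $C$ with $$\Big(\int_Bw\Big)^{1/p}\Big(\int_Bw^{-\frac{1}{p-1}}\Big)^{1/p'}\le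 C|B|(1+r_B)^\theta$$ for all balls $B=B(x_B,r_B)\subset\mathbb{R}^n$, where $1/p+1/p'=1$; $A_p^\infty=\bigcup_{\theta\geq 0}A_p^\theta$. $L^p(w)$ is the space with norm $(\int|f|^pw\,dx)^{1/p}$. For $\theta\ge0$, $BMO_\theta$ is the set of locally integrable $b$ for which there is $C$ with $\frac{1}{|B|}\int_B|b(y)-b_B|dy\le C(1+r_B)^\theta$ for all balls $B=B(x_B,r_B)$, where $b_B=\frac1{|B|}\int_Bb$; $BMO_\infty=\bigcup_{\theta>0}BMO_\theta$. *)

theory Defs
  imports "HOL-Probability.Essential_Supremum"
begin

section \<open>Smooth functions, multi-indices, test functions\<close>

definition dir_deriv :: "'a::euclidean_space \<Rightarrow> ('a \<Rightarrow> complex) \<Rightarrow> 'a \<Rightarrow> complex" where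
  "dir_deriv v f x = vector_derivative (\<lambda>t. f (x + t *\<^sub>R v)) (at 0)"

definition smooth :: "('a::euclidean_space \<Rightarrow> complex) \<Rightarrow> bool" where
  "smooth f \<longleftrightarrow> (\<forall>vs\<in>lists Basis. \<forall>x. foldr dir_deriv vs f differentiable (at x))"

text \<open>A multi-index on \<open>\<real>\<^sup>n\<close> is a function \<open>\<alpha> :: 'n \<Rightarrow> nat\<close>. The coordinate derivatives are
  composed along an arbitrary fixed enumeration of the index type; for smooth functions the
  result does not depend on the enumeration.\<close>

definition coords :: "'n::finite list" where
  "coords = (SOME is. distinct is \<and> set is = UNIV)"

definition multi_deriv :: "('n::finite \<Rightarrow> nat) \<Rightarrow> (real^'n \<Rightarrow> complex) \<Rightarrow> real^'n \<Rightarrow> complex" where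
  "multi_deriv \<alpha> f = foldr (\<lambda>i. dir_deriv (axis i 1) ^^ \<alpha> i) coords f"

definition multi_order :: "('n::finite \<Rightarrow> nat) \<Rightarrow> nat" where
  "multi_order \<alpha> = (\<Sum>i\<in>UNIV. \<alpha> i)"

definition test_function :: "('a::euclidean_space \<Rightarrow> complex) \<Rightarrow> bool" where
  "test_function f \<longleftrightarrow> smooth f \<and> compact (closure {x. f x \<noteq> 0})"


section \<open>Amplitudes and pseudo-differential operators\<close>

definition japanese :: "'a::real_normed_vector \<Rightarrow> real" where
  "japanese \<xi> = (1 + (norm \<xi>)\<^sup>2) powr (1/2)"

text \<open>The class \<open>L\<^sup>\<infinity> A\<^sup>m\<close> with parameters \<open>\<rho>\<close>, \<open>\<delta>\<close>. Measurability in \<open>x\<close> is only asked of \<open>a\<close>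
  itself: the derivatives are then measurable in \<open>x\<close> as limits of difference quotients.\<close>

definition amplitude_class ::
  "real \<Rightarrow> real \<Rightarrow> real \<Rightarrow> (real^'n \<Rightarrow> real^'n \<Rightarrow> real^'n \<Rightarrow> complex) set" where
  "amplitude_class m \<rho> \<delta> = {a.
     (\<forall>y \<xi>. (\<lambda>x. a x y \<xi>) \<in> borel_measurable lebesgue) \<and>
     (\<forall>x. smooth (\<lambda>(y, \<xi>). a x y \<xi>)) \<and>
     (\<forall>\<alpha> \<beta>. \<exists>C. \<forall>y \<xi>.
        esssup lebesgue
          (\<lambda>x. ereal (norm (multi_deriv \<alpha> (\<lambda>\<eta>. multi_deriv \<beta> (\<lambda>z. a x z \<eta>) y) \<xi>)))
        \<le> ereal (C * japanese \<xi> powr (m - \<rho> * multi_order \<alpha> + \<delta> * multi_order \<beta>)))}"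

text \<open>The integral defining \<open>T\<^sub>a f\<close> need not converge absolutely, since \<open>m\<close> may exceed \<open>-n\<close>. As
  usual it is read as an oscillatory integral: insert a cutoff \<open>\<phi> (\<epsilon>\<xi>)\<close> with \<open>\<phi> \<in> C\<^sub>0\<^sup>\<infinity>\<close> and
  \<open>\<phi> 0 = 1\<close>, which makes the integral absolutely convergent for a compactly supported integrable
  \<open>f\<close>, and let \<open>\<epsilon>\<close> tend to \<open>0\<close> from the right; the limit has to be the same for all cutoffs.
  When \<open>m < n(\<rho> - 1)\<close> the limit exists for almost every \<open>x\<close>, also if \<open>f\<close> is only integrable with
  compact support, as is the case for \<open>b f\<close> in the commutator.\<close>

definition pdo_cutoff ::
  "(real^'n \<Rightarrow> real^'n \<Rightarrow> real^'n \<Rightarrow> complex) \<Rightarrow> (real^'n \<Rightarrow> complex) \<Rightarrow> real \<Rightarrow>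
   (real^'n \<Rightarrow> complex) \<Rightarrow> real^'n \<Rightarrow> complex" where
  "pdo_cutoff a \<phi> \<epsilon> f x =
     1 / (2 * of_real pi) ^ CARD('n) *
     (LINT \<xi>|lebesgue. LINT y|lebesgue.
        a x y \<xi> * \<phi> (\<epsilon> *\<^sub>R \<xi>) * exp (\<i> * of_real ((x - y) \<bullet> \<xi>)) * f y)"

definition pdo_limit ::
  "(real^'n \<Rightarrow> real^'n \<Rightarrow> real^'n \<Rightarrow> complex) \<Rightarrow> (real^'n \<Rightarrow> complex) \<Rightarrow> real^'n \<Rightarrow> complex \<Rightarrow> bool" where
  "pdo_limit a f x L \<longleftrightarrow>
     (\<forall>\<phi>. test_function \<phi> \<and> \<phi> 0 = 1 \<longrightarrow> ((\<lambda>\<epsilon>. pdo_cutoff a \<phi> \<epsilon> f x) \<longlongrightarrow> L) (at_right 0))"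

definition pdo ::
  "(real^'n \<Rightarrow> real^'n \<Rightarrow> real^'n \<Rightarrow> complex) \<Rightarrow> (real^'n \<Rightarrow> complex) \<Rightarrow> real^'n \<Rightarrow> complex" where
  "pdo a f x = (THE L. pdo_limit a f x L)"

definition commutator ::
  "('a \<Rightarrow> complex) \<Rightarrow> (('a \<Rightarrow> complex) \<Rightarrow> 'a \<Rightarrow> complex) \<Rightarrow> ('a \<Rightarrow> complex) \<Rightarrow> 'a \<Rightarrow> complex" where
  "commutator b T f x = b x * T f x - T (\<lambda>y. b y * f y) x"


section \<open>Weights and BMO\<close>

definition locally_integrable ::
  "('a::euclidean_space \<Rightarrow> 'b::{banach, second_countable_topology}) \<Rightarrow> bool" where
  "locally_integrable f \<longleftrightarrow> (\<forall>K. compact K \<longrightarrow> set_integrable lebesgue K f)"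

text \<open>Powers of extended nonnegative reals, used with exponent \<open>s > 0\<close> only.\<close>

definition epowr :: "ennreal \<Rightarrow> real \<Rightarrow> ennreal" where
  "epowr t s = (if t = \<infinity> then \<infinity> else ennreal (enn2real t powr s))"

text \<open>The dual weight \<open>w\<^bsup>-1/(p-1)\<^esup>\<close> is \<open>\<infinity>\<close> where \<open>w\<close> vanishes, by \<open>inverse 0 = \<infinity>\<close> in \<open>ennreal\<close>.
  The exponent \<open>1 - 1/p\<close> is \<open>1/p'\<close>.\<close>

definition A_weight :: "real \<Rightarrow> real \<Rightarrow> ('a::euclidean_space \<Rightarrow> real) set" where
  "A_weight p \<theta> = {w. (\<forall>x. 0 \<le> w x) \<and> locally_integrable w \<and>
     (\<exists>C::real. \<forall>x. \<forall>r>0.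
        epowr (\<integral>\<^sup>+y\<in>ball x r. ennreal (w y) \<partial>lebesgue) (1/p) *
        epowr (\<integral>\<^sup>+y\<in>ball x r. epowr (inverse (ennreal (w y))) (1/(p-1)) \<partial>lebesgue) (1 - 1/p)
        \<le> ennreal (C * measure lebesgue (ball x r) * (1 + r) powr \<theta>))}"

definition A_weight_inf :: "real \<Rightarrow> ('a::euclidean_space \<Rightarrow> real) set" where
  "A_weight_inf p = (\<Union>\<theta>\<in>{0..}. A_weight p \<theta>)"

definition ball_mean :: "('a::euclidean_space \<Rightarrow> 'b::{banach, second_countable_topology}) \<Rightarrow> 'a \<Rightarrow> real \<Rightarrow> 'b" where
  "ball_mean f x r = (1 / measure lebesgue (ball x r)) *\<^sub>R (LINT y:ball x r|lebesgue. f y)"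

definition BMO :: "real \<Rightarrow> ('a::euclidean_space \<Rightarrow> complex) set" where
  "BMO \<theta> = {b. locally_integrable b \<and>
     (\<exists>C. \<forall>x. \<forall>r>0. ball_mean (\<lambda>y. norm (b y - ball_mean b x r)) x r \<le> C * (1 + r) powr \<theta>)}"

definition BMO_inf :: "('a::euclidean_space \<Rightarrow> complex) set" where
  "BMO_inf = (\<Union>\<theta>\<in>{0<..}. BMO \<theta>)"


section \<open>Boundedness on weighted Lebesgue spaces\<close>

definition weighted :: "('a::euclidean_space \<Rightarrow> real) \<Rightarrow> 'a measure" where
  "weighted w = density lebesgue (\<lambda>x. ennreal (w x))"

definition Lp :: "real \<Rightarrow> ('a::euclidean_space \<Rightarrow> real) \<Rightarrow> ('a \<Rightarrow> complex) set" where
  "Lp p w = {f \<in> borel_measurable lebesgue. integrable (weighted w) (\<lambda>x. norm (f x) powr p)}"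

definition Lp_norm :: "real \<Rightarrow> ('a::euclidean_space \<Rightarrow> real) \<Rightarrow> ('a \<Rightarrow> complex) \<Rightarrow> real" where
  "Lp_norm p w f = (LINT x|weighted w. norm (f x) powr p) powr (1/p)"

text \<open>\<open>T\<close> is given on test functions only. It is bounded on \<open>L\<^sup>p(w)\<close> if it agrees there with a
  bounded linear operator \<open>S\<close> on the whole of \<open>L\<^sup>p(w)\<close>, whose elements are represented by functions.\<close>

definition bounded_on_Lp ::
  "real \<Rightarrow> ('a::euclidean_space \<Rightarrow> real) \<Rightarrow> (('a \<Rightarrow> complex) \<Rightarrow> 'a \<Rightarrow> complex) \<Rightarrow> bool" where
  "bounded_on_Lp p w T \<longleftrightarrow>
     (\<exists>S C.
        (\<forall>f\<in>Lp p w. S f \<in> Lp p w \<and> Lp_norm p w (S f) \<le> C * Lp_norm p w f) \<and>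
        (\<forall>f\<in>Lp p w. \<forall>g\<in>Lp p w. AE x in weighted w. S (\<lambda>y. f y + g y) x = S f x + S g x) \<and>
        (\<forall>f\<in>Lp p w. \<forall>c. AE x in weighted w. S (\<lambda>y. c * f y) x = c * S f x) \<and>
        (\<forall>f. test_function f \<longrightarrow> (AE x in weighted w. S f x = T f x)))"

end

theory Submission
  imports Defs
begin

text \<open>
  The weights enter only through averages over balls of a fixed radius \<open>r\<close>: by Hoelder's inequality
  and Tonelli's theorem such an averaging operator is bounded on \<open>L\<^sup>p(w)\<close>, with norm a power of
  \<open>1 + r\<close>, directly from the \<open>A\<^sub>p\<close> condition. Since \<open>m < n(\<rho> - 1)\<close>, integrating by parts
  \<open>n - 1\<close> times in \<open>\<xi>\<close> and taking one finite difference of fractional strength bounds the kernel of \<open>T\<^sub>a\<close> by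
  \<open>\<bar>x - y\<bar>\<^sup>-\<^sup>\<sigma>\<close> with \<open>\<sigma> < n\<close>; far from the diagonal more integrations by parts give any negative power.
  Hence \<open>T\<^sub>a\<close> is dominated by a summable series of averages over balls of dyadic radii, and no
  maximal function is needed. For the commutator, \<open>\<bar>b(x) - b(y)\<bar> \<le> h(x) h(y)\<close> with
  \<open>h = 1 + \<bar>b - b\<^sub>Q\<bar>\<close> on a cube \<open>Q\<close> containing the ball, and the powers of \<open>h\<close> are absorbed into the
  weights by a John-Nirenberg inequality with respect to the measure \<open>w dx\<close>.
\<close>

section \<open>Hoelder's inequality for extended nonnegative functions\<close>

text \<open>The hypothesis on m says m - \<rho> n < -n. Hence n integrations by parts make the
  integrand absolutely integrable, but the bound |x - y|^-n they give is not locally integrable,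
  while n - 1 of them need not give convergence. The gap in the strict inequality pays for an order
  n - 1 + t with t < 1; this is where \<sigma> < n comes from. The count covers \<rho> = 0 too:
  there m < -n, and integration by parts only produces decay in x - y.

  The constants of the weight and of b grow like powers of 1 + r, and so do the norms of the
  averaging operators. The sum over dyadic radii survives because the kernel decays faster than any
  power; in return every constant has to be polynomial in the side length. This is why the
  John-Nirenberg argument tracks \<beta> and \<kappa> explicitly: \<kappa> itself is an inverse
  power of 1 + l.

  Amplitudes are only bounded and measurable in x. The kernel estimates hold for almost every x and
  concern size alone, which is why absolute values can be put inside the operator.\<close>

lemma epowr_ennreal [simp]: "0 \<le> x \<Longrightarrow> epowr (ennreal x) s = ennreal (x powr s)"
  by (simp add: epowr_def)

lemma epowr_top [simp]: "epowr top s = top"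
  by (simp add: epowr_def infinity_ennreal_def)

lemma epowr_0 [simp]: "epowr 0 s = 0"
  by (simp add: epowr_def)

lemma epowr_1 [simp]: "epowr x 1 = x"
  by (cases x) simp_all

lemma epowr_one [simp]: "epowr 1 s = 1"
  by (simp add: epowr_def)

lemma epowr_mono: "x \<le> y \<Longrightarrow> 0 \<le> s \<Longrightarrow> epowr x s \<le> epowr y s"
  by (cases x; cases y) (auto simp: ennreal_leI powr_mono2 top_unique)

lemma epowr_mult: "epowr (x * y) s = epowr x s * epowr y s"
proof (cases x)
  case top
  have "epowr y s \<noteq> 0" if "y \<noteq> 0"
    using that by (cases y) auto
  then show ?thesis using top by (cases "y = 0") simp_all
next
  case (real a)
  show ?thesis
  proof (cases y)
    case top
    have "epowr x s \<noteq> 0" if "x \<noteq> 0"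
      using that by (cases x) auto
    then show ?thesis using top by (cases "x = 0") simp_all
  next
    case (real b)
    have "ennreal a * ennreal b = ennreal (a * b)"
      "ennreal (a powr s) * ennreal (b powr s) = ennreal (a powr s * b powr s)"
      using \<open>0 \<le> a\<close> \<open>0 \<le> b\<close> by (auto simp: ennreal_mult)
    then show ?thesis
      using real \<open>x = ennreal a\<close> \<open>0 \<le> a\<close> by (simp add: powr_mult)
  qed
qed

lemma epowr_epowr: "epowr (epowr x s) t = epowr x (s * t)"
  by (cases x) (simp_all add: powr_powr)

lemma epowr_eq_0_iff [simp]: "epowr x s = 0 \<longleftrightarrow> x = 0"
  by (cases x) auto

lemma epowr_eq_top_iff [simp]: "epowr x s = top \<longleftrightarrow> x = top"
  by (cases x) auto

lemma borel_measurable_epowr [measurable]: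
  assumes [measurable]: "f \<in> borel_measurable M"
  shows "(\<lambda>x. epowr (f x) s) \<in> borel_measurable M"
  unfolding epowr_def by measurable

lemma Young_ennreal:
  fixes a b :: ennreal and p q :: real
  assumes "p > 1" "q > 1" "1 / p + 1 / q = 1"
  shows "a * b \<le> ennreal (1/p) * epowr a p + ennreal (1/q) * epowr b q"
proof (cases "a = top \<or> b = top")
  case True
  then show ?thesis using assms by (auto simp: ennreal_mult_top)
next
  case False
  obtain x y where xy: "a = ennreal x" "b = ennreal y" "0 \<le> x" "0 \<le> y"
    using False by (cases a; cases b) auto
  have "x * y \<le> x powr p / p + y powr q / q"
    using Youngs_inequality[OF assms xy(3,4)] .
  then have "ennreal (x * y) \<le> ennreal (1/p * x powr p + 1/q * y powr q)"
    by (intro ennreal_leI) simp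
  also have "\<dots> = ennreal (1/p) * epowr a p + ennreal (1/q) * epowr b q"
    using assms xy by (subst ennreal_plus) (auto simp: ennreal_mult simp del: times_divide_eq_left)
  finally show ?thesis using xy by (simp add: ennreal_mult)
qed

text \<open>Raised to the power \<open>p\<close> and with values in [0, \<infinity>], so that it
  applies to integrals not yet known to be finite. The cases where \<open>F\<close> or
  \<open>G\<close> is 0 or infinite are split off before the usual normalisation and Young's
  inequality.\<close>

lemma Holder_nn_integral:
  fixes f g :: "'a \<Rightarrow> ennreal" and p :: real
  assumes [measurable]: "f \<in> borel_measurable M" "g \<in> borel_measurable M" and p: "p > 1"
  shows "epowr (\<integral>\<^sup>+x. f x * g x \<partial>M) p \<le>
     (\<integral>\<^sup>+x. epowr (f x) p \<partial>M) * epowr (\<integral>\<^sup>+x. epowr (g x) (p / (p - 1)) \<partial>M) (p - 1)"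
proof -
  define q where "q = p / (p - 1)"
  have q: "q > 1" "1 / p + 1 / q = 1" "p / q = p - 1"
    using p by (auto simp: q_def field_simps)
  define F where "F = (\<integral>\<^sup>+x. epowr (f x) p \<partial>M)"
  define G where "G = (\<integral>\<^sup>+x. epowr (g x) q \<partial>M)"
  have main: "epowr (\<integral>\<^sup>+x. f x * g x \<partial>M) p \<le> F * epowr G (p - 1)"
  proof (cases "F = 0 \<or> G = 0")
    case True
    then have "(AE x in M. f x = 0) \<or> (AE x in M. g x = 0)"
      unfolding F_def G_def by (auto simp: nn_integral_0_iff_AE)
    then have "AE x in M. f x * g x = 0" by auto
    then have "(\<integral>\<^sup>+x. f x * g x \<partial>M) = 0" by (simp add: nn_integral_0_iff_AE)
    then show ?thesis by simp
  next
    case nz: False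
    show ?thesis
    proof (cases "F = top \<or> G = top")
      case True
      then show ?thesis using nz by (auto simp: ennreal_mult_eq_top_iff)
    next
      case False
      obtain u v where uv: "F = ennreal u" "G = ennreal v" "u > 0" "v > 0"
        using nz False by (cases F; cases G) (auto simp: less_le)
      \<comment> \<open>\<open>A\<close> and \<open>B\<close> scale both factors to norm 1. The fact
        \<open>AB\<close> below undoes the scaling: the p-th power of \<open>A * B\<close> is the
        reciprocal of the right-hand side.\<close>
      define A where "A = ennreal (u powr (-1/p))"
      define B where "B = ennreal (v powr (-1/q))"
      have "(\<integral>\<^sup>+x. (A * f x) * (B * g x) \<partial>M) \<le>
          (\<integral>\<^sup>+x. ennreal (1/p) * epowr (A * f x) p + ennreal (1/q) * epowr (B * g x) q \<partial>M)"
        by (intro nn_integral_mono Young_ennreal p q)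
      also have "\<dots> = ennreal (1/p) * (epowr A p * F) + ennreal (1/q) * (epowr B q * G)"
        by (simp add: nn_integral_add nn_integral_cmult epowr_mult F_def G_def)
      also have "epowr A p * F = 1"
      proof -
        have "(u powr (-1/p)) powr p * u = 1"
          using p q uv unfolding powr_powr by (simp add: powr_minus)
        then show ?thesis using uv
          by (simp add: A_def flip: ennreal_mult del: divide_minus_left)
      qed
      also have "epowr B q * G = 1"
      proof -
        have "(v powr (-1/q)) powr q * v = 1"
          using p q uv unfolding powr_powr by (simp add: powr_minus)
        then show ?thesis using uv
          by (simp add: B_def flip: ennreal_mult del: divide_minus_left)
      qed
      also have "ennreal (1/p) * 1 + ennreal (1/q) * 1 = 1"
        using p q by (simp flip: ennreal_plus)
      finally have "(\<integral>\<^sup>+x. (A * B) * (f x * g x) \<partial>M) \<le> 1"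
        by (simp add: ac_simps)
      then have le: "(A * B) * (\<integral>\<^sup>+x. f x * g x \<partial>M) \<le> 1"
        by (simp add: nn_integral_cmult)
      have AB: "epowr (A * B) p * (F * epowr G (p - 1)) = 1"
      proof -
        have "(-1/q) * p = - (p - 1)" using q by (simp add: field_simps)
        moreover have "(-1/p) * p = -1" using p by simp
        ultimately have "(u powr (-1/p) * v powr (-1/q)) powr p = u powr -1 * v powr (- (p - 1))"
          by (simp only: powr_mult powr_powr)
        also have "\<dots> * (u * v powr (p - 1)) = 1"
        proof -
          have inv: "c powr (- e) * c powr e = 1" if "c > 0" for c e :: real
            using that by (simp add: powr_minus)
          have "u powr -1 * v powr (- (p - 1)) * (u * v powr (p - 1)) =
              (u powr -1 * u powr 1) * (v powr (- (p - 1)) * v powr (p - 1))"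
            using uv by (simp only: powr_one_gt_zero_iff[THEN iffD2] ac_simps)
          then show ?thesis
            by (simp only: inv[OF uv(3)] inv[OF uv(4)] mult_1)
        qed
        finally have "(u powr (-1/p) * v powr (-1/q)) powr p * (u * v powr (p - 1)) = 1" .
        moreover have "epowr (A * B) p = ennreal ((u powr (-1/p) * v powr (-1/q)) powr p)"
          unfolding A_def B_def
          by (subst ennreal_mult[symmetric])
              (simp_all only: epowr_ennreal powr_ge_zero mult_nonneg_nonneg)
        moreover have "F * epowr G (p - 1) = ennreal (u * v powr (p - 1))"
          using uv by (simp add: ennreal_mult)
        moreover have "0 \<le> u * v powr (p - 1)"
          using uv by simp
        ultimately show ?thesis
          by (simp only: ennreal_mult[symmetric] powr_ge_zero ennreal_1)
      qed
      have "epowr (A * B) p * epowr (\<integral>\<^sup>+x. f x * g x \<partial>M) p \<le> 1"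
        using epowr_mono[OF le, of p] p
        by (simp add: epowr_mult)
      then have "(F * epowr G (p - 1)) * (epowr (A * B) p * epowr (\<integral>\<^sup>+x. f x * g x \<partial>M) p)
          \<le> (F * epowr G (p - 1)) * 1"
        by (intro mult_left_mono) auto
      moreover have "(F * epowr G (p - 1)) * (epowr (A * B) p * epowr (\<integral>\<^sup>+x. f x * g x \<partial>M) p)
          = epowr (\<integral>\<^sup>+x. f x * g x \<partial>M) p"
      proof -
        have "a * (b * c) = (b * a) * c" for a b c :: ennreal by (simp only: ac_simps)
        then show ?thesis using AB by simp
      qed
      ultimately show ?thesis by simp
    qed
  qed
  then show ?thesis by (simp add: F_def G_def q_def)
qed

section \<open>Dyadic cubes\<close>

text \<open>Half-open, so that the dyadic subcubes of one generation tile a cube exactly and no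
  boundaries have to be discarded.\<close>

definition cube :: "real^'n \<Rightarrow> real \<Rightarrow> (real^'n) set" where
  "cube c l = {x. \<forall>i. c $ i \<le> x $ i \<and> x $ i < c $ i + l}"

lemma box_subset_cube: "box c (\<chi> i. c $ i + l) \<subseteq> cube c l"
  by (auto simp: cube_def mem_box_cart less_imp_le)

lemma cube_subset_cbox: "cube c l \<subseteq> cbox c (\<chi> i. c $ i + l)"
  by (auto simp: cube_def mem_box_cart less_imp_le)

lemma cube_borel [measurable]: "cube c l \<in> sets borel"
proof -
  have "cube c l = (\<Inter>i. {x. c $ i \<le> x $ i} \<inter> {x. x $ i < c $ i + l})"
    by (auto simp: cube_def)
  moreover have "{x. c $ i \<le> x $ i} \<inter> {x. x $ i < c $ i + l} \<in> sets borel" for i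
    by (intro sets.Int borel_closed borel_open closed_Collect_le open_Collect_less
        continuous_intros)
  ultimately show ?thesis by (simp add: sets.finite_INT)
qed

lemma cube_lebesgue [measurable]: "cube c l \<in> sets lebesgue"
  using cube_borel by (metis sets_completionI_sets sets_lborel)

lemma emeasure_cube:
  fixes c :: "real^'n"
  assumes "0 \<le> l"
  shows "emeasure lebesgue (cube c l) = ennreal (l ^ CARD('n))"
proof -
  let ?u = "\<chi> i. c $ i + l"
  have le: "\<And>b. b \<in> Basis \<Longrightarrow> c \<bullet> b \<le> ?u \<bullet> b"
    using assms by (auto simp: Basis_vec_def inner_axis)
  have "(\<Prod>b\<in>(Basis :: (real^'n) set). (?u - c) \<bullet> b) = (\<Prod>b\<in>(Basis :: (real^'n) set). l)"
    by (intro prod.cong refl) (auto simp: Basis_vec_def inner_axis)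
  then have P: "(\<Prod>b\<in>(Basis :: (real^'n) set). (?u - c) \<bullet> b) = l ^ CARD('n)" by simp
  have 1: "emeasure lebesgue (box c ?u) = ennreal (l ^ CARD('n))"
    using emeasure_lborel_box[of c ?u, OF le] P by simp
  have 2: "emeasure lebesgue (cbox c ?u) = ennreal (l ^ CARD('n))"
    using emeasure_lborel_cbox[of c ?u, OF le] P by simp
  show ?thesis
  proof (rule antisym)
    show "emeasure lebesgue (cube c l) \<le> ennreal (l ^ CARD('n))"
      using emeasure_mono[OF cube_subset_cbox[of c l], of lebesgue] unfolding 2 by simp
    show "ennreal (l ^ CARD('n)) \<le> emeasure lebesgue (cube c l)"
      using emeasure_mono[OF box_subset_cube[of c l], of lebesgue] unfolding 1 by simp
  qed
qed

lemma measure_cube: "0 \<le> l \<Longrightarrow> measure lebesgue (cube (c :: real^'n) l) = l ^ CARD('n)"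
  unfolding measure_def by (subst emeasure_cube) auto

lemma dist_le_of_components:
  fixes x y :: "real^'n"
  assumes "\<And>i. \<bar>x $ i - y $ i\<bar> < e"
  shows "dist x y < real CARD('n) * e"
proof -
  have "dist x y \<le> (\<Sum>i\<in>UNIV. \<bar>(x - y) $ i\<bar>)"
    unfolding dist_norm by (rule norm_le_l1_cart)
  also have "\<dots> < (\<Sum>i\<in>(UNIV::'n set). e)"
    using assms by (intro sum_strict_mono) auto
  finally show ?thesis by simp
qed

lemma cube_subset_ball: "cube c l \<subseteq> ball (c :: real^'n) (real CARD('n) * l)"
proof
  fix x assume "x \<in> cube c l"
  then have "c $ i \<le> x $ i \<and> x $ i < c $ i + l" for i by (simp add: cube_def)
  then have "\<bar>c $ i - x $ i\<bar> < l" for i by (smt (verit))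
  then show "x \<in> ball c (real CARD('n) * l)"
    using dist_le_of_components[of c x l] by simp
qed

lemma ball_subset_cube: "ball x r \<subseteq> cube (x - (\<chi> i. r)) (2 * r)" for x :: "real^'n"
proof
  fix y assume "y \<in> ball x r"
  then have "norm (x - y) < r" by (simp add: dist_norm)
  then have "\<bar>x $ i - y $ i\<bar> < r" for i
    using component_le_norm_cart[of "x - y" i] by simp
  then have "x $ i - r \<le> y $ i \<and> y $ i < x $ i - r + 2 * r" for i
    by (smt (verit))
  then show "y \<in> cube (x - (\<chi> i. r)) (2 * r)"
    by (simp add: cube_def)
qed

text \<open>The dyadic cube of generation \<open>k\<close>, in the grid of side
  \<open>l / 2 ^ k\<close> through \<open>c\<close>, that contains \<open>x\<close>. Naming a cube
  by one of its points instead of a lattice index makes its ancestors available as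
  \<open>dcube c l j x\<close> with smaller \<open>j\<close>.\<close>

definition dcube :: "real^'n \<Rightarrow> real \<Rightarrow> nat \<Rightarrow> real^'n \<Rightarrow> (real^'n) set" where
  "dcube c l k x = cube (\<chi> i. c $ i + l / 2 ^ k * of_int \<lfloor>2 ^ k * (x $ i - c $ i) / l\<rfloor>) (l / 2 ^ k)"

text \<open>Membership is an equality of floors, hence an equivalence relation between points: cubes
  of one generation are equal or disjoint without further geometry.\<close>

lemma mem_dcube:
  assumes "0 < l"
  shows "y \<in> dcube c l k x \<longleftrightarrow>
    (\<forall>i. \<lfloor>2 ^ k * (y $ i - c $ i) / l\<rfloor> = \<lfloor>2 ^ k * (x $ i - c $ i) / l\<rfloor>)"
proof -
  have "c' + l / 2 ^ k * of_int z \<le> y' \<and> y' < c' + l / 2 ^ k * of_int z + l / 2 ^ k \<longleftrightarrow>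
      \<lfloor>2 ^ k * (y' - c') / l\<rfloor> = z" for c' y' z
    using assms by (simp add: floor_eq_iff field_simps)
  then show ?thesis by (simp add: dcube_def cube_def)
qed

lemma dcube_refl: "0 < l \<Longrightarrow> x \<in> dcube c l k x"
  by (simp add: mem_dcube)

lemma dcube_eq: "0 < l \<Longrightarrow> y \<in> dcube c l k x \<Longrightarrow> dcube c l k y = dcube c l k x"
  unfolding mem_dcube by (simp only: dcube_def)

lemma dcube_Suc_subset:
  assumes "0 < l"
  shows "dcube c l (Suc k) x \<subseteq> dcube c l k x"
proof
  fix y assume y: "y \<in> dcube c l (Suc k) x"
  \<comment> \<open>The index in the coarser generation is the finer one divided by 2 and rounded
    down.\<close>
  have *: "\<lfloor>2 ^ k * a / l\<rfloor> = \<lfloor>2 ^ Suc k * a / l\<rfloor> div 2" for a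
    using floor_divide_real_eq_div[of 2 "2 ^ Suc k * a / l"] by simp
  show "y \<in> dcube c l k x"
    using y assms unfolding mem_dcube[OF assms] by (simp only: *) simp
qed

lemma dcube_antimono: "0 < l \<Longrightarrow> j \<le> k \<Longrightarrow> dcube c l k x \<subseteq> dcube c l j x"
  using lift_Suc_antimono_le[of "\<lambda>k. dcube c l k x" j k] dcube_Suc_subset[of l c _ x] by blast

lemma dcube_0:
  assumes "0 < l" "x \<in> cube c l"
  shows "dcube c l 0 x = cube c l"
proof -
  have "\<lfloor>(x $ i - c $ i) / l\<rfloor> = 0" for i
    using assms by (simp add: floor_eq_iff cube_def field_simps)
  then show ?thesis by (simp add: dcube_def vec_eq_iff)
qed

lemma dcube_subset_open:
  fixes x :: "real^'n"
  assumes "0 < l" "open U" "x \<in> U"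
  shows "\<exists>k. dcube c l k x \<subseteq> U"
proof -
  obtain e where e: "e > 0" "ball x e \<subseteq> U"
    using assms openE by blast
  obtain k where "real CARD('n) * l / e < 2 ^ k"
    using real_arch_pow[of 2] by auto
  then have k: "real CARD('n) * (l / 2 ^ k) < e"
    using e by (simp add: field_simps)
  have "y \<in> ball x e" if "y \<in> dcube c l k x" for y
  proof -
    have "\<bar>x $ i - y $ i\<bar> < l / 2 ^ k" for i
    proof -
      have "\<lfloor>2 ^ k * (y $ i - c $ i) / l\<rfloor> = \<lfloor>2 ^ k * (x $ i - c $ i) / l\<rfloor>"
        using that assms by (simp add: mem_dcube)
      then have "\<bar>2 ^ k * (x $ i - c $ i) / l - 2 ^ k * (y $ i - c $ i) / l\<bar> < 1"
        by linarith
      moreover have "2 ^ k * (x $ i - c $ i) / l - 2 ^ k * (y $ i - c $ i) / l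
          = (x $ i - y $ i) * (2 ^ k / l)"
        by (simp add: algebra_simps diff_divide_distrib)
      moreover have "\<bar>(x $ i - y $ i) * (2 ^ k / l)\<bar> = \<bar>x $ i - y $ i\<bar> * (2 ^ k / l)"
        using assms by (subst abs_mult) simp
      ultimately have "\<bar>x $ i - y $ i\<bar> * (2 ^ k / l) < 1" by simp
      then show ?thesis
        using assms by (simp add: field_simps)
    qed
    then show ?thesis using dist_le_of_components[of x y "l / 2 ^ k"] k by simp
  qed
  then show ?thesis using e by blast
qed

lemma countable_dcubes: "countable {dcube c l k x | k (x :: real^'n). True}"
proof (rule countable_subset)
  show "{dcube c l k x | k (x :: real^'n). True} \<subseteq>
      range (\<lambda>(k, f :: 'n \<Rightarrow> int). cube (\<chi> i. c $ i + l / 2 ^ k * of_int (f i)) (l / 2 ^ k))"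
    by (auto simp: dcube_def image_iff)
qed auto

text \<open>A stopping time: each point takes the first generation at which \<open>P\<close> holds,
  so the selected cubes are the maximal ones with \<open>P\<close>. The last conclusion also records
  that all earlier ancestors fail \<open>P\<close>; failure at the parent is what later bounds the
  average on a selected cube.\<close>

lemma dyadic_selection:
  fixes c :: "real^'n" and P :: "(real^'n) set \<Rightarrow> bool"
  assumes l: "0 < l"
  obtains F where "countable F" "disjoint F" "\<Union>F = {x \<in> cube c l. \<exists>k. P (dcube c l k x)}"
    "\<And>J. J \<in> F \<Longrightarrow> \<exists>x\<in>cube c l. \<exists>k. J = dcube c l k x \<and> P J \<and> (\<forall>j<k. \<not> P (dcube c l j x))"
proof -
  define T where "T = {x \<in> cube c l. \<exists>k. P (dcube c l k x)}"
  define m where "m x = (LEAST k. P (dcube c l k x))" for x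
  define J where "J x = dcube c l (m x) x" for x
  have P: "P (J x)" if "x \<in> T" for x
    using that LeastI_ex[of "\<lambda>k. P (dcube c l k x)"] by (auto simp: T_def J_def m_def)
  have less: "\<not> P (dcube c l j x)" if "j < m x" for j x
    using that not_less_Least by (auto simp: m_def)
  have sub: "J x \<subseteq> cube c l" if "x \<in> T" for x
    using that dcube_antimono[of l 0 "m x" c x] dcube_0[OF l, of x c] l by (auto simp: J_def T_def)
  \<comment> \<open>All points of a selected cube stop at the same generation, because they share
    its ancestors. This gives disjointness and shows that the selected cubes cover nothing outside
    \<open>T\<close>.\<close>
  have same: "y \<in> T \<and> J y = J x" if "x \<in> T" "y \<in> J x" for x y
  proof -
    have eq: "dcube c l j y = dcube c l j x" if "j \<le> m x" for j
    proof -
      have "y \<in> dcube c l j x"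
        using dcube_antimono[OF l that, of c x] \<open>y \<in> J x\<close> unfolding J_def by blast
      then show ?thesis by (rule dcube_eq[OF l])
    qed
    have "P (dcube c l (m x) y)" using P[OF that(1)] eq[of "m x"] by (simp add: J_def)
    then have "y \<in> T" using sub[OF that(1)] that(2) unfolding T_def by blast
    moreover have "m y = m x" unfolding m_def[of y]
    proof (rule Least_equality)
      show "P (dcube c l (m x) y)" using P[OF that(1)] eq[of "m x"] by (simp add: J_def)
      show "m x \<le> k" if "P (dcube c l k y)" for k
        using that eq[of k] less[of k x] by (cases "k < m x") auto
    qed
    ultimately show ?thesis using eq[of "m x"] by (simp add: J_def)
  qed
  show ?thesis
  proof
    show "countable (J ` T)"
      by (rule countable_subset[OF _ countable_dcubes[of c l]]) (auto simp: J_def)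
    show "disjoint (J ` T)"
    proof (rule disjointI)
      fix a b assume "a \<in> J ` T" "b \<in> J ` T" "a \<noteq> b"
      then obtain x y where xy: "x \<in> T" "y \<in> T" "a = J x" "b = J y" by blast
      show "a \<inter> b = {}"
      proof (rule ccontr)
        assume "a \<inter> b \<noteq> {}"
        then obtain z where "z \<in> J x" "z \<in> J y" using xy by blast
        then have "J x = J y" using same[OF xy(1)] same[OF xy(2)] by metis
        then show False using xy \<open>a \<noteq> b\<close> by simp
      qed
    qed
    show "\<Union>(J ` T) = {x \<in> cube c l. \<exists>k. P (dcube c l k x)}"
      unfolding T_def[symmetric]
    proof (intro equalityI subsetI)
      show "y \<in> T" if "y \<in> \<Union>(J ` T)" for y using that same by blast
      show "y \<in> \<Union>(J ` T)" if "y \<in> T" for y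
        using that dcube_refl[OF l, of y c "m y"] unfolding J_def by blast
    qed
    show "\<exists>x\<in>cube c l. \<exists>k. K = dcube c l k x \<and> P K \<and> (\<forall>j<k. \<not> P (dcube c l j x))"
      if K: "K \<in> J ` T" for K
    proof -
      obtain x where x: "x \<in> T" "K = J x" using K by blast
      have "x \<in> cube c l" using x(1) unfolding T_def by blast
      moreover have "K = dcube c l (m x) x" using x(2) unfolding J_def .
      moreover have "P K" using P[OF x(1)] x(2) by simp
      ultimately show ?thesis using less by blast
    qed
  qed
qed

text \<open>Sums an estimate known on each cube of a disjoint family. The set \<open>A\<close> is
  the whole space when densities are compared, and the exceptional set in the John-Nirenberg
  induction.\<close>

lemma emeasure_disjoint_Union_le:
  assumes F: "countable F" "disjoint F" and A: "A \<in> sets M"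
    and sub: "\<And>J. J \<in> F \<Longrightarrow> J \<in> sets M \<and> J \<in> sets N \<and> emeasure M (A \<inter> J) \<le> C * emeasure N J"
  shows "emeasure M (A \<inter> \<Union>F) \<le> C * emeasure N (\<Union>F)"
proof -
  have dis: "disjoint_family_on (\<lambda>J. J) F" "disjoint_family_on (\<lambda>J. A \<inter> J) F"
    using F(2) by (auto simp: disjoint_family_on_def disjoint_def)
  have "emeasure M (\<Union>J\<in>F. A \<inter> J) = (\<integral>\<^sup>+J. emeasure M (A \<inter> J) \<partial>count_space F)"
    by (rule emeasure_UN_countable) (use sub A F dis in blast)+
  also have "\<dots> \<le> (\<integral>\<^sup>+J. C * emeasure N J \<partial>count_space F)"
    by (rule nn_integral_mono) (use sub in simp)
  also have "\<dots> = C * (\<integral>\<^sup>+J. emeasure N J \<partial>count_space F)"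
    by (rule nn_integral_cmult) simp
  also have "(\<integral>\<^sup>+J. emeasure N J \<partial>count_space F) = emeasure N (\<Union>J\<in>F. J)"
    by (rule emeasure_UN_countable[symmetric]) (use sub F dis in blast)+
  also have "(\<Union>J\<in>F. A \<inter> J) = A \<inter> \<Union>F" by blast
  finally show ?thesis by simp
qed

declare emeasure_completion [simp del]

lemma dcube_lebesgue [measurable]: "dcube c l k x \<in> sets lebesgue"
  unfolding dcube_def by (rule cube_lebesgue)

text \<open>This replaces the Lebesgue differentiation theorem: covering \<open>A\<close> by the dyadic cubes inside an
  open superset of almost the same measure already gives \<open>\<integral>\<^sub>A g \<le> lam \<bar>A\<bar>\<close>.\<close>

lemma AE_le_of_dyadic_averages_le:
  fixes c :: "real^'n" and g :: "real^'n \<Rightarrow> ennreal"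
  assumes l: "0 < l" and g: "g \<in> borel_measurable lebesgue" and lam: "lam < top"
    and A: "A \<in> sets lebesgue" "A \<subseteq> cube c l"
    and gt: "\<And>x. x \<in> A \<Longrightarrow> lam < g x"
    and avg: "\<And>x k. x \<in> A \<Longrightarrow> (\<integral>\<^sup>+y\<in>dcube c l k x. g y \<partial>lebesgue)
        \<le> lam * emeasure lebesgue (dcube c l k x)"
  shows "emeasure lebesgue A = 0"
proof -
  define G where "G = density lebesgue g"
  have Gem: "emeasure G S = (\<integral>\<^sup>+y\<in>S. g y \<partial>lebesgue)" if "S \<in> sets lebesgue" for S
    unfolding G_def using g that by (rule emeasure_density)
  have setsG: "sets G = sets lebesgue" by (simp add: G_def)
  have Afin: "emeasure lebesgue A < top"
  proof -
    have "emeasure lebesgue A \<le> emeasure lebesgue (cube c l)"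
      using A by (intro emeasure_mono) auto
    also have "\<dots> < top" using l by (subst emeasure_cube) auto
    finally show ?thesis .
  qed
  have approx: "emeasure G A \<le> lam * (emeasure lebesgue A + ennreal e)" if e: "e > 0" for e :: real
  proof -
    obtain U where U: "open U" "A \<subseteq> U" "U - A \<in> lmeasurable" "emeasure lebesgue (U - A) < ennreal e"
      using sets_lebesgue_outer_open[OF A(1) e] by blast
    have UL: "U \<in> sets lebesgue" using U(1) by auto
    \<comment> \<open>Meeting \<open>A\<close> is part of the condition: a selected cube can then be
      renamed by a point of \<open>A\<close>, where \<open>avg\<close> applies.\<close>
    define P where "P S \<longleftrightarrow> S \<subseteq> U \<and> S \<inter> A \<noteq> {}" for S
    obtain F where F: "countable F" "disjoint F" "\<Union>F = {x \<in> cube c l. \<exists>k. P (dcube c l k x)}"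
      "\<And>J. J \<in> F \<Longrightarrow> \<exists>x\<in>cube c l. \<exists>k. J = dcube c l k x \<and> P J \<and> (\<forall>j<k. \<not> P (dcube c l j x))"
      using dyadic_selection[OF l, of c P] by blast
    have J: "J \<in> sets G \<and> J \<in> sets lebesgue \<and> emeasure G (UNIV \<inter> J) \<le> lam * emeasure lebesgue J"
      if JF: "J \<in> F" for J
    proof -
      obtain x k where xk: "J = dcube c l k x" "P J" using F(4)[OF JF] by blast
      then obtain z where z: "z \<in> A" "z \<in> dcube c l k x" unfolding P_def by blast
      then have "J = dcube c l k z" using dcube_eq[OF l z(2)] xk by simp
      then show ?thesis using avg[OF z(1), of k] by (simp add: Gem setsG)
    qed
    have FL: "\<Union>F \<in> sets lebesgue"
      using F(1) J by (intro sets.countable_Union) auto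
    have AF: "A \<subseteq> \<Union>F"
    proof
      fix x assume x: "x \<in> A"
      then obtain k where "dcube c l k x \<subseteq> U" using dcube_subset_open[OF l U(1), of x c] U(2)
          by blast
      then have "P (dcube c l k x)" using x dcube_refl[OF l, of x c k] by (auto simp: P_def)
      then show "x \<in> \<Union>F" using x A F(3) by blast
    qed
    have FU: "\<Union>F \<subseteq> U" using F(4) by (auto simp: P_def)
    have "emeasure G A \<le> emeasure G (UNIV \<inter> \<Union>F)"
      using AF FL by (intro emeasure_mono) (auto simp: setsG)
    also have "\<dots> \<le> lam * emeasure lebesgue (\<Union>F)"
      by (intro emeasure_disjoint_Union_le F J) (simp add: setsG)
    also have "emeasure lebesgue (\<Union>F) \<le> emeasure lebesgue U"
      using FU UL by (intro emeasure_mono)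
    also have "emeasure lebesgue U = emeasure lebesgue A + emeasure lebesgue (U - A)"
    proof -
      have "emeasure lebesgue A + emeasure lebesgue (U - A) = emeasure lebesgue (A \<union> (U - A))"
        using A(1) UL by (intro plus_emeasure sets.Diff) blast+
      moreover have "A \<union> (U - A) = U" using U(2) by blast
      ultimately show ?thesis by simp
    qed
    also have "\<dots> \<le> emeasure lebesgue A + ennreal e"
      using U(4) by (intro add_left_mono) simp
    finally show ?thesis by (simp add: mult_left_mono)
  qed
  \<comment> \<open>Let \<open>e\<close> tend to 0. As \<open>g\<close> exceeds \<open>lam\<close>
    on \<open>A\<close>, the mass of \<open>A\<close> under \<open>G\<close> is
    \<open>lam * emeasure lebesgue A\<close> plus the integral of the excess \<open>g - lam\<close>;
    finiteness of the first term forces the second to vanish.\<close>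
  have le: "emeasure G A \<le> lam * emeasure lebesgue A"
  proof (rule tendsto_lowerbound)
    have "((\<lambda>e. lam * (emeasure lebesgue A + ennreal e)) \<longlongrightarrow> lam * (emeasure lebesgue A + ennreal 0))
        (at_right 0)"
      using lam Afin
      by (intro ennreal_tendsto_cmult tendsto_add tendsto_const tendsto_ennrealI tendsto_ident_at)
          auto
    then show "((\<lambda>e. lam * (emeasure lebesgue A + ennreal e)) \<longlongrightarrow> lam * emeasure lebesgue A)
        (at_right 0)"
      by simp
    show "\<forall>\<^sub>F e in at_right 0. emeasure G A \<le> lam * (emeasure lebesgue A + ennreal e)"
      using approx by (auto simp: eventually_at_right_field intro!: exI[of _ 1])
  qed auto
  have [measurable]: "g \<in> borel_measurable lebesgue" "A \<in> sets lebesgue" using g A by auto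
  have eq: "emeasure G A = lam * emeasure lebesgue A + (\<integral>\<^sup>+y. (g y - lam)
      * indicator A y \<partial>lebesgue)"
  proof -
    have "emeasure G A = (\<integral>\<^sup>+y. lam * indicator A y + (g y - lam) * indicator A y \<partial>lebesgue)"
      unfolding Gem[OF A(1)]
    proof (intro nn_integral_cong)
      fix y show "g y * indicator A y = lam * indicator A y + (g y - lam) * indicator A y"
        using gt[of y] lam by (cases "y \<in> A") (simp_all add: less_imp_le add_diff_inverse_ennreal)
    qed
    also have "\<dots> = (\<integral>\<^sup>+y. lam * indicator A y \<partial>lebesgue) + (\<integral>\<^sup>+y. (g y - lam)
        * indicator A y \<partial>lebesgue)"
      by (intro nn_integral_add) auto
    finally show ?thesis using A by (simp add: nn_integral_cmult_indicator del: emeasure_completion)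
  qed
  have fin: "lam * emeasure lebesgue A < top"
    using lam Afin by (simp add: ennreal_mult_less_top)
  have "(\<integral>\<^sup>+y. (g y - lam) * indicator A y \<partial>lebesgue) = 0"
  proof -
    have "lam * emeasure lebesgue A + (\<integral>\<^sup>+y. (g y - lam) * indicator A y \<partial>lebesgue) \<le>
        lam * emeasure lebesgue A + 0"
      using le unfolding eq by simp
    then show ?thesis
      unfolding ennreal_add_left_cancel_le using fin by (auto simp: infinity_ennreal_def)
  qed
  then have "AE y in lebesgue. (g y - lam) * indicator A y = 0"
    by (subst (asm) nn_integral_0_iff_AE) auto
  moreover have "(g y - lam) * indicator A y \<noteq> 0" if "y \<in> A" for y
    using gt[OF that] that by (simp add: diff_eq_0_iff_ennreal not_le)
  ultimately have "AE y in lebesgue. y \<notin> A" by (auto elim!: eventually_mono)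
  then show ?thesis
    using AE_iff_measurable[OF A(1), of "\<lambda>y. y \<notin> A"] by simp
qed

section \<open>The John-Nirenberg inequality for weights\<close>

definition set_mean :: "('a::euclidean_space \<Rightarrow> complex) \<Rightarrow> 'a set \<Rightarrow> complex" where
  "set_mean b S = (LINT x:S|lebesgue. b x) /\<^sub>R measure lebesgue S"

text \<open>Used with \<open>z\<close> the mean over a larger set: exchanging one mean for the other
  costs at most the average of |b - z| over the smaller set.\<close>

lemma norm_set_mean_diff_le:
  fixes b :: "'a::euclidean_space \<Rightarrow> complex"
  assumes b: "set_integrable lebesgue S b" and S: "S \<in> sets lebesgue" "0 < measure lebesgue S"
    and le: "(\<integral>\<^sup>+x\<in>S. ennreal (cmod (b x - z)) \<partial>lebesgue) \<le> ennreal C * emeasure lebesgue S"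
    and C: "0 \<le> C"
  shows "cmod (set_mean b S - z) \<le> C"
proof -
  let ?m = "measure lebesgue S"
  have "emeasure lebesgue S \<noteq> top"
    using S(2) by (auto simp: measure_def)
  then have fin: "emeasure lebesgue S = ennreal ?m" "emeasure lebesgue S < top"
    by (simp_all add: emeasure_eq_ennreal_measure less_top)
  have zi: "set_integrable lebesgue S (\<lambda>x. z)"
    unfolding set_integrable_def using S fin
    by (intro integrable_scaleR_left integrable_real_indicator) (auto simp: infinity_ennreal_def)
  have int: "set_integrable lebesgue S (\<lambda>x. b x - z)"
    using b zi by (rule set_integral_diff)
  have "(LINT x:S|lebesgue. b x - z) = (LINT x:S|lebesgue. b x) - (LINT x:S|lebesgue. z)"
    using b zi by (rule set_integral_diff)
  also have "(LINT x:S|lebesgue. z) = ?m *\<^sub>R z"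
    using S fin by (simp add: set_lebesgue_integral_def)
  finally have "(LINT x:S|lebesgue. b x - z) /\<^sub>R ?m = set_mean b S - z"
    using S by (simp add: set_mean_def scaleR_diff_right)
  moreover have "ennreal (cmod (LINT x:S|lebesgue. b x - z))
      \<le> (\<integral>\<^sup>+x\<in>S. ennreal (cmod (b x - z)) \<partial>lebesgue)"
  proof -
    have "ennreal (cmod (LINT x:S|lebesgue. b x - z)) \<le>
        (\<integral>\<^sup>+x. norm (indicator S x *\<^sub>R (b x - z)) \<partial>lebesgue)"
      using int unfolding set_integrable_def set_lebesgue_integral_def
          by (rule integral_norm_bound_ennreal)
    also have "\<dots> = (\<integral>\<^sup>+x\<in>S. ennreal (cmod (b x - z)) \<partial>lebesgue)"
      by (intro nn_integral_cong) (simp split: split_indicator)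
    finally show ?thesis .
  qed
  then have "ennreal (cmod (LINT x:S|lebesgue. b x - z)) \<le> ennreal (C * ?m)"
    using le C fin(1) by (simp add: ennreal_mult)
  then have "cmod (LINT x:S|lebesgue. b x - z) \<le> C * ?m"
    using C S by (subst (asm) ennreal_le_iff) auto
  then have "cmod ((LINT x:S|lebesgue. b x - z) /\<^sub>R ?m) \<le> C"
    using S(2) by (simp add: divide_inverse[symmetric] pos_divide_le_eq mult.commute[of
        "inverse _"])
  ultimately show ?thesis by simp
qed

text \<open>One stopping time at height \<open>2\<beta>\<close>, for all cubes at once, is iterated by induction on \<open>k\<close>. Of the
  measure it is only used that one half of a cube carries a fixed fraction \<open>\<kappa>\<close> of its mass; in
  particular no reverse Hoelder inequality is needed.\<close>

theorem weighted_John_Nirenberg: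
  fixes b :: "real^'n \<Rightarrow> complex" and M :: "(real^'n) measure"
  assumes sets: "sets M = sets lebesgue" and ac: "null_sets lebesgue \<subseteq> null_sets M"
    and beta: "0 < \<beta>" and kappa: "0 \<le> \<kappa>" "\<kappa> \<le> 1"
    and bm: "b \<in> borel_measurable lebesgue"
    and b: "\<And>c l. 0 < l \<Longrightarrow> set_integrable lebesgue (cube c l) b"
    and bmo: "\<And>c l. 0 < l \<Longrightarrow> l \<le> L \<Longrightarrow>
      (\<integral>\<^sup>+x\<in>cube c l. ennreal (cmod (b x - set_mean b (cube c l))) \<partial>lebesgue)
      \<le> ennreal \<beta> * emeasure lebesgue (cube c l)"
    and fin: "\<And>c l. emeasure M (cube c l) < top"
    and ainf: "\<And>c l E. 0 < l \<Longrightarrow> l \<le> L \<Longrightarrow> E \<in> sets lebesgue \<Longrightarrow> E \<subseteq> cube c l \<Longrightarrow>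
      emeasure lebesgue (cube c l) \<le> 2 * emeasure lebesgue E \<Longrightarrow>
      ennreal \<kappa> * emeasure M (cube c l) \<le> emeasure M E"
  assumes "0 < l" "l \<le> L"
  shows "emeasure M {x \<in> cube c l. real k * (2 ^ Suc CARD('n) * \<beta>)
      \<le> cmod (b x - set_mean b (cube c l))}
    \<le> ennreal ((1 - \<kappa>) ^ k) * emeasure M (cube c l)"
  using \<open>0 < l\<close> \<open>l \<le> L\<close>
proof (induction k arbitrary: c l)
  case 0
  have "{x \<in> cube c l. real 0 * (2 ^ Suc CARD('n) * \<beta>) \<le> cmod (b x - set_mean b (cube c l))}
      = cube c l"
    by auto
  then show ?case by simp
next
  case (Suc k)
  note l = Suc.prems(1) and lL = Suc.prems(2)
  define Q where "Q = cube c l"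
  define z where "z = set_mean b Q"
  \<comment> \<open>The stopping height 2\<beta> times the volume ratio \<open>2 ^ CARD('n)\<close>
    of a dyadic parent to its child. The parent of a selected cube did not stop, so \<Lambda> bounds
    the average of |b - z| over the selected cube.\<close>
  define \<Lambda> where "\<Lambda> = 2 ^ Suc CARD('n) * \<beta>"
  define g where "g x = ennreal (cmod (b x - z))" for x
  have gm [measurable]: "g \<in> borel_measurable lebesgue" unfolding g_def using bm by measurable
  define G where "G = density lebesgue g"
  have Gem: "emeasure G S = (\<integral>\<^sup>+y\<in>S. g y \<partial>lebesgue)" if "S \<in> sets lebesgue" for S
    unfolding G_def using gm that by (rule emeasure_density)
  have setsG: "sets G = sets lebesgue" by (simp add: G_def)
  define lam where "lam = ennreal (2 * \<beta>)"
  have QL: "Q \<in> sets lebesgue" unfolding Q_def by (rule cube_lebesgue)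
  have GQ: "emeasure G Q \<le> ennreal \<beta> * emeasure lebesgue Q"
    unfolding Gem[OF QL] unfolding Q_def g_def z_def using bmo[OF l lL] by simp
  define P where "P S \<longleftrightarrow> lam * emeasure lebesgue S < emeasure G S" for S
  obtain F where F: "countable F" "disjoint F" "\<Union>F = {x \<in> Q. \<exists>k. P (dcube c l k x)}"
    "\<And>J. J \<in> F \<Longrightarrow> \<exists>x\<in>Q. \<exists>k. J = dcube c l k x \<and> P J \<and> (\<forall>j<k. \<not> P (dcube c l j x))"
    using dyadic_selection[OF l, of c P] unfolding Q_def by blast
  define T where "T = \<Union>F"
  have FL: "J \<in> sets lebesgue" if "J \<in> F" for J using F(4)[OF that] dcube_lebesgue by blast
  have TL: "T \<in> sets lebesgue" unfolding T_def using F(1) FL by (intro sets.countable_Union) auto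
  have TQ: "T \<subseteq> Q" unfolding T_def F(3) by blast
  have Qfin: "emeasure lebesgue Q < top" using l unfolding Q_def by (subst emeasure_cube) auto
  have beta_inv: "ennreal (1 / \<beta>) * (ennreal \<beta> * X) = X" "ennreal (1 / \<beta>) * (lam * X) = 2 * X" for X
  proof -
    have "ennreal (1 / \<beta>) * ennreal \<beta> = 1" "ennreal (1 / \<beta>) * lam = 2"
      using beta by (simp_all add: lam_def flip: ennreal_mult)
    then show "ennreal (1 / \<beta>) * (ennreal \<beta> * X) = X" "ennreal (1 / \<beta>) * (lam * X) = 2 * X"
      by (simp_all flip: mult.assoc)
  qed
  \<comment> \<open>The average of \<open>g\<close> exceeds 2\<beta> on every selected cube and is
    at most \<beta> on \<open>Q\<close>.\<close>
  have T_half: "2 * emeasure lebesgue T \<le> emeasure lebesgue Q"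
  proof -
    have "emeasure (density lebesgue (\<lambda>_. lam)) (UNIV \<inter> \<Union>F) \<le> 1 * emeasure G (\<Union>F)"
    proof (rule emeasure_disjoint_Union_le[OF F(1,2)])
      fix J assume J: "J \<in> F"
      have "P J" using F(4)[OF J] by blast
      then show "J \<in> sets (density lebesgue (\<lambda>_. lam)) \<and> J \<in> sets G \<and>
          emeasure (density lebesgue (\<lambda>_. lam)) (UNIV \<inter> J) \<le> 1 * emeasure G J"
        using FL[OF J] by (simp add: P_def setsG emeasure_density_const less_imp_le)
    qed simp
    then have "lam * emeasure lebesgue T \<le> emeasure G T"
      using TL by (simp add: T_def[symmetric] emeasure_density_const)
    also have "\<dots> \<le> emeasure G Q" using TQ QL by (intro emeasure_mono) (auto simp: setsG)
    also note GQ
    finally have "ennreal (1 / \<beta>) * (lam * emeasure lebesgue T) \<le> ennreal (1 / \<beta>)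
        * (ennreal \<beta> * emeasure lebesgue Q)"
      by (rule mult_left_mono) simp
    then show ?thesis unfolding beta_inv .
  qed
  have split: "emeasure N Q = emeasure N T + emeasure N (Q - T)" if "sets N = sets lebesgue" for N
  proof -
    have "emeasure N T + emeasure N (Q - T) = emeasure N (T \<union> (Q - T))"
      using TL QL that by (intro plus_emeasure) auto
    moreover have "T \<union> (Q - T) = Q" using TQ by blast
    ultimately show ?thesis by simp
  qed
  have half: "emeasure lebesgue Q \<le> 2 * emeasure lebesgue (Q - T)"
  proof -
    have Tf: "emeasure lebesgue T < top"
      using emeasure_mono[OF TQ QL] Qfin by simp
    have "emeasure lebesgue T + emeasure lebesgue T \<le> emeasure lebesgue T + emeasure lebesgue (Q
        - T)"
      using T_half split[of lebesgue] by (simp add: mult_2)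
    then have "emeasure lebesgue T \<le> emeasure lebesgue (Q - T)"
      unfolding ennreal_add_left_cancel_le using Tf by (auto simp: infinity_ennreal_def)
    then show ?thesis unfolding split[of lebesgue, OF refl] mult_2 by (rule add_right_mono)
  qed
  \<comment> \<open>The complement of \<open>T\<close> has at least half of the volume. Applying
    \<open>ainf\<close> to it, and not to \<open>T\<close>, makes \<open>T\<close> lose the fraction
    \<kappa> of the mass.\<close>
  have MT: "emeasure M T \<le> ennreal (1 - \<kappa>) * emeasure M Q"
  proof -
    have "ennreal \<kappa> * emeasure M Q \<le> emeasure M (Q - T)"
      using ainf[OF l lL, of "Q - T" c] TL QL half unfolding Q_def by blast
    then have "emeasure M T + ennreal \<kappa> * emeasure M Q \<le> emeasure M Q"
      unfolding split[OF sets] by (rule add_left_mono)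
    also have "emeasure M Q = ennreal (1 - \<kappa>) * emeasure M Q + ennreal \<kappa> * emeasure M Q"
      using kappa by (simp flip: distrib_right ennreal_plus)
    finally have "ennreal \<kappa> * emeasure M Q + emeasure M T \<le> ennreal \<kappa> * emeasure M Q
        + ennreal (1 - \<kappa>) * emeasure M Q"
      by (simp add: add.commute)
    moreover have "ennreal \<kappa> * emeasure M Q < top"
      using fin[of c l] by (simp add: Q_def ennreal_mult_less_top)
    ultimately show ?thesis
      unfolding ennreal_add_left_cancel_le by (auto simp: infinity_ennreal_def)
  qed
  define E where "E = {x \<in> Q. real (Suc k) * \<Lambda> \<le> cmod (b x - z)}"
  have EL: "E \<in> sets lebesgue"
    unfolding E_def using bm QL by measurable
  have stopping: "emeasure M (E \<inter> J) \<le> ennreal ((1 - \<kappa>) ^ k) * emeasure M J" if JF: "J \<in> F" for J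
  proof -
    obtain x j where x: "x \<in> Q" "J = dcube c l j x" "P J" "\<And>i. i < j \<Longrightarrow> \<not> P (dcube c l i x)"
      using F(4)[OF JF] by blast
    \<comment> \<open>As \<open>Q\<close> itself does not stop, every selected cube has generation
      at least 1 and thus a dyadic parent that did not stop.\<close>
    have notPQ: "\<not> P Q"
    proof -
      have "ennreal \<beta> * emeasure lebesgue Q \<le> lam * emeasure lebesgue Q"
        using beta by (intro mult_right_mono) (auto simp: lam_def intro!: ennreal_leI)
      then show ?thesis using GQ unfolding P_def by (meson leD order_trans)
    qed
    have "dcube c l 0 x = Q" using dcube_0[OF l, of x c] x(1) unfolding Q_def by blast
    then have "j \<noteq> 0" using notPQ x(2,3) by metis
    then obtain i where i: "j = Suc i" by (cases j) auto
    define J' where "J' = dcube c l i x"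
    have "\<not> P J'" using x(4)[of i] i by (simp add: J'_def)
    then have GJ': "emeasure G J' \<le> lam * emeasure lebesgue J'" by (simp add: P_def not_less)
    have "J \<subseteq> J'" unfolding J'_def x(2) i by (rule dcube_Suc_subset[OF l])
    have dJ: "emeasure lebesgue (dcube c l i' x) = ennreal ((l / 2 ^ i') ^ CARD('n))" for i'
      unfolding dcube_def using l by (intro emeasure_cube) simp
    have "(l / 2 ^ i) ^ CARD('n) = 2 ^ CARD('n) * (l / 2 ^ Suc i) ^ CARD('n)"
      by (simp add: power_divide power_mult_distrib)
    then have eJ': "emeasure lebesgue J' = ennreal (2 ^ CARD('n)) * emeasure lebesgue J"
      unfolding J'_def x(2) i dJ using l by (simp add: ennreal_mult)
    have "emeasure G J \<le> emeasure G J'"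
      using \<open>J \<subseteq> J'\<close> by (intro emeasure_mono) (auto simp: J'_def setsG dcube_lebesgue)
    also note GJ'
    also have "lam * emeasure lebesgue J' = ennreal \<Lambda> * emeasure lebesgue J"
    proof -
      have "\<Lambda> = 2 * \<beta> * 2 ^ CARD('n)" by (simp add: \<Lambda>_def)
      then have "ennreal \<Lambda> = lam * ennreal (2 ^ CARD('n))"
        using beta unfolding lam_def
            by (simp only: ennreal_mult mult_nonneg_nonneg zero_le_power zero_le_numeral
            less_imp_le)
      then show ?thesis unfolding eJ' by (simp only: mult.assoc)
    qed
    finally have GJ: "emeasure G J \<le> ennreal \<Lambda> * emeasure lebesgue J" .
    define l' where "l' = l / 2 ^ j"
    define c' where "c' = (\<chi> i. c $ i + l / 2 ^ j * of_int \<lfloor>2 ^ j * (x $ i - c $ i) / l\<rfloor>)"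
    have Jc: "J = cube c' l'" by (simp add: x(2) dcube_def c'_def l'_def)
    have l': "0 < l'" "l' \<le> L"
    proof -
      show "0 < l'" using l by (simp add: l'_def)
      have "l / 2 ^ j \<le> l / 1" using l by (intro divide_left_mono) auto
      then have "l' \<le> l" by (simp add: l'_def)
      then show "l' \<le> L" using lL by simp
    qed
    have zJ: "cmod (set_mean b J - z) \<le> \<Lambda>"
    proof (rule norm_set_mean_diff_le)
      show "set_integrable lebesgue J b" unfolding Jc by (rule b[OF l'(1)])
      show "J \<in> sets lebesgue" by (rule FL[OF JF])
      show "0 < measure lebesgue J" unfolding Jc using l' by (subst measure_cube) auto
      show "(\<integral>\<^sup>+ x\<in>J. ennreal (cmod (b x - z)) \<partial>lebesgue) \<le> ennreal \<Lambda> * emeasure lebesgue J"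
        using GJ unfolding Gem[OF FL[OF JF]] g_def .
      show "0 \<le> \<Lambda>" using beta by (simp add: \<Lambda>_def)
    qed
    \<comment> \<open>Replacing the mean over \<open>Q\<close> by the mean over \<open>J\<close>
      costs one \<Lambda>: level k + 1 on \<open>Q\<close> becomes level k on \<open>J\<close>,
      where the induction hypothesis applies.\<close>
    have "E \<inter> J \<subseteq> {y \<in> J. real k * \<Lambda> \<le> cmod (b y - set_mean b J)}"
    proof
      fix y assume "y \<in> E \<inter> J"
      then have "real (Suc k) * \<Lambda> \<le> cmod (b y - z)" "y \<in> J" by (auto simp: E_def)
      moreover have "cmod (b y - z) \<le> cmod (b y - set_mean b J) + cmod (set_mean b J - z)"
        using norm_triangle_ineq[of "b y - set_mean b J" "set_mean b J - z"] by simp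
      ultimately show "y \<in> {y \<in> J. real k * \<Lambda> \<le> cmod (b y - set_mean b J)}"
        using zJ by (simp add: algebra_simps)
    qed
    moreover have "{y \<in> J. real k * \<Lambda> \<le> cmod (b y - set_mean b J)} \<in> sets M"
      unfolding sets using bm FL[OF JF] by measurable
    ultimately have "emeasure M (E \<inter> J) \<le> emeasure M {y \<in> J. real k * \<Lambda>
        \<le> cmod (b y - set_mean b J)}"
      by (rule emeasure_mono)
    also have "\<dots> \<le> ennreal ((1 - \<kappa>) ^ k) * emeasure M J"
      using Suc.IH[OF l', of c'] unfolding Jc \<Lambda>_def .
    finally show ?thesis .
  qed
  have "emeasure M (E \<inter> T) \<le> ennreal ((1 - \<kappa>) ^ k) * emeasure M T"
    unfolding T_def using stopping FL EL sets by (intro emeasure_disjoint_Union_le[OF F(1,2)]) auto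
  also have "\<dots> \<le> ennreal ((1 - \<kappa>) ^ k) * (ennreal (1 - \<kappa>) * emeasure M Q)"
    by (intro mult_left_mono MT) simp
  also have "\<dots> = ennreal ((1 - \<kappa>) ^ Suc k) * emeasure M Q"
  proof -
    have "ennreal ((1 - \<kappa>) ^ Suc k) = ennreal ((1 - \<kappa>) ^ k) * ennreal (1 - \<kappa>)"
      using kappa by (subst ennreal_mult[symmetric]) (simp_all add: mult.commute)
    then show ?thesis by (simp only: mult.assoc)
  qed
  finally have ET: "emeasure M (E \<inter> T) \<le> ennreal ((1 - \<kappa>) ^ Suc k) * emeasure M Q" .
  \<comment> \<open>Off \<open>T\<close> all dyadic averages of \<open>g\<close> are at most
    2\<beta>, strictly below the threshold that defines \<open>E\<close>. By \<open>ac\<close> the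
    null set found here is null for \<open>M\<close> as well.\<close>
  have "emeasure lebesgue (E - T) = 0"
  proof (rule AE_le_of_dyadic_averages_le[OF l gm, of lam _ c])
    show "lam < top" by (simp add: lam_def)
    show "E - T \<in> sets lebesgue" using EL TL by blast
    show "E - T \<subseteq> cube c l" by (auto simp: E_def Q_def)
    fix x assume x: "x \<in> E - T"
    have "2 * \<beta> < \<Lambda>"
    proof -
      have "(2::real) * 1 < 2 * 2 ^ CARD('n)" by (intro mult_strict_left_mono one_less_power) auto
      then show ?thesis using beta by (simp add: \<Lambda>_def)
    qed
    moreover have "\<Lambda> \<le> real (Suc k) * \<Lambda>" using beta by (simp add: \<Lambda>_def algebra_simps)
    ultimately have "2 * \<beta> < cmod (b x - z)" using x by (auto simp: E_def)
    then show "lam < g x" using beta by (simp add: lam_def g_def ennreal_less_iff)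
    show "(\<integral>\<^sup>+y\<in>dcube c l k x. g y \<partial>lebesgue) \<le> lam * emeasure lebesgue (dcube c l k x)" for k
    proof -
      have "x \<in> Q" using x by (auto simp: E_def)
      then have "\<not> P (dcube c l k x)" using x F(3) unfolding T_def by blast
      then show ?thesis unfolding P_def Gem[OF dcube_lebesgue] by (simp add: not_less)
    qed
  qed
  then have "E - T \<in> null_sets M" using ac EL TL by (auto simp: null_sets_def)
  then have "emeasure M E = emeasure M (E \<inter> T)"
    using emeasure_Diff_null_set[of "E - T" M E] EL sets by (simp add: Diff_Diff_Int)
  then show ?case using ET unfolding E_def Q_def z_def \<Lambda>_def by simp
qed

text \<open>With u = \<kappa> / (4q), the bound s \<le> exp s at s = u (k + 1) gives a factor exp
  (\<kappa> / 4) per step, which is at most 1 + \<kappa> / 2. The constant is a power of 1 /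
  \<kappa>, as it has to be because \<kappa> will depend on the side length.\<close>

lemma powr_le_geometric:
  fixes \<kappa> q :: real
  assumes "0 < \<kappa>" "\<kappa> \<le> 1" "0 < q"
  shows "(real k + 1) powr q \<le> (4 * q / \<kappa>) powr q * (1 + \<kappa> / 2) ^ Suc k"
proof -
  define u where "u = \<kappa> / (4 * q)"
  have u: "u > 0" using assms by (simp add: u_def)
  have "u * (real k + 1) \<le> exp (u * (real k + 1))"
    using exp_ge_add_one_self[of "u * (real k + 1)"] by linarith
  then have "(u * (real k + 1)) powr q \<le> exp (u * (real k + 1)) powr q"
    using assms u by (intro powr_mono2) auto
  also have "exp (u * (real k + 1)) powr q = exp (\<kappa> / 4) ^ Suc k"
  proof -
    have "exp (u * (real k + 1)) powr q = exp (u * (real k + 1) * q)"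
      by (simp add: powr_def mult.commute)
    also have "u * (real k + 1) * q = real (Suc k) * (\<kappa> / 4)"
      using assms by (simp add: u_def field_simps)
    finally show ?thesis unfolding exp_of_nat_mult .
  qed
  also have "\<dots> \<le> (1 + \<kappa> / 2) ^ Suc k"
  proof (rule power_mono)
    show "exp (\<kappa> / 4) \<le> 1 + \<kappa> / 2"
      using exp_bound_lemma[of "\<kappa> / 4"] assms by simp
  qed simp
  finally have *: "u powr q * (real k + 1) powr q \<le> (1 + \<kappa> / 2) ^ Suc k"
    by (simp add: powr_mult)
  have 1: "4 * q / \<kappa> * u = 1" using assms by (simp add: u_def)
  have "(4 * q / \<kappa>) powr q * u powr q = 1"
    by (simp only: powr_mult[symmetric] 1 powr_one_eq_one)
  then have "(real k + 1) powr q = (4 * q / \<kappa>) powr q * (u powr q * (real k + 1) powr q)"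
    by (simp only: mult.assoc[symmetric] mult_1)
  also have "\<dots> \<le> (4 * q / \<kappa>) powr q * (1 + \<kappa> / 2) ^ Suc k"
    by (intro mult_left_mono *) simp
  finally show ?thesis .
qed

text \<open>Layers of thickness \<Lambda>: where k \<Lambda> \<le> g < (k + 1) \<Lambda>, one has 1
  + g \<le> (k + 1)(1 + \<Lambda>). The polynomial factor costs 1 + \<kappa> / 2 per step, and (1 +
  \<kappa> / 2)(1 - \<kappa>) \<le> 1 - \<kappa> / 2 leaves a geometric series with sum 2 /
  \<kappa>.\<close>

lemma moment_le_of_exponential_decay:
  fixes g :: "'a \<Rightarrow> real" and M :: "'a measure"
  assumes g [measurable]: "g \<in> borel_measurable M" "\<And>x. 0 \<le> g x" and Q [measurable]: "Q \<in> sets M"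
    and kap: "0 < \<kappa>" "\<kappa> \<le> 1" and Lam: "0 < \<Lambda>" and q: "0 < q"
    and decay: "\<And>k. emeasure M {x \<in> Q. real k * \<Lambda> \<le> g x} \<le> ennreal ((1 - \<kappa>) ^ k) * emeasure M Q"
  shows "(\<integral>\<^sup>+x\<in>Q. ennreal ((1 + g x) powr q) \<partial>M)
    \<le> ennreal ((1 + \<Lambda>) powr q * (4 * q / \<kappa>) powr q * (4 / \<kappa>)) * emeasure M Q"
proof -
  define a where "a k = ((real k + 1) * (1 + \<Lambda>)) powr q" for k
  define E where "E k = {x \<in> Q. real k * \<Lambda> \<le> g x}" for k
  have E: "E k \<in> sets M" for k unfolding E_def by measurable
  have "(\<integral>\<^sup>+x\<in>Q. ennreal ((1 + g x) powr q) \<partial>M)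
      \<le> (\<integral>\<^sup>+x. (\<Sum>k. ennreal (a k) * indicator (E k) x) \<partial>M)"
  proof (rule nn_integral_mono)
    fix x
    show "ennreal ((1 + g x) powr q) * indicator Q x \<le> (\<Sum>k. ennreal (a k) * indicator (E k) x)"
    proof (cases "x \<in> Q")
      case True
      define k where "k = nat \<lfloor>g x / \<Lambda>\<rfloor>"
      have "0 \<le> g x / \<Lambda>" using g(2) Lam by simp
      then have k: "real k \<le> g x / \<Lambda>" "g x / \<Lambda> < real k + 1" unfolding k_def by linarith+
      then have k': "real k * \<Lambda> \<le> g x" "g x < (real k + 1) * \<Lambda>" using Lam
          by (simp_all add: field_simps)
      have "1 + g x \<le> (real k + 1) * (1 + \<Lambda>)"
        using k'(2) by (simp add: algebra_simps)
      then have "(1 + g x) powr q \<le> a k" unfolding a_def using q g(2)[of x]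
          by (intro powr_mono2) auto
      then have "ennreal ((1 + g x) powr q) * indicator Q x \<le> ennreal (a k) * indicator (E k) x"
        using True k'(1) by (auto simp: E_def intro: ennreal_leI)
      also have "f k \<le> suminf f" for f :: "nat \<Rightarrow> ennreal"
        using sum_le_suminf[of f "{k}"] by simp
      finally show ?thesis .
    qed simp
  qed
  also have "\<dots> = (\<Sum>k. \<integral>\<^sup>+x. ennreal (a k) * indicator (E k) x \<partial>M)"
    using E by (intro nn_integral_suminf) auto
  also have "\<dots> = (\<Sum>k. ennreal (a k) * emeasure M (E k))"
    using E by (simp add: nn_integral_cmult_indicator)
  also have "\<dots> \<le> (\<Sum>k. ennreal ((1 + \<Lambda>) powr q * (4 * q / \<kappa>) powr q * 2 * (1 - \<kappa> / 2) ^ k)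
      * emeasure M Q)"
  proof (intro suminf_le)
    fix k
    define K where "K = (1 + \<Lambda>) powr q * (4 * q / \<kappa>) powr q"
    have "a k = (real k + 1) powr q * (1 + \<Lambda>) powr q" unfolding a_def by (simp add: powr_mult)
    also have "\<dots> \<le> ((4 * q / \<kappa>) powr q * (1 + \<kappa> / 2) ^ Suc k) * (1 + \<Lambda>) powr q"
      using powr_le_geometric[OF kap q, of k] by (intro mult_right_mono) auto
    finally have "a k \<le> K * (1 + \<kappa> / 2) ^ Suc k" by (simp add: K_def ac_simps)
    then have "a k * (1 - \<kappa>) ^ k \<le> K * (1 + \<kappa> / 2) ^ Suc k * (1 - \<kappa>) ^ k"
      using kap by (intro mult_right_mono) auto
    also have "\<dots> = K * (1 + \<kappa> / 2) * ((1 + \<kappa> / 2) * (1 - \<kappa>)) ^ k"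
      unfolding power_mult_distrib by simp
    also have "\<dots> \<le> K * 2 * (1 - \<kappa> / 2) ^ k"
    proof (rule mult_mono)
      show "K * (1 + \<kappa> / 2) \<le> K * 2" using kap by (intro mult_left_mono) (auto simp: K_def)
      have "(1 + \<kappa> / 2) * (1 - \<kappa>) = 1 - \<kappa> / 2 - \<kappa> * \<kappa> / 2" by (simp add: field_simps)
      also have "\<dots> \<le> 1 - \<kappa> / 2" by simp
      finally show "((1 + \<kappa> / 2) * (1 - \<kappa>)) ^ k \<le> (1 - \<kappa> / 2) ^ k"
        using kap by (intro power_mono) auto
    qed (use kap in \<open>auto simp: K_def\<close>)
    finally have le: "a k * (1 - \<kappa>) ^ k \<le> K * 2 * (1 - \<kappa> / 2) ^ k" .
    have "ennreal (a k) * emeasure M (E k) \<le> ennreal (a k) * (ennreal ((1 - \<kappa>) ^ k) * emeasure M Q)"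
      unfolding E_def by (intro mult_left_mono decay) simp
    also have "\<dots> = ennreal (a k * (1 - \<kappa>) ^ k) * emeasure M Q"
      using kap by (subst ennreal_mult) (auto simp: a_def mult.assoc)
    also have "\<dots> \<le> ennreal (K * 2 * (1 - \<kappa> / 2) ^ k) * emeasure M Q"
      by (intro mult_right_mono ennreal_leI le) simp
    finally show "ennreal (a k) * emeasure M (E k) \<le> ennreal ((1 + \<Lambda>) powr q * (4 * q / \<kappa>) powr q
        * 2 * (1 - \<kappa> / 2) ^ k) * emeasure M Q"
      by (simp add: K_def)
  qed auto
  also have "\<dots> = ennreal ((1 + \<Lambda>) powr q * (4 * q / \<kappa>) powr q * (4 / \<kappa>)) * emeasure M Q"
  proof -
    define K where "K = (1 + \<Lambda>) powr q * (4 * q / \<kappa>) powr q * 2"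
    have K: "0 \<le> K" by (simp add: K_def)
    have "(\<lambda>k. K * (1 - \<kappa> / 2) ^ k) sums (K * (1 / (1 - (1 - \<kappa> / 2))))"
      using kap by (intro sums_mult geometric_sums) simp
    then have "(\<Sum>k. ennreal (K * (1 - \<kappa> / 2) ^ k)) = ennreal (K * (1 / (1 - (1 - \<kappa> / 2))))"
      using kap K by (intro suminf_ennreal_eq) auto
    then show ?thesis
      using kap unfolding K_def by (simp add: ac_simps)
  qed
  finally show ?thesis .
qed

section \<open>Weights and mean oscillation\<close>

lemma borel_measurable_locally_integrable:
  assumes "locally_integrable f"
  shows "f \<in> borel_measurable lebesgue"
proof (rule borel_measurable_LIMSEQ_metric)
  fix n :: nat
  show "(\<lambda>x. indicator (cball 0 (real n)) x *\<^sub>R f x) \<in> borel_measurable lebesgue"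
    using assms unfolding locally_integrable_def set_integrable_def
        by (auto intro: borel_measurable_integrable)
next
  fix x
  have "eventually (\<lambda>n. indicator (cball 0 (real n)) x *\<^sub>R f x = f x) sequentially"
    using eventually_ge_at_top[of "nat \<lceil>norm x\<rceil>"]
    by eventually_elim (auto simp: indicator_def nat_le_iff ceiling_le_iff)
  then show "(\<lambda>n. indicator (cball 0 (real n)) x *\<^sub>R f x) \<longlonglongrightarrow> f x"
    by (rule tendsto_eventually)
qed

lemma locally_integrable_subset:
  assumes "locally_integrable f" "bounded S" "S \<in> sets lebesgue"
  shows "set_integrable lebesgue S f"
proof -
  have "set_integrable lebesgue (closure S) f"
    using assms by (auto simp: locally_integrable_def compact_closure)
  then show ?thesis
    by (rule set_integrable_subset) (use assms closure_subset in auto)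
qed

lemma emeasure_weighted:
  "w \<in> borel_measurable lebesgue \<Longrightarrow> S \<in> sets lebesgue \<Longrightarrow>
    emeasure (weighted w) S = (\<integral>\<^sup>+x\<in>S. ennreal (w x) \<partial>lebesgue)"
  unfolding weighted_def by (rule emeasure_density) auto

lemma sets_weighted [simp]: "sets (weighted w) = sets lebesgue"
  by (simp add: weighted_def)

lemma space_weighted [simp]: "space (weighted w) = UNIV"
  by (simp add: weighted_def)

lemma null_sets_weighted: "w \<in> borel_measurable lebesgue \<Longrightarrow>
    null_sets lebesgue \<subseteq> null_sets (weighted w)"
  unfolding weighted_def
      by (intro subsetI absolutely_continuousI_density[unfolded absolutely_continuous_def, THEN
      subsetD]) auto

lemma cube_bounded: "bounded (cube c l)"
  by (rule bounded_subset[OF bounded_cbox cube_subset_cbox])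

lemma emeasure_weighted_finite:
  assumes "locally_integrable w" "bounded S" "S \<in> sets lebesgue" "\<And>x. 0 \<le> w x"
  shows "emeasure (weighted w) S < top"
proof -
  have wm: "w \<in> borel_measurable lebesgue" using assms(1)
      by (rule borel_measurable_locally_integrable)
  have "set_integrable lebesgue S w" by (rule locally_integrable_subset[OF assms(1-3)])
  then have "(\<integral>\<^sup>+x. norm (indicator S x *\<^sub>R w x) \<partial>lebesgue) < \<infinity>"
    unfolding set_integrable_def integrable_iff_bounded by blast
  also have "(\<integral>\<^sup>+x. norm (indicator S x *\<^sub>R w x) \<partial>lebesgue) = (\<integral>\<^sup>+x\<in>S. ennreal (w x) \<partial>lebesgue)"
    using assms(4) by (intro nn_integral_cong) (auto split: split_indicator)
  finally show ?thesis using emeasure_weighted[OF wm assms(3)] by (simp add: infinity_ennreal_def)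
qed

text \<open>Here \<open>s\<close> stands for the dual weight \<open>w\<^bsup>-1/(p-1)\<^esup>\<close>. Written in this way the condition is symmetric
  under exchanging \<open>(w, p)\<close> and \<open>(s, p')\<close>.\<close>

definition weight_pair :: "real \<Rightarrow> (real^'n \<Rightarrow> real) \<Rightarrow> (real^'n \<Rightarrow> real) \<Rightarrow> real \<Rightarrow> real \<Rightarrow> bool" where
  "weight_pair p w s C \<theta> \<longleftrightarrow> 1 < p \<and> 1 \<le> C \<and> 0 \<le> \<theta> \<and>
     w \<in> borel_measurable lebesgue \<and> s \<in> borel_measurable lebesgue \<and>
     (\<forall>x. 0 \<le> w x) \<and> (\<forall>x. 0 \<le> s x) \<and>
     (AE x in lebesgue. w x powr (1 / p) * s x powr (1 - 1 / p) = 1) \<and>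
     (\<forall>c l. emeasure (weighted w) (cube c l) < top) \<and> (\<forall>c l. emeasure (weighted s) (cube c l)
         < top) \<and>
     (\<forall>c. \<forall>l>0. measure (weighted w) (cube c l) powr (1 / p) * measure (weighted s) (cube c l) powr
         (1 - 1 / p)
        \<le> C * l ^ CARD('n) * (1 + l) powr \<theta>)"

lemma weight_pair_swap:
  assumes "weight_pair p w s C \<theta>"
  shows "weight_pair (p / (p - 1)) s w C \<theta>"
proof -
  have p: "1 < p" using assms by (simp add: weight_pair_def)
  have e: "1 / (p / (p - 1)) = 1 - 1 / p" "1 - (1 - 1 / p) = 1 / p" "1 < p / (p - 1)"
    using p by (auto simp: field_simps)
  show ?thesis using assms e(3) unfolding weight_pair_def e(1,2) by (auto simp: mult.commute)
qed

text \<open>Hoelder's inequality on \<open>E\<close> with w^(1/p) s^(1 - 1/p) = 1 gives |E|^p \<le>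
  w(E) s(E)^(p-1). After s(E) \<le> s(Q) and multiplication by w(Q), the weight condition on the
  whole cube bounds the right-hand side. The inverse of the constant becomes the \<kappa> of the
  John-Nirenberg inequality.\<close>

lemma weight_pair_A_infinity:
  fixes c :: "real^'n"
  assumes wp: "weight_pair p w s C \<theta>" and l: "0 < l"
    and E: "E \<in> sets lebesgue" "E \<subseteq> cube c l" "emeasure lebesgue (cube c l)
        \<le> 2 * emeasure lebesgue E"
  shows "measure (weighted w) (cube c l) \<le> (2 * C * (1 + l) powr \<theta>) powr p * measure (weighted w) E"
proof -
  let ?W = "weighted w" and ?S = "weighted s" and ?Q = "cube c l"
  have p: "1 < p" and C: "1 \<le> C" and [measurable]: "w \<in> borel_measurable lebesgue" "s
      \<in> borel_measurable lebesgue"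
    and nonneg: "\<And>x. 0 \<le> w x" "\<And>x. 0 \<le> s x"
    and AE: "AE x in lebesgue. w x powr (1 / p) * s x powr (1 - 1 / p) = 1"
    and fin: "emeasure ?W ?Q < top" "emeasure ?S ?Q < top"
    and Ap: "measure ?W ?Q powr (1 / p) * measure ?S ?Q powr (1 - 1 / p) \<le> C * l ^ CARD('n)
        * (1 + l) powr \<theta>"
    using wp l unfolding weight_pair_def by blast+
  have [measurable]: "E \<in> sets lebesgue" by fact
  have WE: "emeasure ?W E \<le> emeasure ?W ?Q" "emeasure ?S E \<le> emeasure ?S ?Q" "emeasure lebesgue E
      \<le> emeasure lebesgue ?Q"
    by (auto intro!: emeasure_mono E)
  have lebQ: "emeasure lebesgue ?Q = ennreal (l ^ CARD('n))" using l by (intro emeasure_cube) simp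
  have reals: "emeasure ?W E = ennreal (measure ?W E)" "emeasure ?S E = ennreal (measure ?S E)"
    "emeasure lebesgue E = ennreal (measure lebesgue E)" "emeasure ?S ?Q = ennreal (measure ?S ?Q)"
    using WE fin lebQ by (auto intro!: emeasure_eq_ennreal_measure simp: less_top top_unique)
  have "epowr (emeasure lebesgue E) p = epowr (\<integral>\<^sup>+x. ennreal (w x powr (1 / p)) * indicator E x *
      (ennreal (s x powr (1 - 1 / p)) * indicator E x) \<partial>lebesgue) p"
  proof -
    have "emeasure lebesgue E = (\<integral>\<^sup>+x. indicator E x \<partial>lebesgue)" by simp
    also have "\<dots> = (\<integral>\<^sup>+x. ennreal (w x powr (1 / p)) * indicator E x *
      (ennreal (s x powr (1 - 1 / p)) * indicator E x) \<partial>lebesgue)"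
    proof (rule nn_integral_cong_AE)
      show "AE x in lebesgue. indicator E x = ennreal (w x powr (1 / p)) * indicator E x *
        (ennreal (s x powr (1 - 1 / p)) * indicator E x)"
        using AE
      proof eventually_elim
        case (elim x)
        then have "ennreal (w x powr (1 / p)) * ennreal (s x powr (1 - 1 / p)) = 1"
          by (subst ennreal_mult[symmetric]) auto
        then show ?case by (simp split: split_indicator)
      qed
    qed
    finally show ?thesis by simp
  qed
  also have "\<dots> \<le> (\<integral>\<^sup>+x. epowr (ennreal (w x powr (1 / p)) * indicator E x) p \<partial>lebesgue) *
      epowr (\<integral>\<^sup>+x. epowr (ennreal (s x powr (1 - 1 / p)) * indicator E x) (p / (p - 1)) \<partial>lebesgue)
          (p - 1)"
    using p by (intro Holder_nn_integral) auto
  also have "(\<integral>\<^sup>+x. epowr (ennreal (w x powr (1 / p)) * indicator E x) p \<partial>lebesgue) = emeasure ?W E"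
    using p nonneg by (subst emeasure_weighted)
        (auto intro!: nn_integral_cong split: split_indicator simp: powr_powr)
  also have "(\<integral>\<^sup>+x. epowr (ennreal (s x powr (1 - 1 / p)) * indicator E x) (p / (p - 1)) \<partial>lebesgue)
      = emeasure ?S E"
  proof -
    have "(1 - 1 / p) * (p / (p - 1)) = 1" using p by (simp add: field_simps)
    then show ?thesis
      using nonneg by (subst emeasure_weighted)
          (auto intro!: nn_integral_cong split: split_indicator simp: powr_powr)
  qed
  also have "emeasure ?W E * epowr (emeasure ?S E) (p - 1) \<le> emeasure ?W E * epowr (emeasure ?S ?Q)
      (p - 1)"
    using p WE by (intro mult_left_mono epowr_mono) auto
  finally have "ennreal (measure lebesgue E powr p)
      \<le> ennreal (measure ?W E * measure ?S ?Q powr (p - 1))"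
    unfolding reals by (simp add: ennreal_mult)
  then have H: "measure lebesgue E powr p \<le> measure ?W E * measure ?S ?Q powr (p - 1)"
    by (subst (asm) ennreal_le_iff) auto
  \<comment> \<open>The volume of the cube, not the dimension.\<close>
  define n where "n = l ^ CARD('n)"
  have n: "n > 0" using l by (simp add: n_def)
  have "ennreal n \<le> ennreal (2 * measure lebesgue E)"
    using E(3) unfolding lebQ reals n_def[symmetric] by (simp add: ennreal_mult)
  then have nE: "n / 2 \<le> measure lebesgue E" by (subst (asm) ennreal_le_iff) auto
  have "(n / 2) powr p * measure ?W ?Q \<le> measure ?W E * measure ?S ?Q powr (p - 1) * measure ?W ?Q"
    using powr_mono2[OF _ _ nE, of p] n p H by (intro mult_right_mono) auto
  also have "\<dots> = measure ?W E * (measure ?W ?Q powr (1 / p) * measure ?S ?Q powr (1 - 1 / p)) powr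
      p"
  proof -
    have "(1 - 1 / p) * p = p - 1" "1 / p * p = 1" using p by (simp_all add: field_simps)
    then have "(measure ?W ?Q powr (1 / p) * measure ?S ?Q powr (1 - 1 / p)) powr p
        = measure ?W ?Q * measure ?S ?Q powr (p - 1)"
      by (simp only: powr_mult powr_powr) simp
    then show ?thesis by (simp only: ac_simps)
  qed
  also have "\<dots> \<le> measure ?W E * (C * n * (1 + l) powr \<theta>) powr p"
    using Ap p unfolding n_def by (intro mult_left_mono powr_mono2) auto
  also have "\<dots> = (n / 2) powr p * ((2 * C * (1 + l) powr \<theta>) powr p * measure ?W E)"
  proof -
    have "C * n * (1 + l) powr \<theta> = (n / 2) * (2 * C * (1 + l) powr \<theta>)" by simp
    then have "(C * n * (1 + l) powr \<theta>) powr p = (n / 2) powr p * (2 * C * (1 + l) powr \<theta>) powr p"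
      by (simp only: powr_mult)
    then show ?thesis by (simp only: ac_simps)
  qed
  finally show ?thesis using n by (simp add: mult_le_cancel_left_pos)
qed

section \<open>From balls to cubes, and weighted moments of the oscillation\<close>

lemma one_plus_mult_powr_le:
  fixes l \<theta> :: real
  assumes "0 \<le> l" "0 \<le> \<theta>"
  shows "(1 + real (CARD('n::finite)) * l) powr \<theta> \<le> real CARD('n) powr \<theta> * (1 + l) powr \<theta>"
proof -
  have "1 \<le> real CARD('n)" by (simp add: Suc_leI)
  then have "1 + real CARD('n) * l \<le> real CARD('n) * (1 + l)" by (simp add: algebra_simps)
  then have "(1 + real CARD('n) * l) powr \<theta> \<le> (real CARD('n) * (1 + l)) powr \<theta>"
    using assms by (intro powr_mono2) auto
  then show ?thesis by (simp add: powr_mult)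
qed

lemma measure_ball_lebesgue:
  "0 \<le> r \<Longrightarrow> measure lebesgue (ball x r :: (real^'n) set) = unit_ball_vol (real CARD('n))
      * r ^ CARD('n)"
  using content_ball[of r x] by (simp add: measure_completion)

text \<open>The cube lies in the ball about its corner whose radius is the dimension times
  \<open>l\<close>; \<open>v\<close> is the volume ratio. The ball mean is then exchanged for the
  cube mean, which at most doubles the bound.\<close>

lemma BMO_cube_bound:
  fixes b :: "real^'n \<Rightarrow> complex"
  assumes "b \<in> BMO_inf"
  obtains C \<theta> where "1 \<le> C" "0 \<le> \<theta>"
    "\<And>c l. 0 < l \<Longrightarrow> (\<integral>\<^sup>+x\<in>cube c l. ennreal (cmod (b x - set_mean b (cube c l))) \<partial>lebesgue)
       \<le> ennreal (C * (1 + l) powr \<theta>) * emeasure lebesgue (cube c l)"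
proof -
  obtain \<theta> where th: "0 < \<theta>" "b \<in> BMO \<theta>" using assms by (auto simp: BMO_inf_def)
  then obtain C0 where li: "locally_integrable b"
    and C0: "\<And>x r. 0 < r \<Longrightarrow> ball_mean (\<lambda>y. norm (b y - ball_mean b x r)) x r \<le> C0 * (1 + r) powr \<theta>"
    unfolding BMO_def by blast
  have [measurable]: "b \<in> borel_measurable lebesgue"
      by (rule borel_measurable_locally_integrable[OF li])
  define N where "N = real CARD('n)"
  define v where "v = unit_ball_vol N * N ^ CARD('n)"
  have N: "1 \<le> N" by (simp add: N_def Suc_leI)
  have v: "0 < v" using N by (auto simp: v_def intro!: mult_pos_pos unit_ball_vol_pos)
  \<comment> \<open>The factor 2 pays for the change of mean. The absolute value is there because
    the constant in \<open>BMO\<close> may be negative, and the maximum with 1 will keep \<beta>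
    positive.\<close>
  define C where "C = max 1 (2 * (\<bar>C0\<bar> * v * N powr \<theta>))"
  show ?thesis
  proof (rule that)
    show "1 \<le> C" by (simp add: C_def)
    show "0 \<le> \<theta>" using th by simp
    fix c :: "real^'n" and l :: real assume l: "0 < l"
    let ?Q = "cube c l" and ?B = "ball c (N * l)"
    define z where "z = ball_mean b c (N * l)"
    have r: "0 < N * l" using N l by simp
    have sub: "?Q \<subseteq> ?B" using cube_subset_ball[of c l] by (simp add: N_def)
    have mB: "measure lebesgue ?B = v * l ^ CARD('n)"
      using r by (subst measure_ball_lebesgue) (simp_all add: v_def N_def power_mult_distrib)
    have mBpos: "0 < measure lebesgue ?B" using v l by (simp add: mB)
    have eQ: "emeasure lebesgue ?Q = ennreal (l ^ CARD('n))" using l by (intro emeasure_cube) simp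
    have bI: "set_integrable lebesgue ?B b" by (rule locally_integrable_subset[OF li]) auto
    have zI: "set_integrable lebesgue S (\<lambda>x. z)" if "S \<in> sets lebesgue" "bounded S"
        for S :: "(real^'n) set"
    proof -
      have "S \<in> lmeasurable" using that by (simp add: bounded_set_imp_lmeasurable)
      then show ?thesis unfolding set_integrable_def
        by (intro integrable_scaleR_left integrable_real_indicator) (auto simp: fmeasurable_def)
    qed
    have int: "set_integrable lebesgue ?B (\<lambda>y. b y - z)"
      by (intro set_integral_diff bI zI) auto
    have intn: "integrable lebesgue (\<lambda>x. indicator ?B x *\<^sub>R norm (b x - z))"
    proof -
      have "integrable lebesgue (\<lambda>x. norm (indicator ?B x *\<^sub>R (b x - z)))"
        using int unfolding set_integrable_def by (rule integrable_norm)
      moreover have "norm (indicator ?B x *\<^sub>R (b x - z)) = indicator ?B x *\<^sub>R norm (b x - z)" for x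
        by (simp split: split_indicator)
      ultimately show ?thesis by simp
    qed
    define D where "D = (1 + N * l) powr \<theta>"
    have "(LINT y:?B|lebesgue. norm (b y - z)) / measure lebesgue ?B \<le> C0 * D"
      using C0[OF r, of c] unfolding ball_mean_def z_def D_def
          by (simp add: divide_inverse mult.commute)
    then have "(LINT y:?B|lebesgue. norm (b y - z)) \<le> C0 * D * (v * l ^ CARD('n))"
      using mBpos unfolding mB by (simp add: pos_divide_le_eq)
    also have "\<dots> \<le> \<bar>C0\<bar> * (N powr \<theta> * (1 + l) powr \<theta>) * (v * l ^ CARD('n))"
    proof (intro mult_right_mono mult_mono)
      show "D \<le> N powr \<theta> * (1 + l) powr \<theta>"
        unfolding D_def N_def using l th by (intro one_plus_mult_powr_le) auto
    qed (use v l in \<open>auto simp: D_def\<close>)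
    finally have I: "(LINT y:?B|lebesgue. norm (b y - z)) \<le> (\<bar>C0\<bar> * v * N powr \<theta>) * (1 + l) powr \<theta>
        * l ^ CARD('n)"
      by (simp add: ac_simps)
    define K where "K = (\<bar>C0\<bar> * v * N powr \<theta>) * (1 + l) powr \<theta>"
    have K: "0 \<le> K" using v by (simp add: K_def)
    have "(\<integral>\<^sup>+x\<in>?Q. ennreal (cmod (b x - z)) \<partial>lebesgue)
        \<le> (\<integral>\<^sup>+x. ennreal (indicator ?B x *\<^sub>R norm (b x - z)) \<partial>lebesgue)"
      using sub by (intro nn_integral_mono) (auto split: split_indicator)
    also have "\<dots> = ennreal (LINT y:?B|lebesgue. norm (b y - z))"
      unfolding set_lebesgue_integral_def using intn by (intro nn_integral_eq_integral) auto
    also have "\<dots> \<le> ennreal (K * l ^ CARD('n))" unfolding K_def by (intro ennreal_leI I)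
    also have "\<dots> = ennreal K * emeasure lebesgue ?Q" using K l by (simp add: eQ ennreal_mult)
    finally have Qz: "(\<integral>\<^sup>+x\<in>?Q. ennreal (cmod (b x - z)) \<partial>lebesgue)
        \<le> ennreal K * emeasure lebesgue ?Q" .
    have near: "cmod (set_mean b ?Q - z) \<le> K"
    proof (rule norm_set_mean_diff_le[OF _ _ _ Qz K])
      show "set_integrable lebesgue ?Q b"
          by (rule locally_integrable_subset[OF li cube_bounded cube_lebesgue])
      show "0 < measure lebesgue ?Q" using l by (subst measure_cube) auto
    qed (rule cube_lebesgue)
    have "(\<integral>\<^sup>+x\<in>?Q. ennreal (cmod (b x - set_mean b ?Q)) \<partial>lebesgue)
        \<le> (\<integral>\<^sup>+x. ennreal (cmod (b x - z)) * indicator ?Q x + ennreal K * indicator ?Q x \<partial>lebesgue)"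
    proof (intro nn_integral_mono)
      fix x
      have "cmod (b x - set_mean b ?Q) \<le> cmod (b x - z) + K"
        using norm_triangle_ineq4[of "b x - z" "set_mean b ?Q - z"] near by simp
      then have "ennreal (cmod (b x - set_mean b ?Q)) \<le> ennreal (cmod (b x - z)) + ennreal K"
        using K ennreal_leI[of "cmod (b x - set_mean b ?Q)" "cmod (b x - z) + K"] by simp
      then show "ennreal (cmod (b x - set_mean b ?Q)) * indicator ?Q x \<le>
          ennreal (cmod (b x - z)) * indicator ?Q x + ennreal K * indicator ?Q x"
        by (simp split: split_indicator)
    qed
    also have "\<dots> = (\<integral>\<^sup>+x\<in>?Q. ennreal (cmod (b x - z)) \<partial>lebesgue) + ennreal K * emeasure lebesgue ?Q"
      by (subst nn_integral_add) (auto simp: nn_integral_cmult_indicator)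
    also have "\<dots> \<le> ennreal K * emeasure lebesgue ?Q + ennreal K * emeasure lebesgue ?Q"
      by (intro add_right_mono Qz)
    also have "\<dots> = ennreal (2 * K) * emeasure lebesgue ?Q"
      using K by (simp flip: distrib_right ennreal_plus)
    also have "\<dots> \<le> ennreal (C * (1 + l) powr \<theta>) * emeasure lebesgue ?Q"
    proof (intro mult_right_mono ennreal_leI)
      have "2 * K = 2 * (\<bar>C0\<bar> * v * N powr \<theta>) * (1 + l) powr \<theta>" by (simp add: K_def)
      also have "\<dots> \<le> C * (1 + l) powr \<theta>" by (intro mult_right_mono) (auto simp: C_def)
      finally show "2 * K \<le> C * (1 + l) powr \<theta>" .
    qed simp
    finally show "(\<integral>\<^sup>+x\<in>?Q. ennreal (cmod (b x - set_mean b ?Q)) \<partial>lebesgue)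
       \<le> ennreal (C * (1 + l) powr \<theta>) * emeasure lebesgue ?Q" .
  qed
qed

text \<open>The John-Nirenberg inequality is applied with \<open>L = l\<close>: only cubes of side
  at most \<open>l\<close> occur, so \<beta> and \<kappa> taken at scale \<open>l\<close> serve all
  of them, and only their polynomial growth in \<open>l\<close> enters the result.\<close>

theorem BMO_weighted_moments:
  fixes b :: "real^'n \<Rightarrow> complex"
  assumes wp: "weight_pair p w s C \<theta>" and b: "b \<in> BMO_inf" and q: "0 < q"
  obtains K P where "0 \<le> K" "0 \<le> P"
    "\<And>c l. 0 < l \<Longrightarrow>
      (\<integral>\<^sup>+x\<in>cube c l. ennreal ((1 + cmod (b x - set_mean b (cube c l))) powr q) \<partial>weighted w)
        \<le> ennreal (K * (1 + l) powr P) * emeasure (weighted w) (cube c l)"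
proof -
  have p: "1 < p" and C: "1 \<le> C" and th: "0 \<le> \<theta>" and wm: "w \<in> borel_measurable lebesgue"
    and fin: "\<And>c l. emeasure (weighted w) (cube c l) < top"
    using wp unfolding weight_pair_def by blast+
  obtain D \<phi> where D: "1 \<le> D" "0 \<le> \<phi>"
    "\<And>c l. 0 < l \<Longrightarrow> (\<integral>\<^sup>+x\<in>cube c l. ennreal (cmod (b x - set_mean b (cube c l))) \<partial>lebesgue)
       \<le> ennreal (D * (1 + l) powr \<phi>) * emeasure lebesgue (cube c l)"
    using BMO_cube_bound[OF b] by blast
  have li: "locally_integrable b" using b by (auto simp: BMO_inf_def BMO_def)
  have bm [measurable]: "b \<in> borel_measurable lebesgue"
      by (rule borel_measurable_locally_integrable[OF li])
  define A where "A = 2 ^ Suc CARD('n) * D"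
  have "1 * 1 \<le> 2 ^ Suc CARD('n) * D" using D(1) by (intro mult_mono one_le_power) auto
  then have A: "1 \<le> A" by (simp add: A_def)
  \<comment> \<open>Read off from the last estimate of the proof: the moment constant with 1 +
    \<Lambda> \<le> 2 A (1 + l)^\<phi> and 1 / \<kappa> = (2 C (1 + l)^\<theta>)^p inserted. The
    exponents of 1 + l are collected in \<open>P\<close>.\<close>
  define K where "K = (2 * A) powr q * (4 * q) powr q * (2 * C) powr (p * q) * (4 * (2 * C) powr p)"
  define P where "P = \<phi> * q + \<theta> * p * q + \<theta> * p"
  show ?thesis
  proof (rule that)
    show "0 \<le> K" by (simp add: K_def)
    show "0 \<le> P" using D th p q by (simp add: P_def)
    fix c :: "real^'n" and l :: real assume l: "0 < l"
    let ?M = "weighted w"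
    define \<beta> where "\<beta> = D * (1 + l) powr \<phi>"
    define H where "H = (2 * C * (1 + l) powr \<theta>) powr p"
    have H: "1 \<le> H"
    proof -
      have "1 \<le> (1 + l) powr \<theta>" using l th by (simp add: ge_one_powr_ge_zero)
      then have "1 * 1 \<le> 2 * C * (1 + l) powr \<theta>" using C by (intro mult_mono) auto
      then show ?thesis unfolding H_def using p by (simp add: ge_one_powr_ge_zero)
    qed
    define \<kappa> where "\<kappa> = 1 / H"
    have kap: "0 < \<kappa>" "\<kappa> \<le> 1" using H by (auto simp: \<kappa>_def)
    have beta: "0 < \<beta>" using D l by (simp add: \<beta>_def)
    define \<Lambda> where "\<Lambda> = 2 ^ Suc CARD('n) * \<beta>"
    have Lam: "0 < \<Lambda>" using beta by (simp add: \<Lambda>_def)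
    have mono: "(1 + l') powr e \<le> (1 + l) powr e" if "0 < l'" "l' \<le> l" "0 \<le> e" for l' e
      using that by (intro powr_mono2) auto
    have JN: "emeasure ?M {x \<in> cube c l. real k * \<Lambda> \<le> cmod (b x - set_mean b (cube c l))}
      \<le> ennreal ((1 - \<kappa>) ^ k) * emeasure ?M (cube c l)" for k
      unfolding \<Lambda>_def
    proof (rule weighted_John_Nirenberg[where L = l])
      show "sets ?M = sets lebesgue" by simp
      show "null_sets lebesgue \<subseteq> null_sets ?M" by (rule null_sets_weighted[OF wm])
      show "set_integrable lebesgue (cube c l) b" for c l
        by (rule locally_integrable_subset[OF li cube_bounded cube_lebesgue])
      fix c' :: "real^'n" and l' assume l': "0 < l'" "l' \<le> l"
      have "\<beta> \<ge> D * (1 + l') powr \<phi>" unfolding \<beta>_def using D(1,2) l' mono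
          by (intro mult_left_mono) auto
      then show "(\<integral>\<^sup>+x\<in>cube c' l'. ennreal (cmod (b x - set_mean b (cube c' l'))) \<partial>lebesgue)
        \<le> ennreal \<beta> * emeasure lebesgue (cube c' l')"
        by (intro order_trans[OF D(3)[OF l'(1)]] mult_right_mono ennreal_leI) auto
      fix E assume E: "E \<in> sets lebesgue" "E \<subseteq> cube c' l'" "emeasure lebesgue (cube c' l')
          \<le> 2 * emeasure lebesgue E"
      have "measure ?M (cube c' l') \<le> (2 * C * (1 + l') powr \<theta>) powr p * measure ?M E"
        by (rule weight_pair_A_infinity[OF wp l'(1) E])
      also have "\<dots> \<le> H * measure ?M E"
        unfolding H_def using p C th l' mono
            by (intro mult_right_mono powr_mono2 mult_left_mono) auto
      finally have "\<kappa> * measure ?M (cube c' l') \<le> measure ?M E"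
        using H by (simp add: \<kappa>_def divide_le_eq mult.commute)
      moreover have "emeasure ?M (cube c' l') = ennreal (measure ?M (cube c' l'))"
        using fin[of c' l'] by (intro emeasure_eq_ennreal_measure) auto
      moreover have "emeasure ?M E \<le> emeasure ?M (cube c' l')"
        using E by (intro emeasure_mono) auto
      then have "emeasure ?M E = ennreal (measure ?M E)"
        using fin[of c' l'] by (intro emeasure_eq_ennreal_measure) (auto simp: top_unique)
      ultimately show "ennreal \<kappa> * emeasure ?M (cube c' l') \<le> emeasure ?M E"
        using kap by (simp add: ennreal_leI flip: ennreal_mult)
    qed (use kap beta fin l bm in auto)
    have "(\<integral>\<^sup>+x\<in>cube c l. ennreal ((1 + cmod (b x - set_mean b (cube c l))) powr q) \<partial>?M)
      \<le> ennreal ((1 + \<Lambda>) powr q * (4 * q / \<kappa>) powr q * (4 / \<kappa>)) * emeasure ?M (cube c l)"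
      using kap Lam q JN by (intro moment_le_of_exponential_decay)
          (auto simp: measurable_cong_sets[OF sets_weighted refl])
    also have "\<dots> \<le> ennreal (K * (1 + l) powr P) * emeasure ?M (cube c l)"
    proof (intro mult_right_mono ennreal_leI)
      have "1 \<le> (1 + l) powr \<phi>" using l D by (simp add: ge_one_powr_ge_zero)
      then have "1 * 1 \<le> A * (1 + l) powr \<phi>" using A by (intro mult_mono) auto
      then have "1 + \<Lambda> \<le> 2 * A * (1 + l) powr \<phi>" by (simp add: \<Lambda>_def \<beta>_def A_def ac_simps)
      then have 1: "(1 + \<Lambda>) powr q \<le> (2 * A * (1 + l) powr \<phi>) powr q" using q Lam
          by (intro powr_mono2) auto
      have "(1 + \<Lambda>) powr q * (4 * q / \<kappa>) powr q * (4 / \<kappa>) \<le> (2 * A * (1 + l) powr \<phi>) powr q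
          * (4 * q * H) powr q * (4 * H)"
        using 1 H by (simp add: \<kappa>_def mult_right_mono)
      also have "\<dots> = K * (1 + l) powr P"
        unfolding H_def K_def P_def by (simp add: powr_mult powr_powr powr_add ac_simps)
      finally show "(1 + \<Lambda>) powr q * (4 * q / \<kappa>) powr q * (4 / \<kappa>) \<le> K * (1 + l) powr P" .
    qed simp
    finally show "(\<integral>\<^sup>+x\<in>cube c l. ennreal ((1 + cmod (b x - set_mean b (cube c l))) powr q)
        \<partial>weighted w)
        \<le> ennreal (K * (1 + l) powr P) * emeasure (weighted w) (cube c l)" .
  qed
qed

text \<open>The dual weight is \<open>\<infinity>\<close> where \<open>w\<close> vanishes, so it can only be integrable on a ball on which \<open>w\<close> is
  positive almost everywhere; the condition is void (\<open>0 * \<infinity> = 0\<close>) on balls of mass zero.\<close>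

lemma A_weight_cases:
  fixes w :: "real^'n \<Rightarrow> real"
  assumes w: "w \<in> A_weight_inf p" and p: "1 < p"
  obtains (zero) "AE x in lebesgue. w x = 0"
  | (pair) s C \<theta> where "weight_pair p w s C \<theta>"
proof -
  obtain \<theta> where th: "0 \<le> \<theta>" and wA: "w \<in> A_weight p \<theta>"
    using w unfolding A_weight_inf_def by auto
  obtain C0 where w0: "\<And>x. 0 \<le> w x" and li: "locally_integrable w"
    and Ap: "\<And>x r. 0 < r \<Longrightarrow> epowr (\<integral>\<^sup>+y\<in>ball x r. ennreal (w y) \<partial>lebesgue) (1/p) *
        epowr (\<integral>\<^sup>+y\<in>ball x r. epowr (inverse (ennreal (w y))) (1/(p-1)) \<partial>lebesgue) (1 - 1/p)
        \<le> ennreal (C0 * measure lebesgue (ball x r) * (1 + r) powr \<theta>)"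
    using wA unfolding A_weight_def by blast
  have wm [measurable]: "w \<in> borel_measurable lebesgue"
      by (rule borel_measurable_locally_integrable[OF li])
  have ballL [measurable]: "ball x r \<in> sets lebesgue" for x :: "real^'n" and r by auto
  define V where "V y = epowr (inverse (ennreal (w y))) (1/(p-1))" for y
  have Vm [measurable]: "V \<in> borel_measurable lebesgue" unfolding V_def by measurable
  let ?W = "weighted w"
  have Wfin: "emeasure ?W S < top" if "bounded S" "S \<in> sets lebesgue" for S
    by (rule emeasure_weighted_finite[OF li that w0])
  show thesis
  proof (cases "\<forall>N::nat. emeasure ?W (ball 0 (real N)) = 0")
    case True
    have "AE x in lebesgue. ennreal (w x) * indicator (ball 0 (real N)) x = 0" for N
    proof -
      have "(\<integral>\<^sup>+x\<in>ball 0 (real N). ennreal (w x) \<partial>lebesgue) = 0"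
        using True emeasure_weighted[OF wm ballL[of 0 "real N"]] by simp
      then show ?thesis by (subst (asm) nn_integral_0_iff_AE) auto
    qed
    then have "AE x in lebesgue. \<forall>N. ennreal (w x) * indicator (ball 0 (real N)) x = 0"
      unfolding AE_all_countable by blast
    then have "AE x in lebesgue. w x = 0"
    proof eventually_elim
      case (elim x)
      obtain N :: nat where "norm x < real N" using reals_Archimedean2 by blast
      then show ?case using elim[rule_format, of N] w0[of x] by auto
    qed
    then show ?thesis by (rule zero)
  next
    case False
    \<comment> \<open>One ball of positive mass is enough: the larger balls about 0 have positive
      mass too, so on each of them the second factor of the weight condition is finite, and the dual
      weight is locally integrable.\<close>
    then obtain N0 :: nat where N0: "emeasure ?W (ball 0 (real N0)) \<noteq> 0" by blast
    have Sfin0: "(\<integral>\<^sup>+y\<in>ball 0 (real N0 + real m + 1). V y \<partial>lebesgue) < top" for m :: nat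
    proof -
      let ?R = "real N0 + real m + 1"
      have "emeasure ?W (ball 0 (real N0)) \<le> emeasure ?W (ball 0 ?R)" by (intro emeasure_mono) auto
      then have nz: "emeasure ?W (ball 0 ?R) \<noteq> 0" using N0 by auto
      have "epowr (emeasure ?W (ball 0 ?R)) (1/p) * epowr (\<integral>\<^sup>+y\<in>ball 0 ?R. V y \<partial>lebesgue) (1 - 1/p)
          < top"
        using Ap[of ?R 0] unfolding emeasure_weighted[OF wm ballL] V_def[symmetric]
        by (rule le_less_trans) simp_all
      then have "epowr (\<integral>\<^sup>+y\<in>ball 0 ?R. V y \<partial>lebesgue) (1 - 1/p) \<noteq> top"
        using nz by (auto simp: ennreal_mult_less_top)
      then show ?thesis by (simp add: less_top)
    qed
    have Vfin: "AE x in lebesgue. V x \<noteq> top"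
    proof -
      have "AE x in lebesgue. V x * indicator (ball 0 (real N0 + real m + 1)) x \<noteq> \<infinity>" for m :: nat
        using Sfin0[of m] by (intro nn_integral_PInf_AE) (auto simp: infinity_ennreal_def)
      then have "AE x in lebesgue. \<forall>m::nat. V x * indicator (ball 0 (real N0 + real m + 1)) x \<noteq> \<infinity>"
        unfolding AE_all_countable by blast
      then show ?thesis
      proof eventually_elim
        case (elim x)
        obtain m :: nat where "norm x < real m" using reals_Archimedean2 by blast
        then show ?case using elim[rule_format, of m] by (auto simp: infinity_ennreal_def)
      qed
    qed
    then have wpos: "AE x in lebesgue. 0 < w x"
    proof eventually_elim
      case (elim x)
      then have "w x \<noteq> 0" by (auto simp: V_def)
      then show ?case using w0[of x] by simp
    qed
    \<comment> \<open>A real-valued dual weight. It is 0 rather than \<infinity> where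
      \<open>w\<close> vanishes, but by \<open>wpos\<close> this happens only on a null set.\<close>
    define s where "s x = w x powr (- (1 / (p - 1)))" for x
    have sm [measurable]: "s \<in> borel_measurable lebesgue" unfolding s_def by measurable
    have s0: "0 \<le> s x" for x by (simp add: s_def)
    have Vs: "AE x in lebesgue. V x = ennreal (s x)" using wpos
    proof eventually_elim
      case (elim x)
      then show ?case unfolding V_def s_def by (simp add: inverse_ennreal inverse_powr powr_minus)
    qed
    let ?S = "weighted s"
    have Sem: "(\<integral>\<^sup>+y\<in>A. V y \<partial>lebesgue) = emeasure ?S A" if "A \<in> sets lebesgue" for A
      unfolding emeasure_weighted[OF sm that]
      by (rule nn_integral_cong_AE) (use Vs in eventually_elim, simp)
    have Sfin: "emeasure ?S A < top" if A: "bounded A" "A \<in> sets lebesgue" for A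
    proof -
      obtain m0 where m0: "\<And>x. x \<in> A \<Longrightarrow> norm x \<le> m0" using A(1) by (auto simp: bounded_iff)
      obtain m :: nat where m: "m0 < real m" using reals_Archimedean2 by blast
      have "x \<in> ball 0 (real N0 + real m + 1)" if "x \<in> A" for x
        using m0[OF that] m by simp
      then have "emeasure ?S A \<le> emeasure ?S (ball 0 (real N0 + real m + 1))"
        by (intro emeasure_mono) auto
      then show ?thesis using Sfin0[of m] unfolding Sem[OF ballL] by simp
    qed
    define N where "N = real CARD('n)"
    define v where "v = unit_ball_vol N * N ^ CARD('n)"
    have N: "1 \<le> N" by (simp add: N_def Suc_leI)
    have v: "0 < v" using N by (auto simp: v_def intro!: mult_pos_pos unit_ball_vol_pos)
    define C where "C = max 1 (\<bar>C0\<bar> * v * N powr \<theta>)"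
    have "weight_pair p w s C \<theta>"
      unfolding weight_pair_def
    proof (intro conjI allI impI p th wm sm w0 s0)
      show "1 \<le> C" by (simp add: C_def)
      show "AE x in lebesgue. w x powr (1 / p) * s x powr (1 - 1 / p) = 1" using wpos
      proof eventually_elim
        case (elim x)
        have "1 / (p - 1) * (1 - 1 / p) = 1 / p" using p by (simp add: field_simps)
        then have "1 / p + - (1 / (p - 1)) * (1 - 1 / p) = 0" by simp
        then have "w x powr (1 / p) * s x powr (1 - 1 / p) = w x powr 0"
          unfolding s_def powr_powr powr_add[symmetric] by (simp only:)
        then show ?case using elim by simp
      qed
      fix c :: "real^'n" and l :: real
      show "emeasure ?W (cube c l) < top" "emeasure ?S (cube c l) < top"
        by (rule Wfin Sfin, rule cube_bounded, rule cube_lebesgue)+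
      assume l: "0 < l"
      let ?Q = "cube c l" and ?B = "ball c (N * l)"
      have r: "0 < N * l" using N l by simp
      have sub: "?Q \<subseteq> ?B" using cube_subset_ball[of c l] by (simp add: N_def)
      have mB: "measure lebesgue ?B = v * l ^ CARD('n)"
        using r by (subst measure_ball_lebesgue) (simp_all add: v_def N_def power_mult_distrib)
      have fB: "emeasure ?W ?B = ennreal (measure ?W ?B)" "emeasure ?S ?B = ennreal (measure ?S ?B)"
        using Wfin[of ?B] Sfin[of ?B] by (auto intro!: emeasure_eq_ennreal_measure)
      have mono: "measure ?W ?Q \<le> measure ?W ?B" "measure ?S ?Q \<le> measure ?S ?B"
        using Wfin[of ?B] Sfin[of ?B] sub
            by (auto intro!: measure_mono_fmeasurable simp: fmeasurable_def infinity_ennreal_def)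
      have "ennreal (measure ?W ?B powr (1 / p) * measure ?S ?B powr (1 - 1 / p)) \<le>
          ennreal (C0 * measure lebesgue ?B * (1 + N * l) powr \<theta>)"
        using Ap[OF r, of c] unfolding V_def[symmetric] Sem[OF ballL] emeasure_weighted[OF wm ballL,
            symmetric] fB
        by (simp add: ennreal_mult)
      also have "\<dots> \<le> ennreal (C * l ^ CARD('n) * (1 + l) powr \<theta>)"
      proof (rule ennreal_leI)
        have "C0 * measure lebesgue ?B * (1 + N * l) powr \<theta> \<le> \<bar>C0\<bar> * (v * l ^ CARD('n))
            * (N powr \<theta> * (1 + l) powr \<theta>)"
          unfolding mB using l th v unfolding N_def by (intro mult_mono one_plus_mult_powr_le) auto
        also have "\<dots> = (\<bar>C0\<bar> * v * N powr \<theta>) * (l ^ CARD('n) * (1 + l) powr \<theta>)"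
            by (simp only: ac_simps)
        also have "\<dots> \<le> C * (l ^ CARD('n) * (1 + l) powr \<theta>)"
          using l by (intro mult_right_mono) (auto simp: C_def)
        finally show "C0 * measure lebesgue ?B * (1 + N * l) powr \<theta> \<le> C * l ^ CARD('n)
            * (1 + l) powr \<theta>"
          by (simp only: ac_simps)
      qed
      finally have B: "measure ?W ?B powr (1 / p) * measure ?S ?B powr (1 - 1 / p)
          \<le> C * l ^ CARD('n) * (1 + l) powr \<theta>"
        using l by (subst (asm) ennreal_le_iff) (auto simp: C_def)
      show "measure ?W ?Q powr (1 / p) * measure ?S ?Q powr (1 - 1 / p) \<le> C * l ^ CARD('n)
          * (1 + l) powr \<theta>"
        by (rule order_trans[OF mult_mono B])
            (use p mono in \<open>auto intro!: powr_mono2 simp: divide_le_eq\<close>)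
    qed
    then show ?thesis by (rule pair)
  qed
qed

section \<open>Averages over balls of a fixed radius\<close>

interpretation lebesgue: sigma_finite_measure "lebesgue :: 'a::euclidean_space measure"
proof
  show "\<exists>A. countable A \<and> A \<subseteq> sets (lebesgue :: 'a measure) \<and> \<Union>A = space lebesgue \<and>
      (\<forall>a\<in>A. emeasure lebesgue a \<noteq> \<infinity>)"
  proof (intro exI conjI ballI)
    show "countable (range (\<lambda>n::nat. ball (0::'a) (real n)))" by simp
    show "\<Union>(range (\<lambda>n::nat. ball (0::'a) (real n))) = space lebesgue"
      by (auto simp: reals_Archimedean2)
    show "emeasure lebesgue a \<noteq> \<infinity>" if "a \<in> range (\<lambda>n::nat. ball (0::'a) (real n))" for a
      using that fmeasurableD2[OF lmeasurable_ball] by (auto simp: infinity_ennreal_def)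
  qed auto
qed

interpretation lebesgue_pair: pair_sigma_finite "lebesgue :: 'a::euclidean_space measure"
    "lebesgue :: 'b::euclidean_space measure" ..

text \<open>Transports Borel facts, such as the measurability of \<open>dist\<close>, to products of
  completed measures. The direction matters: the source carries the larger sigma-algebra.\<close>

lemma measurable_ident_lebesgue_borel [measurable]: "(\<lambda>x. x) \<in> lebesgue \<rightarrow>\<^sub>M borel"
  by (rule measurable_completion) simp

lemma measurable_lebesgue_borel: "f \<in> M \<rightarrow>\<^sub>M lebesgue \<Longrightarrow> f \<in> M \<rightarrow>\<^sub>M borel"
  using measurable_compose[OF _ measurable_ident_lebesgue_borel] by blast

lemma pred_dist_less [measurable]:
  "Measurable.pred (lebesgue \<Otimes>\<^sub>M lebesgue) (\<lambda>(x :: 'a::euclidean_space, y). dist x y < r)"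
proof -
  have [measurable]: "fst \<in> borel_measurable (lebesgue \<Otimes>\<^sub>M lebesgue)" "snd
      \<in> borel_measurable (lebesgue \<Otimes>\<^sub>M lebesgue)"
    by (rule measurable_lebesgue_borel; simp)+
  show ?thesis unfolding case_prod_beta by measurable
qed

text \<open>As \<open>1 + \<bar>b(x) - b(z)\<bar> \<le> h(x) h(z)\<close>, where \<open>h = 1 + \<bar>b - b\<^sub>Q\<bar>\<close>, the oscillation of \<open>b\<close>
  merely replaces the weights \<open>w\<close> and \<open>s\<close> by \<open>h\<^sup>p w\<close> and \<open>h\<^sup>q s\<close>.\<close>

theorem weighted_average_bound:
  fixes b :: "real^'n \<Rightarrow> complex"
  assumes wp: "weight_pair p w s C \<theta>" and b: "b \<in> BMO_inf"
  obtains K P where "0 \<le> K" "0 \<le> P"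
    "\<And>r (f :: real^'n \<Rightarrow> ennreal). 0 < r \<Longrightarrow> f \<in> borel_measurable lebesgue \<Longrightarrow>
      (\<integral>\<^sup>+x. epowr (\<integral>\<^sup>+y\<in>ball x r. ennreal (1 + cmod (b x - b y)) * f y \<partial>lebesgue) p \<partial>weighted w)
      \<le> ennreal (K * (1 + r) powr P * (r ^ CARD('n)) powr p) * (\<integral>\<^sup>+y. epowr (f y) p \<partial>weighted w)"
proof -
  have p: "1 < p" and C: "1 \<le> C" and th: "0 \<le> \<theta>"
    and wm [measurable]: "w \<in> borel_measurable lebesgue"
        and sm [measurable]: "s \<in> borel_measurable lebesgue"
    and w0: "\<And>x. 0 \<le> w x" and s0: "\<And>x. 0 \<le> s x"
    and ws: "AE x in lebesgue. w x powr (1 / p) * s x powr (1 - 1 / p) = 1"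
    and fin: "\<And>c l. emeasure (weighted w) (cube c l) < top" "\<And>c l. emeasure (weighted s) (cube c l)
        < top"
    and Ap: "\<And>c l. 0 < l \<Longrightarrow> measure (weighted w) (cube c l) powr (1 / p) * measure (weighted s)
        (cube c l) powr (1 - 1 / p)
        \<le> C * l ^ CARD('n) * (1 + l) powr \<theta>"
    using wp unfolding weight_pair_def by blast+
  have bm [measurable]: "b \<in> borel_measurable lebesgue"
    using b by (intro borel_measurable_locally_integrable) (auto simp: BMO_inf_def BMO_def)
  define q where "q = p / (p - 1)"
  have q: "1 < q" "q * (p - 1) = p" "(1 - 1 / p) * q = 1" using p by (auto simp: q_def field_simps)
  obtain K1 P1 where K1: "0 \<le> K1" "0 \<le> P1"
    "\<And>c l. 0 < l \<Longrightarrow>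
      (\<integral>\<^sup>+x\<in>cube c l. ennreal ((1 + cmod (b x - set_mean b (cube c l))) powr p) \<partial>weighted w)
        \<le> ennreal (K1 * (1 + l) powr P1) * emeasure (weighted w) (cube c l)"
    using BMO_weighted_moments[OF wp b, of p] p by auto
  obtain K2 P2 where K2: "0 \<le> K2" "0 \<le> P2"
    "\<And>c l. 0 < l \<Longrightarrow>
      (\<integral>\<^sup>+x\<in>cube c l. ennreal ((1 + cmod (b x - set_mean b (cube c l))) powr q) \<partial>weighted s)
        \<le> ennreal (K2 * (1 + l) powr P2) * emeasure (weighted s) (cube c l)"
    using BMO_weighted_moments[OF weight_pair_swap[OF wp] b, of q] q unfolding q_def by auto
  define P where "P = P1 + P2 * (p - 1) + \<theta> * p"
  have P0: "0 \<le> P" using K1 K2 th p by (simp add: P_def)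
  \<comment> \<open>The powers of 4 come from the cube of side \<open>l = 4 r\<close> used for
    radius \<open>r\<close>: one from its volume, the other from 1 + l \<le> 4 (1 + r).\<close>
  define K where "K = K1 * K2 powr (p - 1) * (C * 4 ^ CARD('n)) powr p * 4 powr P"
  show ?thesis
  proof (rule that)
    show "0 \<le> K" using K1 by (simp add: K_def)
    show "0 \<le> P" by (rule P0)
    fix r :: real and f :: "real^'n \<Rightarrow> ennreal"
    assume r: "0 < r" and fm [measurable]: "f \<in> borel_measurable lebesgue"
    define u where "u x y = 1 + cmod (b x - b y)" for x y
    have u1: "1 \<le> u x y" for x y by (simp add: u_def)
    have [measurable]: "(\<lambda>(x, y). u x y) \<in> borel_measurable (lebesgue \<Otimes>\<^sub>M lebesgue)" "u x
        \<in> borel_measurable lebesgue" for x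
      unfolding u_def by measurable
    define I where "I x y = (indicator {(x, y). dist x y < r} (x, y) :: ennreal)"
        for x y :: "real^'n"
    have Im [measurable]: "(\<lambda>(x, y). I x y) \<in> borel_measurable (lebesgue \<Otimes>\<^sub>M lebesgue)"
      unfolding I_def case_prod_beta prod.collapse
      by (rule borel_measurable_indicator')
          (use pred_dist_less[of r] in \<open>simp add: pred_def case_prod_beta\<close>)
    have Im' [measurable]: "I x \<in> borel_measurable lebesgue" for x
      using measurable_Pair2[OF Im, of x] by simp
    have Ieq: "I x y = indicator (ball x r) y" for x y by (simp add: I_def indicator_def)
    \<comment> \<open>The second Hoelder factor at \<open>x\<close>. The first is the integral of
      \<open>g\<close> = f^p w over the ball about \<open>x\<close>, so after Tonelli it remains to
      integrate \<open>V * w\<close> over a ball about \<open>y\<close>.\<close>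
    define V where "V x = epowr (\<integral>\<^sup>+y. I x y * (ennreal (u x y powr q) * ennreal (s y)) \<partial>lebesgue)
        (p - 1)" for x
    have [measurable]: "V \<in> borel_measurable lebesgue" unfolding V_def by measurable
    define g where "g y = epowr (f y) p * ennreal (w y)" for y
    have [measurable]: "g \<in> borel_measurable lebesgue" unfolding g_def by measurable
    \<comment> \<open>The integrand is split as f w^(1/p) times u s^(1 - 1/p), the product of the
      two weight factors being 1.\<close>
    have stepA: "epowr (\<integral>\<^sup>+y\<in>ball x r. ennreal (1 + cmod (b x - b y)) * f y \<partial>lebesgue) p
        \<le> (\<integral>\<^sup>+y. I x y * g y \<partial>lebesgue) * V x" for x
    proof -
      define F where "F y = I x y * (f y * ennreal (w y powr (1 / p)))" for y
      define G where "G y = I x y * ennreal (u x y * s y powr (1 - 1 / p))" for y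
      have II: "I x y * I x y = I x y" "epowr (I x y) t = I x y" for y t
        by (simp_all add: Ieq split: split_indicator)
      have "(\<integral>\<^sup>+y\<in>ball x r. ennreal (1 + cmod (b x - b y)) * f y \<partial>lebesgue)
          = (\<integral>\<^sup>+y. F y * G y \<partial>lebesgue)"
      proof (rule nn_integral_cong_AE)
        show "AE y in lebesgue. ennreal (1 + cmod (b x - b y)) * f y * indicator (ball x r) y
            = F y * G y"
          using ws
        proof eventually_elim
          case (elim y)
          then have e: "ennreal (w y powr (1 / p)) * ennreal (s y powr (1 - 1 / p)) = 1"
            by (subst ennreal_mult[symmetric]) auto
          have "F y * G y = I x y * I x y * (f y * ennreal (u x y) * (ennreal (w y powr (1 / p))
              * ennreal (s y powr (1 - 1 / p))))"
            unfolding F_def G_def using u1[of x y] by (simp add: ennreal_mult ac_simps)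
          then show ?case unfolding e II(1) by (simp add: Ieq u_def ac_simps)
        qed
      qed
      also have "epowr \<dots> p \<le> (\<integral>\<^sup>+y. epowr (F y) p \<partial>lebesgue)
          * epowr (\<integral>\<^sup>+y. epowr (G y) (p / (p - 1)) \<partial>lebesgue) (p - 1)"
        using p unfolding F_def G_def by (intro Holder_nn_integral) measurable
      also have "(\<integral>\<^sup>+y. epowr (F y) p \<partial>lebesgue) = (\<integral>\<^sup>+y. I x y * g y \<partial>lebesgue)"
        using p w0 by (simp add: F_def g_def epowr_mult II powr_powr)
      also have "(\<integral>\<^sup>+y. epowr (G y) (p / (p - 1)) \<partial>lebesgue)
          = (\<integral>\<^sup>+y. I x y * (ennreal (u x y powr q) * ennreal (s y)) \<partial>lebesgue)"
      proof (rule nn_integral_cong)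
        fix y
        have "(u x y * s y powr (1 - 1 / p)) powr q = u x y powr q * s y"
          using q(3) s0[of y] by (simp only: powr_mult powr_powr) simp
        moreover have "0 \<le> u x y * s y powr (1 - 1 / p)" using u1[of x y] by simp
        ultimately have "epowr (ennreal (u x y * s y powr (1 - 1 / p))) q
            = ennreal (u x y powr q * s y)"
          by (metis epowr_ennreal)
        then show "epowr (G y) (p / (p - 1)) = I x y * (ennreal (u x y powr q) * ennreal (s y))"
          using s0[of y] unfolding G_def q_def[symmetric]
              by (simp only: epowr_mult II ennreal_mult powr_ge_zero)
      qed
      finally show ?thesis by (simp add: V_def)
    qed
    have stepC: "(\<integral>\<^sup>+x. I x y * (V x * ennreal (w x)) \<partial>lebesgue)
        \<le> ennreal (K * (1 + r) powr P * (r ^ CARD('n)) powr p)" for y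
    proof -
      \<comment> \<open>This cube contains the ball of radius 2r about \<open>y\<close>, hence the
        ball of radius \<open>r\<close> about every \<open>x\<close> with
        \<open>dist x y < r\<close>. A single mean \<open>set_mean b Q\<close> therefore serves all
        these balls.\<close>
      define Q where "Q = cube (y - (\<chi> i. 2 * r)) (2 * (2 * r))"
      have QL [measurable]: "Q \<in> sets lebesgue" unfolding Q_def by (rule cube_lebesgue)
      have bQ: "ball y (2 * r) \<subseteq> Q" unfolding Q_def by (rule ball_subset_cube)
      define h where "h x = 1 + cmod (b x - set_mean b Q)" for x
      have [measurable]: "h \<in> borel_measurable lebesgue" unfolding h_def by measurable
      have uh: "u x z \<le> h x * h z" for x z
      proof -
        have "cmod (b x - b z) \<le> cmod (b x - set_mean b Q) + cmod (b z - set_mean b Q)"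
          using norm_triangle_ineq4[of "b x - set_mean b Q" "b z - set_mean b Q"] by simp
        moreover have "0 \<le> cmod (b x - set_mean b Q) * cmod (b z - set_mean b Q)" by simp
        moreover have "h x * h z = 1 + cmod (b x - set_mean b Q) + cmod (b z - set_mean b Q)
            + cmod (b x - set_mean b Q) * cmod (b z - set_mean b Q)"
          unfolding h_def by (simp add: algebra_simps)
        ultimately show ?thesis unfolding u_def by linarith
      qed
      define l where "l = 2 * (2 * r)"
      have l: "0 < l" using r by (simp add: l_def)
      have mom: "(\<integral>\<^sup>+x\<in>Q. ennreal (h x powr p) \<partial>weighted w) \<le> ennreal (K1 * (1 + l) powr P1)
          * emeasure (weighted w) Q"
          "(\<integral>\<^sup>+x\<in>Q. ennreal (h x powr q) \<partial>weighted s) \<le> ennreal (K2 * (1 + l) powr P2)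
              * emeasure (weighted s) Q"
        unfolding h_def using K1(3)[OF l] K2(3)[OF l] by (auto simp: Q_def l_def)
      define Hs where "Hs = (\<integral>\<^sup>+x\<in>Q. ennreal (h x powr q) \<partial>weighted s)"
      have Hs: "Hs = (\<integral>\<^sup>+z. indicator Q z * (ennreal (h z powr q) * ennreal (s z)) \<partial>lebesgue)"
        unfolding Hs_def weighted_def by (subst nn_integral_density)
            (auto intro!: nn_integral_cong simp: ac_simps)
      have Vle: "V x \<le> ennreal (h x powr p) * epowr Hs (p - 1)" if "dist x y < r" for x
      proof -
        have "(\<integral>\<^sup>+z. I x z * (ennreal (u x z powr q) * ennreal (s z)) \<partial>lebesgue) \<le>
            (\<integral>\<^sup>+z. ennreal (h x powr q) * (indicator Q z * (ennreal (h z powr q) * ennreal (s z)))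
                \<partial>lebesgue)"
        proof (rule nn_integral_mono)
          fix z
          have "z \<in> Q" if "dist x z < r"
          proof -
            have "dist y z < 2 * r" using dist_triangle[of y z x] that \<open>dist x y < r\<close>
                by (simp add: dist_commute)
            then show ?thesis using bQ by auto
          qed
          moreover have "u x z powr q \<le> h x powr q * h z powr q"
            using uh[of x z] u1[of x z] q(1) by (subst powr_mult[symmetric])
                (intro powr_mono2, auto)
          then have "ennreal (u x z powr q) \<le> ennreal (h x powr q) * ennreal (h z powr q)"
            by (subst ennreal_mult[symmetric]) (auto intro: ennreal_leI)
          ultimately show "I x z * (ennreal (u x z powr q) * ennreal (s z)) \<le>
            ennreal (h x powr q) * (indicator Q z * (ennreal (h z powr q) * ennreal (s z)))"
            by (cases "dist x z < r") (auto simp: Ieq mult.assoc[symmetric] intro!: mult_right_mono)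
        qed
        also have "\<dots> = ennreal (h x powr q) * Hs" unfolding Hs
            by (intro nn_integral_cmult) measurable
        finally have "V x \<le> epowr (ennreal (h x powr q) * Hs) (p - 1)"
          unfolding V_def using p by (intro epowr_mono) auto
        also have "\<dots> = ennreal (h x powr p) * epowr Hs (p - 1)"
          using q(2) by (simp add: epowr_mult powr_powr)
        finally show ?thesis .
      qed
      have "(\<integral>\<^sup>+x. I x y * (V x * ennreal (w x)) \<partial>lebesgue) \<le>
          (\<integral>\<^sup>+x. epowr Hs (p - 1) * (indicator Q x * (ennreal (h x powr p) * ennreal (w x)))
              \<partial>lebesgue)"
      proof (rule nn_integral_mono)
        fix x
        show "I x y * (V x * ennreal (w x)) \<le> epowr Hs (p - 1)
            * (indicator Q x * (ennreal (h x powr p) * ennreal (w x)))"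
        proof (cases "dist x y < r")
          case True
          then have "x \<in> Q" using bQ r by (auto simp: dist_commute)
          then show ?thesis using True mult_right_mono[OF Vle[OF True], of "ennreal (w x)"]
              by (simp add: I_def ac_simps)
        qed (simp add: I_def)
      qed
      also have "\<dots> = epowr Hs (p - 1) * (\<integral>\<^sup>+x. indicator Q x * (ennreal (h x powr p)
          * ennreal (w x)) \<partial>lebesgue)"
        by (intro nn_integral_cmult) measurable
      also have "(\<integral>\<^sup>+x. indicator Q x * (ennreal (h x powr p) * ennreal (w x)) \<partial>lebesgue)
          = (\<integral>\<^sup>+x\<in>Q. ennreal (h x powr p) \<partial>weighted w)"
        unfolding weighted_def by (subst nn_integral_density)
            (auto intro!: nn_integral_cong simp: ac_simps)
      also have "epowr Hs (p - 1) * \<dots> \<le> epowr (ennreal (K2 * (1 + l) powr P2)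
          * emeasure (weighted s) Q) (p - 1) *
          (ennreal (K1 * (1 + l) powr P1) * emeasure (weighted w) Q)"
        unfolding Hs_def using p mom by (intro mult_mono epowr_mono) auto
      also have "\<dots> = ennreal ((K2 * (1 + l) powr P2 * measure (weighted s) Q) powr (p - 1)
          * (K1 * (1 + l) powr P1 * measure (weighted w) Q))"
      proof -
        have "emeasure (weighted s) Q = ennreal (measure (weighted s) Q)" "emeasure (weighted w) Q
            = ennreal (measure (weighted w) Q)"
          unfolding Q_def by (intro emeasure_eq_ennreal_measure less_imp_neq fin)+
        then show ?thesis using K1 K2 by (simp flip: ennreal_mult)
      qed
      also have "\<dots> \<le> ennreal (K * (1 + r) powr P * (r ^ CARD('n)) powr p)"
      proof (rule ennreal_leI)
        define X where "X = measure (weighted w) Q"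
        define Y where "Y = measure (weighted s) Q"
        have XY: "0 \<le> X" "0 \<le> Y" by (auto simp: X_def Y_def)
        \<comment> \<open>The left-hand side of the weight condition on \<open>Q\<close>, raised to
          the power \<open>p\<close>.\<close>
        have "X * Y powr (p - 1) = (X powr (1 / p) * Y powr (1 - 1 / p)) powr p"
        proof -
          have "1 / p * p = 1" "(1 - 1 / p) * p = p - 1" using p by (auto simp: field_simps)
          then show ?thesis using XY by (simp only: powr_mult powr_powr) simp
        qed
        also have "\<dots> \<le> (C * l ^ CARD('n) * (1 + l) powr \<theta>) powr p"
          using Ap[OF l, of "y - (\<chi> i. 2 * r)"] p unfolding X_def Y_def Q_def l_def
              by (intro powr_mono2) auto
        finally have XYle: "X * Y powr (p - 1) \<le> (C * l ^ CARD('n) * (1 + l) powr \<theta>) powr p" .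
        have "(K2 * (1 + l) powr P2 * Y) powr (p - 1) * (K1 * (1 + l) powr P1 * X) =
            (K1 * K2 powr (p - 1) * ((1 + l) powr P1 * ((1 + l) powr P2) powr (p - 1)))
                * (X * Y powr (p - 1))"
          by (simp only: powr_mult ac_simps)
        also have "\<dots> \<le> (K1 * K2 powr (p - 1) * ((1 + l) powr P1 * ((1 + l) powr P2) powr (p - 1)))
            * (C * l ^ CARD('n) * (1 + l) powr \<theta>) powr p"
          using K1 by (intro mult_left_mono XYle) auto
        also have "\<dots> = K1 * K2 powr (p - 1) * (C * l ^ CARD('n)) powr p * (1 + l) powr P"
          unfolding P_def by (simp only: powr_mult powr_powr powr_add ac_simps)
        also have "\<dots> \<le> K1 * K2 powr (p - 1) * (C * l ^ CARD('n)) powr p * (4 * (1 + r)) powr P"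
          using K1 P0 r l by (intro mult_left_mono powr_mono2) (auto simp: l_def)
        also have "\<dots> = K * (1 + r) powr P * (r ^ CARD('n)) powr p"
        proof -
          have "C * l ^ CARD('n) = C * 4 ^ CARD('n) * r ^ CARD('n)"
              by (simp add: l_def power_mult_distrib)
          then show ?thesis unfolding K_def by (simp only: powr_mult ac_simps)
        qed
        finally show "(K2 * (1 + l) powr P2 * measure (weighted s) Q) powr (p - 1)
            * (K1 * (1 + l) powr P1 * measure (weighted w) Q)
            \<le> K * (1 + r) powr P * (r ^ CARD('n)) powr p" unfolding X_def Y_def .
      qed
      finally show ?thesis .
    qed
    have "(\<integral>\<^sup>+x. epowr (\<integral>\<^sup>+y\<in>ball x r. ennreal (1 + cmod (b x - b y)) * f y \<partial>lebesgue) p \<partial>weighted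
        w)
      \<le> (\<integral>\<^sup>+x. (\<integral>\<^sup>+y. I x y * g y \<partial>lebesgue) * V x \<partial>weighted w)"
      by (intro nn_integral_mono stepA)
    also have "\<dots> = (\<integral>\<^sup>+x. ennreal (w x) * ((\<integral>\<^sup>+y. I x y * g y \<partial>lebesgue) * V x) \<partial>lebesgue)"
      unfolding weighted_def by (intro nn_integral_density) measurable
    also have "\<dots> = (\<integral>\<^sup>+x. (\<integral>\<^sup>+y. (V x * ennreal (w x)) * (I x y * g y) \<partial>lebesgue) \<partial>lebesgue)"
      by (subst nn_integral_cmult) (auto simp: ac_simps)
    also have "\<dots> = (\<integral>\<^sup>+y. (\<integral>\<^sup>+x. (V x * ennreal (w x)) * (I x y * g y) \<partial>lebesgue) \<partial>lebesgue)"
      by (rule lebesgue_pair.Fubini') measurable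
    also have "\<dots> = (\<integral>\<^sup>+y. g y * (\<integral>\<^sup>+x. I x y * (V x * ennreal (w x)) \<partial>lebesgue) \<partial>lebesgue)"
      by (subst nn_integral_cmult[symmetric]) (auto simp: ac_simps)
    also have "\<dots> \<le> (\<integral>\<^sup>+y. g y * ennreal (K * (1 + r) powr P * (r ^ CARD('n)) powr p) \<partial>lebesgue)"
      by (intro nn_integral_mono mult_left_mono stepC) simp
    also have "\<dots> = ennreal (K * (1 + r) powr P * (r ^ CARD('n)) powr p) * (\<integral>\<^sup>+y. g y \<partial>lebesgue)"
      by (subst nn_integral_multc) (auto simp: ac_simps)
    also have "(\<integral>\<^sup>+y. g y \<partial>lebesgue) = (\<integral>\<^sup>+y. epowr (f y) p \<partial>weighted w)"
      unfolding weighted_def g_def by (subst nn_integral_density) (auto simp: ac_simps)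
    finally show "(\<integral>\<^sup>+x. epowr (\<integral>\<^sup>+y\<in>ball x r. ennreal (1 + cmod (b x - b y)) * f y \<partial>lebesgue) p
        \<partial>weighted w)
      \<le> ennreal (K * (1 + r) powr P * (r ^ CARD('n)) powr p) * (\<integral>\<^sup>+y. epowr (f y) p \<partial>weighted w)" .
  qed
qed

section \<open>Kernel operators on weighted spaces\<close>

lemma epowr_add: "epowr x a * epowr x b = epowr x (a + b)"
proof (cases x)
  case (real r)
  then have "ennreal (r powr a) * ennreal (r powr b) = ennreal (r powr (a + b))"
    by (subst ennreal_mult[symmetric]) (auto simp: powr_add)
  then show ?thesis using real by simp
qed simp

text \<open>Hoelder's inequality on the counting measure with c = c^(1/p) c^(1 - 1/p), in the role
  of Minkowski's inequality for the series. It leaves only two scalar sums to be shown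
  finite.\<close>

lemma nn_integral_powr_series_le:
  fixes A :: "nat \<Rightarrow> 'a \<Rightarrow> ennreal" and c B :: "nat \<Rightarrow> ennreal"
  assumes A [measurable]: "\<And>j. A j \<in> borel_measurable M" and p: "1 < p"
    and B: "\<And>j. (\<integral>\<^sup>+x. epowr (A j x) p \<partial>M) \<le> B j * I"
  shows "(\<integral>\<^sup>+x. epowr (\<Sum>j. c j * A j x) p \<partial>M) \<le> epowr (\<Sum>j. c j) (p - 1) * (\<Sum>j. c j * B j) * I"
proof -
  have "epowr (\<Sum>j. c j * A j x) p \<le> epowr (\<Sum>j. c j) (p - 1) * (\<Sum>j. c j * epowr (A j x) p)" for x
  proof -
    have e: "1 / p + (1 - 1 / p) = 1" "1 / p * p = 1" "(1 - 1 / p) * (p / (p - 1)) = 1"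
      using p by (auto simp: field_simps)
    have "(\<Sum>j. c j * A j x) = (\<integral>\<^sup>+j. (epowr (c j) (1 / p) * A j x) * epowr (c j) (1 - 1 / p)
        \<partial>count_space UNIV)"
    proof -
      have "(epowr (c j) (1 / p) * A j x) * epowr (c j) (1 - 1 / p) = c j * A j x" for j
        using epowr_add[of "c j" "1 / p" "1 - 1 / p"] unfolding e(1) by (simp add: ac_simps)
      then show ?thesis by (simp add: nn_integral_count_space_nat)
    qed
    also have "epowr \<dots> p \<le> (\<integral>\<^sup>+j. epowr (epowr (c j) (1 / p) * A j x) p \<partial>count_space UNIV) *
        epowr (\<integral>\<^sup>+j. epowr (epowr (c j) (1 - 1 / p)) (p / (p - 1)) \<partial>count_space UNIV) (p - 1)"
      using p by (intro Holder_nn_integral) auto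
    also have "\<dots> = (\<Sum>j. c j * epowr (A j x) p) * epowr (\<Sum>j. c j) (p - 1)"
      unfolding epowr_mult epowr_epowr e by (simp add: nn_integral_count_space_nat)
    finally show ?thesis by (simp add: mult.commute)
  qed
  then have "(\<integral>\<^sup>+x. epowr (\<Sum>j. c j * A j x) p \<partial>M) \<le>
      (\<integral>\<^sup>+x. epowr (\<Sum>j. c j) (p - 1) * (\<Sum>j. c j * epowr (A j x) p) \<partial>M)"
    by (intro nn_integral_mono)
  also have "\<dots> = epowr (\<Sum>j. c j) (p - 1) * (\<Sum>j. c j * (\<integral>\<^sup>+x. epowr (A j x) p \<partial>M))"
    by (simp add: nn_integral_cmult nn_integral_suminf)
  also have "\<dots> \<le> epowr (\<Sum>j. c j) (p - 1) * (\<Sum>j. c j * (B j * I))"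
    by (intro mult_left_mono suminf_le B) auto
  also have "(\<Sum>j. c j * (B j * I)) = (\<Sum>j. c j * B j) * I"
    by (subst ennreal_suminf_multc[symmetric]) (simp add: mult.assoc)
  finally show ?thesis by (simp add: mult.assoc)
qed

lemma AE_weighted:
  assumes "w \<in> borel_measurable lebesgue" "AE x in lebesgue. P x"
  shows "AE x in weighted w. P x"
  unfolding weighted_def using assms by (subst AE_density) (auto elim!: eventually_mono)

section \<open>Summation over dyadic scales\<close>

lemma suminf_ennreal_geometric_less_top:
  fixes z D :: real
  assumes "0 \<le> z" "z < 1" "0 \<le> D" "\<And>j. f j \<le> D * z ^ j"
  shows "(\<Sum>j. ennreal (f j)) < top"
proof -
  have "(\<Sum>j. ennreal (f j)) \<le> (\<Sum>j. ennreal (D * z ^ j))"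
    using assms by (intro suminf_le ennreal_leI) auto
  also have "\<dots> = ennreal (D * (1 / (1 - z)))"
    using assms by (intro suminf_ennreal_eq sums_mult geometric_sums) auto
  finally show ?thesis by (rule le_less_trans) simp
qed

text \<open>All scales 2^j with j an integer, small and large, enumerated by the naturals so that
  one \<open>suminf\<close> runs over both directions.\<close>

definition dyadic :: "nat \<Rightarrow> real" where
  "dyadic i = 2 powr of_int (int_decode i)"

lemma dyadic_pos: "0 < dyadic i"
  by (simp add: dyadic_def)

lemma dyadic_scale_exists:
  assumes "0 < d"
  shows "\<exists>i. dyadic i / 2 \<le> d \<and> d < dyadic i"
proof -
  define j where "j = \<lfloor>log 2 d\<rfloor> + 1"
  have j: "of_int j - 1 \<le> log 2 d" "log 2 d < of_int j" unfolding j_def by linarith+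
  have "2 powr (of_int j - 1) \<le> 2 powr log 2 d" "2 powr log 2 d < 2 powr of_int j"
    using j by simp_all
  then have "2 powr of_int j / 2 \<le> d" "d < 2 powr of_int j"
    using assms by (simp_all add: powr_diff)
  then show ?thesis by (intro exI[of _ "int_encode j"]) (simp add: dyadic_def)
qed

text \<open>In this enumeration i \<le> 2 |j| + 1, so the bound D 2^(-\<eta> |j|), which the two
  hypotheses express together, is geometric in \<open>i\<close>.\<close>

lemma dyadic_sum_less_top:
  assumes \<eta>: "0 < \<eta>" and D: "0 \<le> D"
    and f: "\<And>i. f i \<le> D * dyadic i powr \<eta>" "\<And>i. f i \<le> D * dyadic i powr - \<eta>"
  shows "(\<Sum>i. ennreal (f i)) < top"
proof (rule suminf_ennreal_geometric_less_top)
  fix i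
  let ?j = "real_of_int (int_decode i)"
  have "real i \<le> 2 * \<bar>?j\<bar> + 1"
    by (cases "even i") (auto simp: int_decode_def sum_decode_def elim!: evenE oddE)
  then have "- (\<eta> * \<bar>?j\<bar>) \<le> \<eta> / 2 - \<eta> / 2 * real i"
    using mult_left_mono[of "real i" "2 * \<bar>?j\<bar> + 1" "\<eta> / 2"] \<eta> by (simp add: algebra_simps)
  then have "2 powr - (\<eta> * \<bar>?j\<bar>) \<le> 2 powr (\<eta> / 2 - \<eta> / 2 * real i)" by simp
  also have "\<dots> = 2 powr (\<eta> / 2) * (2 powr - (\<eta> / 2)) ^ i"
    by (subst powr_power) (simp_all add: powr_add[symmetric] mult.commute)
  finally have "D * 2 powr - (\<eta> * \<bar>?j\<bar>) \<le> D * (2 powr (\<eta> / 2) * (2 powr - (\<eta> / 2)) ^ i)"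
    using D by (rule mult_left_mono)
  moreover have "f i \<le> D * 2 powr - (\<eta> * \<bar>?j\<bar>)"
    using f[of i] unfolding dyadic_def powr_powr by (cases "0 \<le> ?j") (simp_all add: mult.commute)
  ultimately show "f i \<le> D * 2 powr (\<eta> / 2) * (2 powr - (\<eta> / 2)) ^ i" by simp
qed (use \<eta> D powr_less_mono[of "- (\<eta> / 2)" 0 2] in auto)

definition kernel_bounded :: "real \<Rightarrow> (real^'n \<Rightarrow> real) \<Rightarrow> (real^'n \<Rightarrow> real^'n \<Rightarrow> ennreal) \<Rightarrow> real \<Rightarrow> bool"
    where
  "kernel_bounded p w H K \<longleftrightarrow> 0 \<le> K \<and> (\<forall>f\<in>borel_measurable lebesgue.
     (\<integral>\<^sup>+x. epowr (\<integral>\<^sup>+y. H x y * f y \<partial>lebesgue) p \<partial>weighted w)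
         \<le> ennreal K * (\<integral>\<^sup>+y. epowr (f y) p \<partial>weighted w))"

text \<open>At small scales \<sigma> < n makes the dyadic series converge; at large ones a high
  power beats the growth (1 + r)^P of the averaging operators. The hypothesis \<open>far\<close>
  asks for some exponent at least \<open>M\<close> rather than \<open>M\<close> itself, because the
  oscillatory integrals yield exponents of the form N + t.\<close>

theorem kernel_operator_bound:
  fixes b :: "real^'n \<Rightarrow> complex" and H :: "real^'n \<Rightarrow> real^'n \<Rightarrow> ennreal"
  assumes wp: "weight_pair p w s C \<theta>" and b: "b \<in> BMO_inf"
    and near: "AE x in lebesgue. \<forall>y. y \<noteq> x \<longrightarrow>
        H x y \<le> ennreal (C1 * dist x y powr - \<sigma> * (1 + cmod (b x - b y)))"
    and sig: "0 < \<sigma>" "\<sigma> < real CARD('n)"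
    and far: "\<And>M. \<exists>M'\<ge>M. \<exists>C2. AE x in lebesgue. \<forall>y. y \<noteq> x \<longrightarrow>
        H x y \<le> ennreal (C2 * dist x y powr - M' * (1 + cmod (b x - b y)))"
  obtains K where "kernel_bounded p w H K"
proof -
  have p: "1 < p" and wm [measurable]: "w \<in> borel_measurable lebesgue"
    using wp unfolding weight_pair_def by blast+
  have bm [measurable]: "b \<in> borel_measurable lebesgue"
    using b by (intro borel_measurable_locally_integrable) (auto simp: BMO_inf_def BMO_def)
  define n where "n = real CARD('n)"
  define u where "u x y = 1 + cmod (b x - b y)" for x y
  have u0: "0 \<le> u x y" for x y by (simp add: u_def)
  have um [measurable]: "(\<lambda>(x, y). u x y) \<in> borel_measurable (lebesgue \<Otimes>\<^sub>M lebesgue)" "u x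
      \<in> borel_measurable lebesgue" for x
    unfolding u_def by measurable
  define Av where "Av r f x = (\<integral>\<^sup>+y\<in>ball x r. ennreal (u x y) * f y \<partial>lebesgue)" for r f x
  obtain K0 P where K0: "0 \<le> K0" "0 \<le> P"
    "\<And>r f. 0 < r \<Longrightarrow> f \<in> borel_measurable lebesgue \<Longrightarrow> (\<integral>\<^sup>+x. epowr (Av r f x) p \<partial>weighted w)
      \<le> ennreal (K0 * (1 + r) powr P * (r ^ CARD('n)) powr p) * (\<integral>\<^sup>+y. epowr (f y) p \<partial>weighted w)"
    using weighted_average_bound[OF wp b] unfolding Av_def u_def by blast
  have meas: "Av r f \<in> borel_measurable lebesgue" if [measurable]: "f \<in> borel_measurable lebesgue"
      for f r
  proof -
    define I where "I x y = (indicator {(x, y). dist x y < r} (x, y) :: ennreal)"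
        for x y :: "real^'n"
    have Im [measurable]: "(\<lambda>(x, y). I x y) \<in> borel_measurable (lebesgue \<Otimes>\<^sub>M lebesgue)"
      unfolding I_def case_prod_beta prod.collapse
      by (rule borel_measurable_indicator')
          (use pred_dist_less[of r] in \<open>simp add: pred_def case_prod_beta\<close>)
    have "(\<lambda>x. \<integral>\<^sup>+y. ennreal (u x y) * f y * I x y \<partial>lebesgue) \<in> borel_measurable lebesgue"
      by measurable
    moreover have "I x y = indicator (ball x r) y" for x y by (simp add: I_def indicator_def)
    ultimately show ?thesis by (simp add: Av_def[abs_def])
  qed
  obtain M C2 where M: "n + P + 1 \<le> M"
    and far: "AE x in lebesgue. \<forall>y. y \<noteq> x \<longrightarrow> H x y \<le> ennreal (C2 * dist x y powr - M * u x y)"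
    using far[of "n + P + 1"] unfolding u_def by blast
  \<comment> \<open>Coefficients relative to averages normalised by r^-n: r^(-\<sigma>) = r^(n -
    \<sigma>) r^(-n), and likewise for \<open>M\<close>. Both kernel bounds hold at every distance,
    so the smaller one is taken.\<close>
  define c where "c i = min (dyadic i powr (n - \<sigma>)) (dyadic i powr (n - M))" for i
  have c0: "0 \<le> c i" for i by (simp add: c_def)
  \<comment> \<open>The exponent gained is n - \<sigma> at small scales, and at least 1 at large
    ones by the choice of \<open>M\<close>.\<close>
  define \<eta> where "\<eta> = min (n - \<sigma>) 1"
  have \<eta>: "0 < \<eta>" using sig by (simp add: \<eta>_def n_def)
  have c_le: "c i * (1 + dyadic i) powr P \<le> 2 powr P * dyadic i powr \<eta>"
    "c i * (1 + dyadic i) powr P \<le> 2 powr P * dyadic i powr - \<eta>" for i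
  proof -
    define r where "r = dyadic i"
    have r: "0 < r" by (simp add: r_def dyadic_pos)
    have "c i * (1 + r) powr P \<le> 2 powr P * min (r powr \<eta>) (r powr - \<eta>)"
    proof (cases "1 \<le> r")
      case True
      have "c i * (1 + r) powr P \<le> r powr (n - M) * (2 * r) powr P"
        using True K0 by (intro mult_mono powr_mono2) (auto simp: c_def r_def)
      also have "\<dots> = 2 powr P * r powr (n - M + P)" by (simp add: powr_mult powr_add)
      also have "\<dots> \<le> 2 powr P * min (r powr \<eta>) (r powr - \<eta>)"
        using True M \<eta> by (intro mult_left_mono min.boundedI powr_mono) (auto simp: \<eta>_def)
      finally show ?thesis .
    next
      case False
      have "c i * (1 + r) powr P \<le> r powr (n - \<sigma>) * 2 powr P"
        using False r K0 by (intro mult_mono powr_mono2) (auto simp: c_def r_def)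
      also have "\<dots> \<le> min (r powr \<eta>) (r powr - \<eta>) * 2 powr P"
        using False r \<eta> by (intro mult_right_mono min.boundedI powr_mono') (auto simp: \<eta>_def)
      finally show ?thesis by (simp only: mult.commute)
    qed
    moreover have "2 powr P * min (r powr \<eta>) (r powr - \<eta>) \<le> 2 powr P * r powr \<eta>"
      "2 powr P * min (r powr \<eta>) (r powr - \<eta>) \<le> 2 powr P * r powr - \<eta>"
      by (rule mult_left_mono; simp)+
    ultimately show "c i * (1 + dyadic i) powr P \<le> 2 powr P * dyadic i powr \<eta>"
      "c i * (1 + dyadic i) powr P \<le> 2 powr P * dyadic i powr - \<eta>"
      unfolding r_def by linarith+
  qed
  have c_le': "c i \<le> c i * (1 + dyadic i) powr P" for i
    using mult_left_mono[of 1 "(1 + dyadic i) powr P" "c i"] c0[of i] K0(2) dyadic_pos[of i]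
    by (simp add: ge_one_powr_ge_zero)
  have sum1: "(\<Sum>i. ennreal (c i)) < top"
    by (rule dyadic_sum_less_top[OF \<eta> _ order_trans[OF c_le' c_le(1)] order_trans[OF c_le'
        c_le(2)]]) simp
  have sum2: "(\<Sum>i. ennreal (c i * (1 + dyadic i) powr P)) < top"
    by (rule dyadic_sum_less_top[OF \<eta> _ c_le]) simp
  define U where "U f x = (\<Sum>i. ennreal (c i) * (ennreal (dyadic i powr - n) * Av (dyadic i) f x))"
      for f x
  define T where "T = epowr (\<Sum>i. ennreal (c i)) (p - 1) * (\<Sum>i. ennreal (c i)
      * ennreal (K0 * (1 + dyadic i) powr P))"
  have T: "T < top"
  proof -
    have e: "(\<Sum>i. ennreal (c i) * ennreal (K0 * (1 + dyadic i) powr P))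
        = ennreal K0 * (\<Sum>i. ennreal (c i * (1 + dyadic i) powr P))"
      using K0 c0 by (subst ennreal_suminf_cmult[symmetric]) (simp add: ennreal_mult ac_simps)
    have "epowr S (p - 1) * (ennreal K0 * S') < top" if "S < top" "S' < top" for S S'
    proof -
      have "epowr S (p - 1) \<noteq> top" "ennreal K0 * S' \<noteq> top"
        using that by (auto simp: ennreal_mult_eq_top_iff)
      then have "epowr S (p - 1) * (ennreal K0 * S') \<noteq> top"
        by (auto simp: ennreal_mult_eq_top_iff)
      then show ?thesis by (simp only: less_top)
    qed
    then show ?thesis using sum1 sum2 unfolding T_def e by blast
  qed
  have U: "(\<integral>\<^sup>+x. epowr (U f x) p \<partial>weighted w) \<le> T * (\<integral>\<^sup>+y. epowr (f y) p \<partial>weighted w)"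
    if f [measurable]: "f \<in> borel_measurable lebesgue" for f
    unfolding T_def U_def
  proof (rule nn_integral_powr_series_le[OF _ p])
    fix i
    let ?r = "dyadic i" and ?J = "\<integral>\<^sup>+y. epowr (f y) p \<partial>weighted w"
    have Avm: "Av ?r f \<in> borel_measurable (weighted w)"
      using meas[OF f] by (simp add: measurable_cong_sets[OF sets_weighted refl])
    then show "(\<lambda>x. ennreal (?r powr - n) * Av ?r f x) \<in> borel_measurable (weighted w)"
        by measurable
    have "(\<integral>\<^sup>+x. epowr (ennreal (?r powr - n) * Av ?r f x) p \<partial>weighted w) =
        ennreal ((?r powr - n) powr p) * (\<integral>\<^sup>+x. epowr (Av ?r f x) p \<partial>weighted w)"
      unfolding epowr_mult using Avm by (subst nn_integral_cmult) auto
    also have "\<dots> \<le> ennreal ((?r powr - n) powr p)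
        * (ennreal (K0 * (1 + ?r) powr P * (?r ^ CARD('n)) powr p) * ?J)"
      by (intro mult_left_mono K0(3) dyadic_pos f) simp
    also have "\<dots> = ennreal (K0 * (1 + ?r) powr P) * ?J"
    proof -
      \<comment> \<open>The normalisation cancels the volume factor of the averaging bound; only the
        polynomial growth in 1 + r remains.\<close>
      have "?r powr - n * ?r ^ CARD('n) = 1"
        using dyadic_pos[of i] by (simp add: n_def powr_minus powr_realpow)
      then have "(?r powr - n) powr p * (K0 * (1 + ?r) powr P * (?r ^ CARD('n)) powr p)
          = K0 * (1 + ?r) powr P"
        by (metis (no_types, opaque_lifting) mult.commute mult.left_commute mult_1 powr_mult
            powr_one_eq_one)
      then show ?thesis using K0
          by (simp only: mult.assoc[symmetric] ennreal_mult[symmetric] powr_ge_zero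
          mult_nonneg_nonneg)
    qed
    finally show "(\<integral>\<^sup>+x. epowr (ennreal (?r powr - n) * Av ?r f x) p \<partial>weighted w)
        \<le> ennreal (K0 * (1 + ?r) powr P) * ?J" .
  qed
  \<comment> \<open>The factors 2^\<sigma> and 2^M come from replacing the distance by its lower
    bound r / 2 in the shell of outer radius r.\<close>
  define D where "D = \<bar>C1\<bar> * 2 powr \<sigma> + \<bar>C2\<bar> * 2 powr M"
  have D: "0 \<le> D" by (simp add: D_def)
  define k where "k x y
      = (\<Sum>i. ennreal (c i) * (ennreal (dyadic i powr - n) * indicator (ball x (dyadic i)) y))"
      for x y :: "real^'n"
  have ptw: "H x y \<le> ennreal D * (k x y * ennreal (u x y))"
    if "x \<noteq> y" and H: "H x y \<le> ennreal (C1 * dist x y powr - \<sigma> * u x y)" "H x y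
        \<le> ennreal (C2 * dist x y powr - M * u x y)" for x y
  proof -
    obtain i where i: "dyadic i / 2 \<le> dist x y" "dist x y < dyadic i"
      using dyadic_scale_exists[of "dist x y"] \<open>x \<noteq> y\<close> by auto
    define r where "r = dyadic i"
    have r: "0 < r" by (simp add: r_def dyadic_pos)
    have bd: "H x y \<le> ennreal (D * (r powr (n - t) * r powr - n * u x y))"
      if "0 \<le> t" and HB: "H x y \<le> ennreal (B * dist x y powr - t * u x y)"
          and BD: "\<bar>B\<bar> * 2 powr t \<le> D" for B t
    proof -
      have "dist x y powr - t \<le> (r / 2) powr - t"
        using i r that(1) unfolding r_def by (intro powr_mono2') auto
      also have "\<dots> = 2 powr t * (r powr (n - t) * r powr - n)"
        using r by (simp add: powr_divide powr_minus powr_add[symmetric] field_simps)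
      finally have "B * dist x y powr - t \<le> \<bar>B\<bar> * (2 powr t * (r powr (n - t) * r powr - n))"
        by (intro mult_mono) auto
      also have "\<dots> \<le> D * (r powr (n - t) * r powr - n)"
        using mult_right_mono[OF BD, of "r powr (n - t) * r powr - n"]
            by (simp only: mult.assoc) simp
      finally have "B * dist x y powr - t * u x y \<le> D * (r powr (n - t) * r powr - n) * u x y"
        using u0 by (rule mult_right_mono)
      then show ?thesis by (intro order_trans[OF HB] ennreal_leI) (simp only: mult.assoc)
    qed
    have "H x y \<le> ennreal (D * (c i * r powr - n * u x y))"
      using bd[OF _ H(1)] bd[OF _ H(2)] sig M K0 unfolding c_def r_def[symmetric]
      by (auto simp: min_def D_def n_def)
    also have "\<dots> = ennreal D * (ennreal (c i) * (ennreal (r powr - n) * indicator (ball x r) y)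
        * ennreal (u x y))"
      using D c0[of i] u0[of x y] i(2) by (simp add: ennreal_mult r_def)
    also have "\<dots> \<le> ennreal D * (k x y * ennreal (u x y))"
    proof -
      define F where "F i = ennreal (c i) * (ennreal (dyadic i powr - n)
          * indicator (ball x (dyadic i)) y)" for i
      have "F i \<le> suminf F" using sum_le_suminf[of F "{i}"] by simp
      then show ?thesis unfolding F_def k_def r_def by (intro mult_left_mono mult_right_mono) auto
    qed
    finally show ?thesis .
  qed
  have bI: "(indicator (ball x r) :: real^'n \<Rightarrow> ennreal) \<in> borel_measurable lebesgue" for x r
    by (intro borel_measurable_indicator) auto
  have kf: "(\<integral>\<^sup>+y. k x y * ennreal (u x y) * f y \<partial>lebesgue) = U f x"
    and km: "(\<lambda>y. k x y * ennreal (u x y) * f y) \<in> borel_measurable lebesgue"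
    if f: "f \<in> borel_measurable lebesgue" for x f
  proof -
    have m: "(\<lambda>y. ennreal (u x y) * f y * indicator (ball x r) y) \<in> borel_measurable lebesgue" for r
      by (intro borel_measurable_times_ennreal bI f measurable_compose[OF um(2) measurable_ennreal])
    have "(\<integral>\<^sup>+y. k x y * ennreal (u x y) * f y \<partial>lebesgue) =
      (\<integral>\<^sup>+y. (\<Sum>i. ennreal (c i) * (ennreal (dyadic i powr - n) * (ennreal (u x y) * f y
          * indicator (ball x (dyadic i)) y))) \<partial>lebesgue)"
    proof (rule nn_integral_cong)
      fix y
      have r: "(t1 * (t2 * i)) * z = t1 * (t2 * (z * i))" for t1 t2 i z :: ennreal
        by (simp only: ac_simps)
      have "k x y * z = (\<Sum>i. ennreal (c i) * (ennreal (dyadic i powr - n)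
          * (z * indicator (ball x (dyadic i)) y)))" for z
        unfolding k_def ennreal_suminf_multc[symmetric] by (simp only: r)
      from this[of "ennreal (u x y) * f y"] show "k x y * ennreal (u x y) * f y =
          (\<Sum>i. ennreal (c i) * (ennreal (dyadic i powr - n) * (ennreal (u x y) * f y
              * indicator (ball x (dyadic i)) y)))"
        by (simp only: mult.assoc)
    qed
    also have "\<dots> = (\<Sum>i. \<integral>\<^sup>+y. ennreal (c i) * (ennreal (dyadic i powr - n) * (ennreal (u x y) * f y
        * indicator (ball x (dyadic i)) y)) \<partial>lebesgue)"
      by (intro nn_integral_suminf borel_measurable_times_ennreal[OF borel_measurable_const] m)
    also have "\<dots> = U f x"
    proof -
      have "(\<integral>\<^sup>+y. t1 * (t2 * (ennreal (u x y) * f y * indicator (ball x r) y)) \<partial>lebesgue)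
          = t1 * (t2 * Av r f x)" for t1 t2 r
        using nn_integral_cmult[OF m, of "t1 * t2" r] by (simp only: mult.assoc Av_def)
      then show ?thesis unfolding U_def by (simp only:)
    qed
    finally show "(\<integral>\<^sup>+y. k x y * ennreal (u x y) * f y \<partial>lebesgue) = U f x" .
    show "(\<lambda>y. k x y * ennreal (u x y) * f y) \<in> borel_measurable lebesgue"
      unfolding k_def by (intro borel_measurable_times_ennreal borel_measurable_suminf_order
          borel_measurable_const
          bI f measurable_compose[OF um(2) measurable_ennreal])
  qed
  obtain T' where T': "0 \<le> T'" "T = ennreal T'" using T by (cases T) auto
  have "kernel_bounded p w H (D powr p * T')"
    unfolding kernel_bounded_def
  proof (intro conjI ballI)
    show "0 \<le> D powr p * T'" using T' by simp
    fix f :: "real^'n \<Rightarrow> ennreal" assume fm: "f \<in> borel_measurable lebesgue"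
    have "AE x in lebesgue. (\<integral>\<^sup>+y. H x y * f y \<partial>lebesgue) \<le> ennreal D * U f x"
      using near far
    proof eventually_elim
      case (elim x)
      have "AE y in lebesgue. y \<noteq> x"
        by (rule AE_not_in[of "{x}", simplified]) simp
      then have "AE y in lebesgue. H x y * f y \<le> ennreal D * (k x y * ennreal (u x y) * f y)"
      proof eventually_elim
        case y: (elim y)
        have "H x y * f y \<le> ennreal D * (k x y * ennreal (u x y)) * f y"
          using elim y by (intro mult_right_mono ptw) (auto simp: u_def)
        then show ?case by (simp only: mult.assoc)
      qed
      then have "(\<integral>\<^sup>+y. H x y * f y \<partial>lebesgue)
          \<le> (\<integral>\<^sup>+y. ennreal D * (k x y * ennreal (u x y) * f y) \<partial>lebesgue)"
        by (rule nn_integral_mono_AE)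
      then show ?case unfolding nn_integral_cmult[OF km[OF fm]] kf[OF fm] .
    qed
    then have "AE x in weighted w. epowr (\<integral>\<^sup>+y. H x y * f y \<partial>lebesgue) p \<le> ennreal (D powr p)
        * epowr (U f x) p"
      using D p by (intro AE_weighted[OF wm])
          (auto elim!: eventually_mono dest: epowr_mono[of _ _ p] simp: epowr_mult)
    then have "(\<integral>\<^sup>+x. epowr (\<integral>\<^sup>+y. H x y * f y \<partial>lebesgue) p \<partial>weighted w)
        \<le> (\<integral>\<^sup>+x. ennreal (D powr p) * epowr (U f x) p \<partial>weighted w)"
      by (rule nn_integral_mono_AE)
    also have "\<dots> = ennreal (D powr p) * (\<integral>\<^sup>+x. epowr (U f x) p \<partial>weighted w)"
    proof (intro nn_integral_cmult borel_measurable_epowr)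
      show "U f \<in> borel_measurable (weighted w)"
        unfolding U_def[abs_def] measurable_cong_sets[OF sets_weighted refl]
        by (intro borel_measurable_suminf_order borel_measurable_times_ennreal
            borel_measurable_const meas fm)
    qed
    also have "\<dots> \<le> ennreal (D powr p) * (T * (\<integral>\<^sup>+y. epowr (f y) p \<partial>weighted w))"
      by (intro mult_left_mono U fm) simp
    also have "\<dots> = ennreal (D powr p * T') * (\<integral>\<^sup>+y. epowr (f y) p \<partial>weighted w)"
      using T' by (simp add: ennreal_mult mult.assoc)
    finally show "(\<integral>\<^sup>+x. epowr (\<integral>\<^sup>+y. H x y * f y \<partial>lebesgue) p \<partial>weighted w) \<le>
        ennreal (D powr p * T') * (\<integral>\<^sup>+y. epowr (f y) p \<partial>weighted w)" .
  qed
  then show ?thesis by (rule that)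
qed

section \<open>Test functions and operators with a kernel\<close>

lemma smooth_imp_continuous:
  assumes "smooth f"
  shows "continuous_on UNIV f"
proof -
  have "foldr dir_deriv [] f differentiable (at x)" for x
    using assms unfolding smooth_def by blast
  then show ?thesis
    by (intro continuous_at_imp_continuous_on ballI differentiable_imp_continuous_within) simp
qed

lemma test_function_support:
  assumes "test_function f"
  obtains R where "0 \<le> R" "\<And>x. R < norm x \<Longrightarrow> f x = 0"
proof -
  have "bounded (closure {x. f x \<noteq> 0})" using assms
      by (auto simp: test_function_def compact_imp_bounded)
  then obtain R where R: "\<And>x. x \<in> closure {x. f x \<noteq> 0} \<Longrightarrow> norm x \<le> R" by (auto simp: bounded_iff)
  have "f x = 0" if "max 0 R < norm x" for x
    using R[of x] closure_subset[of "{x. f x \<noteq> 0}"] that by force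
  then show ?thesis using that[of "max 0 R"] by auto
qed

lemma continuous_compact_support_bounded:
  fixes f :: "'a::euclidean_space \<Rightarrow> complex"
  assumes "continuous_on UNIV f" "\<And>x. R < norm x \<Longrightarrow> f x = 0"
  obtains B where "0 \<le> B" "\<And>x. cmod (f x) \<le> B"
proof -
  have "compact (f ` cball 0 R)"
    using assms(1) by (intro compact_continuous_image) (auto intro: continuous_on_subset)
  then have "bounded (f ` cball 0 R)" by (rule compact_imp_bounded)
  then obtain B where B: "\<forall>z\<in>f ` cball 0 R. cmod z \<le> B" unfolding bounded_iff by blast
  have "cmod (f x) \<le> max 0 B" for x
    using B assms(2)[of x] by (cases "norm x \<le> R") (auto simp: le_max_iff_disj)
  then show ?thesis using that[of "max 0 B"] by auto
qed

lemma test_function_Lp: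
  fixes f :: "real^'n \<Rightarrow> complex"
  assumes f: "test_function f" and w: "locally_integrable w" "\<And>x. 0 \<le> w x" and p: "0 < p"
  shows "f \<in> Lp p w"
proof -
  have cont: "continuous_on UNIV f" using f by (auto simp: test_function_def smooth_imp_continuous)
  then have fm [measurable]: "f \<in> borel_measurable lebesgue"
    by (intro measurable_completion) (auto intro: borel_measurable_continuous_onI)
  obtain R where R: "\<And>x. R < norm x \<Longrightarrow> f x = 0" using test_function_support[OF f] by blast
  obtain B where B: "0 \<le> B" "\<And>x. cmod (f x) \<le> B"
    using continuous_compact_support_bounded[OF cont R] by blast
  have "(\<integral>\<^sup>+x. ennreal (norm (norm (f x) powr p)) \<partial>weighted w)
      \<le> (\<integral>\<^sup>+x. ennreal (B powr p) * indicator (cball 0 R) x \<partial>weighted w)"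
  proof (rule nn_integral_mono)
    fix x
    show "ennreal (norm (norm (f x) powr p)) \<le> ennreal (B powr p) * indicator (cball 0 R) x"
    proof (cases "norm x \<le> R")
      case True
      then show ?thesis using B(2)[of x] p by (auto intro!: ennreal_leI powr_mono2)
    next
      case False
      then show ?thesis using R[of x] by simp
    qed
  qed
  also have "\<dots> = ennreal (B powr p) * emeasure (weighted w) (cball 0 R)"
    by (intro nn_integral_cmult_indicator) auto
  also have "\<dots> < top"
    using emeasure_weighted_finite[OF w(1) _ _ w(2), of "cball 0 R"]
        by (auto simp: ennreal_mult_less_top)
  finally have "integrable (weighted w) (\<lambda>x. norm (f x) powr p)"
    by (intro integrableI_bounded)
        (auto simp: measurable_cong_sets[OF sets_weighted refl] infinity_ennreal_def)
  then show ?thesis using fm by (simp add: Lp_def)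
qed

text \<open>The measure \<open>weighted w\<close> is then zero, so the zero operator meets every
  clause and all almost-everywhere statements are void.\<close>

lemma bounded_on_Lp_if_weight_zero:
  assumes w: "w \<in> borel_measurable lebesgue" "AE x in lebesgue. w x = 0"
  shows "bounded_on_Lp p w T"
proof -
  have AE: "AE x in weighted w. P x" for P
    using w unfolding weighted_def by (subst AE_density) (auto elim!: eventually_mono)
  have "(\<lambda>_. 0) \<in> Lp p w" by (simp add: Lp_def)
  then show ?thesis unfolding bounded_on_Lp_def
    by (intro exI[of _ "\<lambda>_ _. 0"] exI[of _ 0]) (auto simp: Lp_norm_def intro: AE)
qed

text \<open>The extension \<open>S\<close> is the kernel integral itself: for \<open>f\<close> in
  \<open>Lp p w\<close> it converges absolutely almost everywhere, because the operator with kernel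
  |H| is bounded.\<close>

theorem bounded_on_Lp_kernel:
  fixes H :: "real^'n \<Rightarrow> real^'n \<Rightarrow> complex"
  assumes w: "locally_integrable w" "\<And>x. 0 \<le> w x" and p: "1 < p"
    and Hm [measurable]: "(\<lambda>(x, y). H x y) \<in> borel_measurable (lebesgue \<Otimes>\<^sub>M lebesgue)"
    and KB: "kernel_bounded p w (\<lambda>x y. ennreal (cmod (H x y))) K"
    and agree: "\<And>f. test_function f \<Longrightarrow> AE x in weighted w. T f x = (LINT y|lebesgue. H x y * f y)"
  shows "bounded_on_Lp p w T"
proof -
  have K: "0 \<le> K" and bound: "\<And>f. f \<in> borel_measurable lebesgue \<Longrightarrow>
      (\<integral>\<^sup>+x. epowr (\<integral>\<^sup>+y. ennreal (cmod (H x y)) * f y \<partial>lebesgue) p \<partial>weighted w)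
          \<le> ennreal K * (\<integral>\<^sup>+y. epowr (f y) p \<partial>weighted w)"
    using KB unfolding kernel_bounded_def by blast+
  have wm [measurable]: "w \<in> borel_measurable lebesgue"
      by (rule borel_measurable_locally_integrable[OF w(1)])
  define S where "S f x = (LINT y|lebesgue. H x y * f y)" for f x
  define U where "U f x = (\<integral>\<^sup>+y. ennreal (cmod (H x y)) * ennreal (cmod (f y)) \<partial>lebesgue)"
      for f :: "real^'n \<Rightarrow> complex" and x
  note mw = measurable_cong_sets[OF sets_weighted refl]
  have Hx [measurable]: "H x \<in> borel_measurable lebesgue" for x
    using measurable_Pair2[OF Hm, of x] by simp
  have Ufin: "AE x in weighted w. U f x < top" and Sbd: "(\<integral>\<^sup>+x. epowr (U f x) p \<partial>weighted w)
      \<le> ennreal K * (\<integral>\<^sup>+x. ennreal (cmod (f x) powr p) \<partial>weighted w)"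
    and Ifin: "(\<integral>\<^sup>+x. ennreal (cmod (f x) powr p) \<partial>weighted w)
        = ennreal (LINT x|weighted w. cmod (f x) powr p)"
    and fm: "f \<in> borel_measurable lebesgue" if f: "f \<in> Lp p w" for f
  proof -
    show fm [measurable]: "f \<in> borel_measurable lebesgue" using f by (simp add: Lp_def)
    show Ifin: "(\<integral>\<^sup>+x. ennreal (cmod (f x) powr p) \<partial>weighted w)
        = ennreal (LINT x|weighted w. cmod (f x) powr p)"
      using f by (intro nn_integral_eq_integral) (auto simp: Lp_def)
    show bd: "(\<integral>\<^sup>+x. epowr (U f x) p \<partial>weighted w)
        \<le> ennreal K * (\<integral>\<^sup>+x. ennreal (cmod (f x) powr p) \<partial>weighted w)"
      using bound[of "\<lambda>y. ennreal (cmod (f y))"] by (simp add: U_def)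
    have Um: "U f \<in> borel_measurable lebesgue" unfolding U_def by measurable
    have "(\<integral>\<^sup>+x. epowr (U f x) p \<partial>weighted w) < top"
      using bd unfolding Ifin by (rule le_less_trans) (simp add: ennreal_mult_less_top)
    then have "AE x in weighted w. epowr (U f x) p \<noteq> \<infinity>"
      using Um by (intro nn_integral_PInf_AE) (auto simp: mw infinity_ennreal_def)
    then show "AE x in weighted w. U f x < top"
      by eventually_elim (simp add: infinity_ennreal_def less_top)
  qed
  have int: "integrable lebesgue (\<lambda>y. H x y * f y)" if "U f x < top" "f \<in> borel_measurable lebesgue"
      for f x
    using that unfolding U_def by (intro integrableI_bounded)
        (auto simp: norm_mult ennreal_mult infinity_ennreal_def)
  \<comment> \<open>Where the integral diverges \<open>U f x\<close> is infinite and the bound is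
    trivial, so it holds at every \<open>x\<close>.\<close>
  have SU: "ennreal (cmod (S f x)) \<le> U f x" if "f \<in> borel_measurable lebesgue" for f x
  proof (cases "U f x < top")
    case True
    then show ?thesis
      using integral_norm_bound_ennreal[OF int[OF True that]] unfolding S_def U_def
      by (simp add: norm_mult ennreal_mult)
  qed (simp add: not_less top_unique)
  have Sm: "S f \<in> borel_measurable lebesgue" if [measurable]: "f \<in> borel_measurable lebesgue" for f
    unfolding S_def by measurable
  have main: "S f \<in> Lp p w \<and> Lp_norm p w (S f) \<le> K powr (1 / p) * Lp_norm p w f" if f: "f \<in> Lp p w"
      for f
  proof -
    note fm [measurable] = fm[OF f]
    have "(\<integral>\<^sup>+x. ennreal (cmod (S f x) powr p) \<partial>weighted w) \<le> (\<integral>\<^sup>+x. epowr (U f x) p \<partial>weighted w)"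
      using epowr_mono[OF SU[OF fm], of p] p by (intro nn_integral_mono) simp
    also note Sbd[OF f]
    finally have le: "(\<integral>\<^sup>+x. ennreal (cmod (S f x) powr p) \<partial>weighted w)
        \<le> ennreal (K * (LINT x|weighted w. cmod (f x) powr p))"
      unfolding Ifin[OF f] using K by (simp add: ennreal_mult)
    have intS: "integrable (weighted w) (\<lambda>x. cmod (S f x) powr p)"
      using Sm[OF fm] le_less_trans[OF le] by (intro integrableI_bounded)
          (auto simp: mw infinity_ennreal_def)
    have "ennreal (LINT x|weighted w. cmod (S f x) powr p)
        \<le> ennreal (K * (LINT x|weighted w. cmod (f x) powr p))"
      using le by (subst nn_integral_eq_integral[symmetric]) (auto simp: intS)
    then have "(LINT x|weighted w. cmod (S f x) powr p)
        \<le> K * (LINT x|weighted w. cmod (f x) powr p)"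
      using K by (subst (asm) ennreal_le_iff) auto
    then have "Lp_norm p w (S f) \<le> (K * (LINT x|weighted w. cmod (f x) powr p)) powr (1 / p)"
      unfolding Lp_norm_def using p by (intro powr_mono2) auto
    then show ?thesis using intS Sm[OF fm] unfolding Lp_def Lp_norm_def by (simp add: powr_mult)
  qed
  show ?thesis unfolding bounded_on_Lp_def
  proof (intro exI conjI ballI allI impI)
    show "S f \<in> Lp p w" "Lp_norm p w (S f) \<le> K powr (1 / p) * Lp_norm p w f" if "f \<in> Lp p w" for f
      using main[OF that] by auto
    show "AE x in weighted w. S (\<lambda>y. f y + g y) x = S f x + S g x" if "f \<in> Lp p w" "g \<in> Lp p w"
        for f g
      using Ufin[OF that(1)] Ufin[OF that(2)]
    proof eventually_elim
      case (elim x)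
      then show ?case unfolding S_def
        using int[OF elim(1) fm[OF that(1)]] int[OF elim(2) fm[OF that(2)]]
            by (simp add: distrib_left)
    qed
    \<comment> \<open>Homogeneity holds at every \<open>x\<close>, even where the integral diverges
      and the Bochner integral is 0 by convention. Additivity above needs convergence.\<close>
    show "AE x in weighted w. S (\<lambda>y. c * f y) x = c * S f x" if "f \<in> Lp p w" for f c
    proof (intro AE_I2)
      fix x
      have "H x y * (c * f y) = c * (H x y * f y)" for y by simp
      then show "S (\<lambda>y. c * f y) x = c * S f x" unfolding S_def
          by (simp only: integral_mult_right_zero)
    qed
    show "AE x in weighted w. S f x = T f x" if "test_function f" for f
      using agree[OF that] by eventually_elim (simp add: S_def)
  qed
qed

section \<open>Oscillatory integrals\<close>

text \<open>As the Euclidean norm of (1, x) the bracket inherits the triangle inequality, from which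
  the comparison estimates below follow.\<close>

lemma japanese_eq_norm: "japanese x = norm (1 :: real, x)"
  by (simp add: japanese_def norm_Pair powr_half_sqrt add_nonneg_nonneg)

lemma japanese_ge_1: "1 \<le> japanese x"
  using norm_fst_le[of "1::real" x] by (simp add: japanese_eq_norm)

lemma japanese_pos: "0 < japanese x"
  using japanese_ge_1[of x] by linarith

lemma norm_le_japanese: "norm x \<le> japanese x"
  using norm_snd_le[of x "1::real"] by (simp add: japanese_eq_norm)

lemma japanese_le: "japanese x \<le> 1 + norm x"
  using norm_Pair_le[of "1::real" x] by (simp add: japanese_eq_norm)

lemma japanese_add_le: "japanese (x + h) \<le> japanese x + norm h"
  using norm_triangle_ineq[of "(1::real, x)" "(0, h)"] by (simp add: japanese_eq_norm)

lemma continuous_on_japanese [continuous_intros]: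
  "continuous_on S f \<Longrightarrow> continuous_on S (\<lambda>x. japanese (f x))"
  unfolding japanese_eq_norm by (intro continuous_intros)

lemma borel_measurable_japanese [measurable]: "japanese \<in> borel_measurable borel"
  by (intro borel_measurable_continuous_onI continuous_intros)

text \<open>Dyadic shells: where 2^j \<le> \<open>japanese x\<close> < 2^(j+1) the integrand is at
  most 2^(jq), on a set inside a ball of volume comparable to 2^(jn). As q + n < 0 the series is
  geometric.\<close>

lemma integrable_japanese_powr:
  assumes q: "q < - real CARD('n)"
  shows "integrable lborel (\<lambda>x::real^'n. japanese x powr q)"
proof (rule integrableI_bounded)
  define V where "V = unit_ball_vol (real CARD('n))"
  define n where "n = real CARD('n)"
  have V: "0 \<le> V" by (simp add: V_def)
  have "(\<integral>\<^sup>+x. ennreal (norm (japanese x powr q)) \<partial>(lborel :: (real^'n) measure)) \<le>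
      (\<integral>\<^sup>+x. (\<Sum>j. ennreal (2 powr (real j * q)) * indicator (ball (0 :: real^'n) (2 ^ Suc j)) x)
          \<partial>lborel)"
  proof (rule nn_integral_mono)
    fix x :: "real^'n"
    have ex: "\<exists>j. japanese x < 2 ^ Suc j"
    proof -
      obtain j where "japanese x < 2 ^ j" using real_arch_pow[of 2 "japanese x"] by auto
      moreover have "(2::real) ^ j \<le> 2 ^ Suc j" by simp
      ultimately show ?thesis by (intro exI[of _ j]) linarith
    qed
    define j where "j = (LEAST j. japanese x < 2 ^ Suc j)"
    have j1: "japanese x < 2 ^ Suc j" unfolding j_def by (rule LeastI_ex[OF ex])
    have j2: "2 ^ j \<le> japanese x"
    proof (cases j)
      case 0
      then show ?thesis using japanese_ge_1 by simp
    next
      case (Suc i)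
      then have "\<not> japanese x < 2 ^ Suc i"
        using not_less_Least[of i "\<lambda>j. japanese x < 2 ^ Suc j"] unfolding j_def by simp
      then show ?thesis using Suc by simp
    qed
    have "japanese x powr q \<le> (2 ^ j) powr q"
      using q j2 by (intro powr_mono2') auto
    also have "(2 ^ j) powr q = 2 powr (real j * q)" by (simp add: powr_powr flip: powr_realpow)
    finally have "japanese x powr q \<le> 2 powr (real j * q)" .
    moreover have "x \<in> ball 0 (2 ^ Suc j)" using norm_le_japanese[of x] j1 by simp
    ultimately have le: "ennreal (norm (japanese x powr q)) \<le> ennreal (2 powr (real j * q))
        * indicator (ball 0 (2 ^ Suc j)) x"
      by (simp add: ennreal_leI)
    define F where "F j = ennreal (2 powr (real j * q)) * indicator (ball 0 (2 ^ Suc j)) x" for j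
    have "F j \<le> suminf F" using sum_le_suminf[of F "{j}"] by simp
    with le show "ennreal (norm (japanese x powr q)) \<le> (\<Sum>j. ennreal (2 powr (real j * q))
        * indicator (ball 0 (2 ^ Suc j)) x)"
      unfolding F_def by (rule order_trans)
  qed
  also have "\<dots> = (\<Sum>j. \<integral>\<^sup>+x. ennreal (2 powr (real j * q))
      * indicator (ball (0 :: real^'n) (2 ^ Suc j)) x \<partial>lborel)"
    by (rule nn_integral_suminf)
        (intro borel_measurable_times_ennreal borel_measurable_const borel_measurable_indicator,
        simp)
  also have "\<dots> = (\<Sum>j. ennreal (2 powr (real j * q))
      * emeasure lborel (ball (0::real^'n) (2 ^ Suc j)))"
  proof -
    have "(\<integral>\<^sup>+x. c * indicator (ball (0 :: real^'n) r) x \<partial>lborel)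
        = c * emeasure lborel (ball (0::real^'n) r)" for c r
      by (rule nn_integral_cmult_indicator) simp
    then show ?thesis by (simp only:)
  qed
  also have "\<dots> = (\<Sum>j. ennreal (V * 2 ^ CARD('n) * (2 powr (q + n)) ^ j))"
  proof -
    have "2 powr (real j * q) * (V * (2 ^ Suc j) ^ CARD('n)) = V * 2 ^ CARD('n) * (2 powr (q + n)) ^
        j" for j
    proof -
      have "(2 powr (q + n)) ^ j = 2 powr (real j * q) * 2 powr (real j * n)"
        by (subst powr_power) (simp_all add: distrib_left powr_add)
      moreover have "2 powr (real j * n) = (2 ^ j) ^ CARD('n)"
      proof -
        have "real j * n = real (j * CARD('n))" by (simp add: n_def)
        then have "2 powr (real j * n) = 2 ^ (j * CARD('n))"
            by (simp only: powr_realpow zero_less_numeral)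
        then show ?thesis by (simp only: power_mult)
      qed
      ultimately show ?thesis by (simp add: power_mult_distrib)
    qed
    moreover have "ennreal (2 powr (real j * q)) * emeasure lborel (ball (0::real^'n) (2 ^ Suc j)) =
        ennreal (2 powr (real j * q) * (V * (2 ^ Suc j) ^ CARD('n)))" for j
      using V by (subst emeasure_ball)
          (simp_all only: V_def ennreal_mult DIM_cart DIM_real mult_1_right
          powr_ge_zero zero_le_power zero_le_numeral mult_nonneg_nonneg)
    ultimately show ?thesis by (simp only:)
  qed
  also have "\<dots> < top"
    using q V powr_less_mono[of "q + n" 0 2]
        by (intro suminf_ennreal_geometric_less_top[of "2 powr (q + n)" "V * 2 ^ CARD('n)"])
        (auto simp: n_def)
  finally show "(\<integral>\<^sup>+x. ennreal (norm (japanese x powr q)) \<partial>(lborel :: (real^'n) measure)) < \<infinity>"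
    by (simp add: infinity_ennreal_def)
qed simp

text \<open>\<open>D k\<close> plays the k-th derivative of \<open>D 0\<close> along
  \<open>v\<close>. With the whole sequence as datum, Leibniz' rule and rescaling are statements
  about explicit formulas instead of iterated \<open>dir_deriv\<close>.\<close>

definition line_seq :: "'a::real_normed_vector \<Rightarrow> (nat \<Rightarrow> 'a \<Rightarrow> complex) \<Rightarrow> bool" where
  "line_seq v D \<longleftrightarrow> (\<forall>k x. ((\<lambda>t. D k (x + t *\<^sub>R v)) has_vector_derivative D (Suc k) x) (at 0))"

lemma line_derivative_shift:
  fixes H :: "'a::real_normed_vector \<Rightarrow> complex"
  assumes "\<And>x. ((\<lambda>t. H (x + t *\<^sub>R v)) has_vector_derivative H' x) (at 0)"
  shows "((\<lambda>t. H (x + t *\<^sub>R v)) has_vector_derivative H' (x + s *\<^sub>R v)) (at s)"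
proof -
  have "((\<lambda>t. H (x + s *\<^sub>R v + t *\<^sub>R v)) has_vector_derivative H' (x + s *\<^sub>R v)) (at (s - s))"
    using assms[of "x + s *\<^sub>R v"] by simp
  moreover have "((\<lambda>t. t - s) has_vector_derivative 1) (at s)"
    by (auto intro!: derivative_eq_intros)
  ultimately have "((\<lambda>t. H (x + s *\<^sub>R v + t *\<^sub>R v)) \<circ> (\<lambda>t. t - s) has_vector_derivative 1 *\<^sub>R H' (x
      + s *\<^sub>R v)) (at s)"
    by (intro vector_diff_chain_at)
  moreover have "(\<lambda>t. H (x + s *\<^sub>R v + t *\<^sub>R v)) \<circ> (\<lambda>t. t - s) = (\<lambda>t. H (x + t *\<^sub>R v))"
    by (auto simp: scaleR_diff_left algebra_simps)
  ultimately show ?thesis by simp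
qed

text \<open>For complex values the mean value theorem is only an inequality. Negative
  \<open>t\<close> are reduced to positive ones by traversing the segment backwards.\<close>

lemma line_mean_value:
  fixes H :: "'a::real_normed_vector \<Rightarrow> complex"
  assumes der: "\<And>x. ((\<lambda>t. H (x + t *\<^sub>R v)) has_vector_derivative H' x) (at 0)"
  shows "\<exists>s. \<bar>s\<bar> \<le> \<bar>t\<bar> \<and> cmod (H (x + t *\<^sub>R v) - H x) \<le> \<bar>t\<bar> * cmod (H' (x + s *\<^sub>R v))"
proof -
  have pos: "\<exists>s. 0 \<le> s \<and> s \<le> t \<and> cmod (H (x + t *\<^sub>R v) - H x) \<le> t * cmod (H' (x + s *\<^sub>R v))"
      if t: "0 < t" for t x
  proof -
    let ?f = "\<lambda>t. H (x + t *\<^sub>R v)"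
    have d: "(?f has_derivative (\<lambda>h. h *\<^sub>R H' (x + s *\<^sub>R v))) (at s)" for s
      using line_derivative_shift[of H v H', OF der] by (simp add: has_vector_derivative_def)
    then have "continuous_on {0..t} ?f"
      by (meson has_derivative_continuous continuous_at_imp_continuous_on)
    then obtain s where "s \<in> {0<..<t}" "cmod (?f t - ?f 0) \<le> cmod ((t - 0) *\<^sub>R H' (x + s *\<^sub>R v))"
      using mvt_general[OF t, of ?f "\<lambda>s h. h *\<^sub>R H' (x + s *\<^sub>R v)"] d by blast
    then show ?thesis using t by (intro exI[of _ s]) auto
  qed
  consider "t = 0" | "0 < t" | "t < 0" by linarith
  then show ?thesis
  proof cases
    case 2
    then obtain s where "0 \<le> s" "s \<le> t" "cmod (H (x + t *\<^sub>R v) - H x) \<le> t * cmod (H' (x + s *\<^sub>R v))"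
      using pos[of t x] by auto
    then show ?thesis using 2 by (intro exI[of _ s]) auto
  next
    case 3
    obtain s where s: "0 \<le> s" "s \<le> - t" "cmod (H (x + t *\<^sub>R v + (- t) *\<^sub>R v) - H (x + t *\<^sub>R v))
        \<le> - t * cmod (H' (x + t *\<^sub>R v + s *\<^sub>R v))"
      using pos[of "- t" "x + t *\<^sub>R v"] 3 by auto
    have e: "x + t *\<^sub>R v + s *\<^sub>R v = x + (t + s) *\<^sub>R v" by (simp add: algebra_simps)
    have "\<bar>t + s\<bar> \<le> \<bar>t\<bar>" using s(1,2) 3 by simp
    moreover have "cmod (H (x + t *\<^sub>R v) - H x) \<le> \<bar>t\<bar> * cmod (H' (x + (t + s) *\<^sub>R v))"
      using s(3) 3 unfolding e by (simp add: norm_minus_commute)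
    ultimately show ?thesis by blast
  qed auto
qed

lemma lborel_integral_shift:
  fixes f :: "real^'n \<Rightarrow> complex"
  assumes "f \<in> borel_measurable borel"
  shows "(LINT x|lborel. f (x + c)) = (LINT x|lborel. f x)"
proof -
  have "(LINT x|lborel. f x) = (LINT x|distr lborel borel ((+) c). f x)"
      by (simp add: lborel_distr_plus)
  also have "\<dots> = (LINT x|lborel. f (c + x))" using assms by (intro integral_distr) auto
  finally show ?thesis by (simp add: add.commute)
qed

lemma lborel_integrable_shift:
  fixes f :: "real^'n \<Rightarrow> 'b::{banach, second_countable_topology}"
  assumes "integrable lborel f"
  shows "integrable lborel (\<lambda>x. f (x + c))"
proof -
  have "integrable (distr lborel borel ((+) c)) f" using assms by (simp add: lborel_distr_plus)
  then have "integrable lborel (\<lambda>x. f (c + x))" using assms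
      by (subst (asm) integrable_distr_eq) auto
  then show ?thesis by (simp add: add.commute)
qed

lemma continuous_compact_support_integrable:
  fixes f :: "real^'n \<Rightarrow> complex"
  assumes "continuous_on UNIV f" "\<And>x. R < norm x \<Longrightarrow> f x = 0"
  shows "integrable lborel f"
proof -
  have "integrable lborel (\<lambda>x. indicator (cball 0 R) x *\<^sub>R f x)"
    using assms(1) by (intro borel_integrable_compact) (auto intro: continuous_on_subset)
  moreover have "(\<lambda>x. indicator (cball 0 R) x *\<^sub>R f x) = f"
    using assms(2) by (auto simp: fun_eq_iff indicator_def not_le)
  ultimately show ?thesis by simp
qed

definition phase :: "'a::real_inner \<Rightarrow> 'a \<Rightarrow> complex" where
  "phase z \<xi> = exp (\<i> * of_real (z \<bullet> \<xi>))"

lemma norm_phase [simp]: "cmod (phase z \<xi>) = 1"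
  by (simp add: phase_def)

lemma continuous_on_phase [continuous_intros]:
  "continuous_on S f \<Longrightarrow> continuous_on S g \<Longrightarrow> continuous_on S (\<lambda>x. phase (f x) (g x))"
  unfolding phase_def by (intro continuous_intros)

lemma phase_add: "phase z (\<xi> + \<eta>) = phase z \<xi> * phase z \<eta>"
  by (simp add: phase_def inner_add_right distrib_left exp_add)

lemma borel_measurable_phase [measurable]: "phase z \<in> borel_measurable borel"
  by (intro borel_measurable_continuous_onI continuous_intros)

text \<open>Difference quotients along \<open>v\<close> have integral 0 by translation invariance,
  and dominated convergence passes this on to the derivative. Neither coordinates nor iterated
  integrals enter, so \<open>v\<close> is arbitrary.\<close>

lemma integral_line_derivative_eq_0:
  fixes H H' :: "real^'n \<Rightarrow> complex"
  assumes cont: "continuous_on UNIV H" "continuous_on UNIV H'"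
    and der: "\<And>x. ((\<lambda>t. H (x + t *\<^sub>R v)) has_vector_derivative H' x) (at 0)"
    and supp: "\<And>x. R < norm x \<Longrightarrow> H x = 0" "\<And>x. R < norm x \<Longrightarrow> H' x = 0"
  shows "(LINT x|lborel. H' x) = 0"
proof -
  obtain B where B: "0 \<le> B" "\<And>x. cmod (H' x) \<le> B"
    using continuous_compact_support_bounded[OF cont(2) supp(2)] by blast
  have [measurable]: "H \<in> borel_measurable borel" "H' \<in> borel_measurable borel"
    using cont by (auto intro: borel_measurable_continuous_onI)
  define \<tau> where "\<tau> j = 1 / real (Suc j)" for j
  have tau: "0 < \<tau> j" "\<tau> j \<le> 1" for j by (auto simp: \<tau>_def field_simps)
  define D where "D j x = (H (x + \<tau> j *\<^sub>R v) - H x) /\<^sub>R \<tau> j" for j x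
  have HI: "integrable lborel H" by (rule continuous_compact_support_integrable[OF cont(1) supp(1)])
  have D0: "(LINT x|lborel. D j x) = 0" for j
    unfolding D_def using HI lborel_integrable_shift[OF HI, of "\<tau> j *\<^sub>R v"]
    by (simp add: lborel_integral_shift)
  have "(\<lambda>j. LINT x|lborel. D j x) \<longlonglongrightarrow> (LINT x|lborel. H' x)"
  proof (rule integral_dominated_convergence)
    \<comment> \<open>The steps are at most 1, so all difference quotients vanish beyond radius R +
      |v|; inside, the mean value inequality bounds them by \<open>B\<close>.\<close>
    show "integrable lborel (\<lambda>x. B * indicator (cball 0 (R + norm v)) x)"
      by (intro integrable_mult_right integrable_real_indicator emeasure_lborel_cball_finite) simp
    show "AE x in lborel. (\<lambda>j. D j x) \<longlonglongrightarrow> H' x"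
    proof (intro AE_I2)
      fix x
      have "((\<lambda>t. (H (x + t *\<^sub>R v) - H x) /\<^sub>R t) \<longlongrightarrow> H' x) (at 0)"
      proof -
        have lim: "((\<lambda>t. norm (H (x + t *\<^sub>R v) - H x - t *\<^sub>R H' x) / norm t) \<longlongrightarrow> 0) (at 0)"
          using der[of x] unfolding has_vector_derivative_def has_derivative_iff_norm by simp
        have "((\<lambda>t. norm ((H (x + t *\<^sub>R v) - H x) /\<^sub>R t - H' x)) \<longlongrightarrow> 0) (at 0)"
        proof (rule Lim_transform_eventually[OF lim])
          show "\<forall>\<^sub>F t in at 0. norm (H (x + t *\<^sub>R v) - H x - t *\<^sub>R H' x) / norm t =
              norm ((H (x + t *\<^sub>R v) - H x) /\<^sub>R t - H' x)"
          proof (rule eventually_at_filter[THEN iffD2], intro always_eventually allI impI)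
            fix t :: real assume t: "t \<noteq> 0"
            have "(H (x + t *\<^sub>R v) - H x) /\<^sub>R t - H' x = (H (x + t *\<^sub>R v) - H x - t *\<^sub>R H' x) /\<^sub>R t"
              using t by (simp add: scaleR_diff_right)
            then show "norm (H (x + t *\<^sub>R v) - H x - t *\<^sub>R H' x) / norm t =
                norm ((H (x + t *\<^sub>R v) - H x) /\<^sub>R t - H' x)"
              by (simp only: norm_scaleR norm_inverse real_norm_def abs_inverse divide_inverse
                  mult.commute)
          qed
        qed
        from tendsto_norm_zero_cancel[OF this] show ?thesis by (rule LIM_zero_cancel)
      qed
      moreover have "filterlim \<tau> (at 0) sequentially"
      proof -
        have "\<tau> \<longlonglongrightarrow> 0"
          unfolding \<tau>_def using LIMSEQ_Suc[OF lim_1_over_n[where 'a = real]] by simp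
        moreover have "\<tau> j \<noteq> 0" for j using tau(1)[of j] by simp
        ultimately show ?thesis
          unfolding filterlim_at by (simp add: always_eventually)
      qed
      ultimately show "(\<lambda>j. D j x) \<longlonglongrightarrow> H' x"
        unfolding D_def by (rule filterlim_compose)
    qed
    show "AE x in lborel. norm (D j x) \<le> B * indicator (cball 0 (R + norm v)) x" for j
    proof (intro AE_I2)
      fix x
      show "norm (D j x) \<le> B * indicator (cball 0 (R + norm v)) x"
      proof (cases "norm x \<le> R + norm v")
        case True
        obtain s where "cmod (H (x + \<tau> j *\<^sub>R v) - H x) \<le> \<bar>\<tau> j\<bar> * cmod (H' (x + s *\<^sub>R v))"
          using line_mean_value[of H v H' "\<tau> j" x, OF der] by blast
        also have "\<dots> \<le> \<tau> j * B" using tau[of j] B by (intro mult_mono) auto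
        finally have "cmod (H (x + \<tau> j *\<^sub>R v) - H x) / \<tau> j \<le> B"
          using tau(1)[of j] by (simp add: pos_divide_le_eq mult.commute)
        moreover have "cmod (D j x) = cmod (H (x + \<tau> j *\<^sub>R v) - H x) / \<tau> j"
          unfolding D_def norm_scaleR using tau(1)[of j] by (simp add: divide_inverse)
        ultimately show ?thesis using True by simp
      next
        case False
        have "norm x \<le> norm (x + \<tau> j *\<^sub>R v) + norm (\<tau> j *\<^sub>R v)"
          using norm_triangle_ineq4[of "x + \<tau> j *\<^sub>R v" "\<tau> j *\<^sub>R v"] by simp
        also have "norm (\<tau> j *\<^sub>R v) \<le> norm v" using tau[of j] by (simp add: mult_left_le_one_le)
        finally have "R < norm (x + \<tau> j *\<^sub>R v)" using False by simp
        moreover have "R < norm x" using False norm_ge_zero[of v] by linarith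
        ultimately show ?thesis using supp(1) False by (simp add: D_def)
      qed
    qed
  qed (auto simp: D_def)
  then show ?thesis unfolding D0 by (simp add: LIMSEQ_const_iff)
qed

text \<open>The derivative of \<open>D N * phase z\<close> along \<open>v\<close> has integral 0,
  and differentiating the phase produces the factor i (z \<bullet> v).\<close>

lemma integral_by_parts_phase:
  fixes D :: "nat \<Rightarrow> real^'n \<Rightarrow> complex"
  assumes D: "line_seq v D" and cont: "\<And>k. continuous_on UNIV (D k)" and supp: "\<And>k x. R < norm x \<Longrightarrow>
      D k x = 0"
  shows "(LINT \<xi>|lborel. D N \<xi> * phase z \<xi>) = (- (\<i> * of_real (z \<bullet> v))) ^ N * (LINT \<xi>|lborel. D 0 \<xi>
      * phase z \<xi>)"
proof (induction N)
  case (Suc N)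
  have int: "integrable lborel (\<lambda>\<xi>. D k \<xi> * phase z \<xi>)" for k
    using cont supp by (intro continuous_compact_support_integrable[of _ R] continuous_intros) auto
  have "(LINT \<xi>|lborel. D (Suc N) \<xi> * phase z \<xi> + (\<i> * of_real (z \<bullet> v)) * (D N \<xi> * phase z \<xi>)) = 0"
  proof (rule integral_line_derivative_eq_0[where H = "\<lambda>\<xi>. D N \<xi> * phase z \<xi>" and v = v and R = R])
    fix x
    have ph: "((\<lambda>t. phase z (x + t *\<^sub>R v)) has_vector_derivative \<i> * of_real (z \<bullet> v) * phase z x)
        (at 0)"
    proof -
      have "((\<lambda>t::real. \<i> * of_real (z \<bullet> x + t * (z \<bullet> v))) has_vector_derivative \<i>
          * of_real (z \<bullet> v)) (at 0)"
        by (auto intro!: derivative_eq_intros has_vector_derivative_mult_right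
            has_vector_derivative_of_real)
      moreover have "(exp has_field_derivative exp (\<i> * of_real (z \<bullet> x + 0 * (z \<bullet> v))))
          (at (\<i> * of_real (z \<bullet> x + 0 * (z \<bullet> v))))"
        by (rule DERIV_exp)
      ultimately have "(exp \<circ> (\<lambda>t::real. \<i> * of_real (z \<bullet> x + t * (z \<bullet> v))) has_vector_derivative
          \<i> * of_real (z \<bullet> v) * exp (\<i> * of_real (z \<bullet> x + 0 * (z \<bullet> v)))) (at 0)"
        by (rule field_vector_diff_chain_at)
      then show ?thesis
        by (simp add: phase_def inner_add_right o_def)
    qed
    have "((\<lambda>t. D N (x + t *\<^sub>R v)) has_vector_derivative D (Suc N) x) (at 0)"
      using D by (simp add: line_seq_def)
    from has_vector_derivative_mult[OF this ph]
    show "((\<lambda>t. D N (x + t *\<^sub>R v) * phase z (x + t *\<^sub>R v)) has_vector_derivative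
        D (Suc N) x * phase z x + (\<i> * of_real (z \<bullet> v)) * (D N x * phase z x)) (at 0)"
      by (simp add: algebra_simps)
  qed (use supp in \<open>auto intro!: continuous_intros cont\<close>)
  then have "(LINT \<xi>|lborel. D (Suc N) \<xi> * phase z \<xi>) + (\<i> * of_real (z \<bullet> v))
      * (LINT \<xi>|lborel. D N \<xi> * phase z \<xi>) = 0"
    using int by simp
  then have "(LINT \<xi>|lborel. D (Suc N) \<xi> * phase z \<xi>) = - (\<i> * of_real (z \<bullet> v))
      * (LINT \<xi>|lborel. D N \<xi> * phase z \<xi>)"
    by (simp add: eq_neg_iff_add_eq_0)
  then show ?case unfolding Suc.IH by (simp only: power_Suc mult.assoc)
qed simp

section \<open>Fractional differences of symbols\<close>

lemma powr_comparable_le: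
  fixes x y e :: real
  assumes "0 < x" "x / 2 \<le> y" "y \<le> 2 * x"
  shows "y powr e \<le> 2 powr \<bar>e\<bar> * x powr e"
proof (cases "0 \<le> e")
  case True
  then have "y powr e \<le> (2 * x) powr e" using assms by (intro powr_mono2) auto
  then show ?thesis using True by (simp add: powr_mult)
next
  case False
  then have "y powr e \<le> (x / 2) powr e" using assms by (intro powr_mono2') auto
  also have "\<dots> = 2 powr (- e) * x powr e" by (simp add: powr_divide powr_minus field_simps)
  finally show ?thesis using False by simp
qed

text \<open>The threshold \<open>2 \<bar>\<tau>\<bar> \<le> \<langle>\<xi>\<rangle>\<^sup>\<rho>\<close> decides whether the mean value theorem or the trivial bound is
  used for the difference.\<close>

lemma symbol_difference_bound:
  fixes B B' :: "real^'n \<Rightarrow> complex"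
  assumes der: "\<And>x. ((\<lambda>t. B (x + t *\<^sub>R v)) has_vector_derivative B' x) (at 0)" and v: "norm v = 1"
    and bd: "\<And>x. cmod (B x) \<le> C * japanese x powr \<mu>" "\<And>x. cmod (B' x) \<le> C * japanese x powr (\<mu> - \<rho>)"
    and C: "0 \<le> C" and rho: "0 \<le> \<rho>" "\<rho> \<le> 1" and t: "0 \<le> t" "t \<le> 1"
  shows "cmod (B (x + \<tau> *\<^sub>R v) - B x) \<le> C * 2 powr (1 + \<bar>\<mu> - \<rho>\<bar>) * \<bar>\<tau>\<bar> powr t *
    (japanese x powr (\<mu> - \<rho> * t) + japanese (x + \<tau> *\<^sub>R v) powr (\<mu> - \<rho> * t))"
proof -
  define q where "q = \<mu> - \<rho> * t"
  define c where "c = 2 powr \<bar>\<mu> - \<rho>\<bar>"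
  have c: "1 \<le> c" by (simp add: c_def ge_one_powr_ge_zero)
  have small: "cmod (B (y + \<sigma> *\<^sub>R v) - B y) \<le> C * c * \<bar>\<sigma>\<bar> powr t * japanese y powr q"
    if small: "2 * \<bar>\<sigma>\<bar> \<le> japanese y powr \<rho>" for y \<sigma>
  proof -
    have jr: "japanese y powr \<rho> \<le> japanese y"
      using powr_mono[of \<rho> 1 "japanese y"] rho japanese_ge_1[of y] by simp
    obtain s where s: "\<bar>s\<bar> \<le> \<bar>\<sigma>\<bar>" "cmod (B (y + \<sigma> *\<^sub>R v) - B y) \<le> \<bar>\<sigma>\<bar> * cmod (B' (y + s *\<^sub>R v))"
      using line_mean_value[of B v B' \<sigma> y, OF der] by blast
    \<comment> \<open>As \<rho> \<le> 1, the threshold also gives a step of at most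
      \<open>japanese y / 2\<close>, so the bracket stays within a factor 2 along the
      segment.\<close>
    have sm: "\<bar>s\<bar> \<le> japanese y / 2" using s(1) small jr by linarith
    have "japanese (y + s *\<^sub>R v) \<le> japanese y + \<bar>s\<bar>" using japanese_add_le[of y "s *\<^sub>R v"] v by simp
    moreover have "japanese y \<le> japanese (y + s *\<^sub>R v) + \<bar>s\<bar>"
        using japanese_add_le[of "y + s *\<^sub>R v" "- s *\<^sub>R v"] v by simp
    ultimately have cmp: "japanese (y + s *\<^sub>R v) powr (\<mu> - \<rho>) \<le> c * japanese y powr (\<mu> - \<rho>)"
      unfolding c_def using sm japanese_pos[of y] by (intro powr_comparable_le) auto
    \<comment> \<open>Interpolation: of the full power of |\<sigma>|, the part 1 - t is traded for
      the power \<rho> (1 - t) of the bracket. This turns the order \<mu> - \<rho> into \<mu> -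
      \<rho> t.\<close>
    have tau: "\<bar>\<sigma>\<bar> \<le> \<bar>\<sigma>\<bar> powr t * (japanese y powr \<rho>) powr (1 - t)"
    proof -
      have "\<bar>\<sigma>\<bar> powr (1 - t) \<le> (japanese y powr \<rho>) powr (1 - t)"
        using small t by (intro powr_mono2) auto
      then have "\<bar>\<sigma>\<bar> powr t * \<bar>\<sigma>\<bar> powr (1 - t) \<le> \<bar>\<sigma>\<bar> powr t * (japanese y powr \<rho>) powr (1 - t)"
        by (intro mult_left_mono) auto
      moreover have "\<bar>\<sigma>\<bar> powr t * \<bar>\<sigma>\<bar> powr (1 - t) = \<bar>\<sigma>\<bar>" by (simp add: powr_add[symmetric])
      ultimately show ?thesis by simp
    qed
    have "cmod (B (y + \<sigma> *\<^sub>R v) - B y) \<le> \<bar>\<sigma>\<bar> * (C * (c * japanese y powr (\<mu> - \<rho>)))"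
      by (rule order_trans[OF s(2)], intro mult_left_mono order_trans[OF bd(2)] cmp C) auto
    also have "\<dots> \<le> (\<bar>\<sigma>\<bar> powr t * (japanese y powr \<rho>) powr (1 - t))
        * (C * (c * japanese y powr (\<mu> - \<rho>)))"
      using C c by (intro mult_right_mono tau) auto
    also have "\<dots> = C * c * \<bar>\<sigma>\<bar> powr t * ((japanese y powr \<rho>) powr (1 - t) * japanese y powr (\<mu>
        - \<rho>))"
      by (simp only: ac_simps)
    also have "(japanese y powr \<rho>) powr (1 - t) * japanese y powr (\<mu> - \<rho>) = japanese y powr q"
      unfolding powr_powr powr_add[symmetric] q_def by (simp add: algebra_simps)
    finally show ?thesis .
  qed
  have large: "cmod (B y) \<le> C * (2 * \<bar>\<tau>\<bar> powr t) * japanese y powr q"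
      if large: "japanese y powr \<rho> < 2 * \<bar>\<tau>\<bar>" for y
  proof -
    have "(japanese y powr \<rho>) powr t \<le> (2 * \<bar>\<tau>\<bar>) powr t" using large t by (intro powr_mono2) auto
    also have "\<dots> \<le> 2 * \<bar>\<tau>\<bar> powr t"
      using powr_mono[of t 1 2] t by (simp add: powr_mult mult_right_mono)
    finally have le: "japanese y powr (\<rho> * t) \<le> 2 * \<bar>\<tau>\<bar> powr t" by (simp add: powr_powr)
    have "cmod (B y) \<le> C * (japanese y powr (\<rho> * t) * japanese y powr q)"
      using bd(1)[of y] by (simp add: powr_add[symmetric] q_def)
    also have "\<dots> \<le> C * (2 * \<bar>\<tau>\<bar> powr t * japanese y powr q)"
      using C by (intro mult_left_mono mult_right_mono le) auto
    finally show ?thesis by (simp add: mult.assoc)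
  qed
  let ?y = "x + \<tau> *\<^sub>R v"
  define X where "X = C * \<bar>\<tau>\<bar> powr t * japanese x powr q"
  define Y where "Y = C * \<bar>\<tau>\<bar> powr t * japanese ?y powr q"
  have XY: "0 \<le> X" "0 \<le> Y" using C by (auto simp: X_def Y_def)
  have "cmod (B ?y - B x) \<le> 2 * c * (X + Y)"
  proof -
    \<comment> \<open>The small-step bound may be based at either end point, hence a result
      symmetric in both. If it is available at neither, the two values are estimated
      separately.\<close>
    consider "2 * \<bar>\<tau>\<bar> \<le> japanese x powr \<rho>" | "2 * \<bar>\<tau>\<bar> \<le> japanese ?y powr \<rho>"
      | "japanese x powr \<rho> < 2 * \<bar>\<tau>\<bar>" "japanese ?y powr \<rho> < 2 * \<bar>\<tau>\<bar>" by linarith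
    then show ?thesis
    proof cases
      case 1
      have "cmod (B ?y - B x) \<le> c * X" using small[OF 1] by (simp add: X_def ac_simps)
      also have "\<dots> \<le> 2 * c * (X + Y)" using XY c by (simp add: mult_mono algebra_simps)
      finally show ?thesis .
    next
      case 2
      have "2 * \<bar>- \<tau>\<bar> \<le> japanese ?y powr \<rho>" using 2 by simp
      from small[OF this] have "cmod (B ?y - B x) \<le> c * Y"
          by (simp add: Y_def norm_minus_commute ac_simps)
      also have "\<dots> \<le> 2 * c * (X + Y)" using XY c by (simp add: mult_mono algebra_simps)
      finally show ?thesis .
    next
      case 3
      have "cmod (B ?y - B x) \<le> cmod (B ?y) + cmod (B x)" by (rule norm_triangle_ineq4)
      also have "\<dots> \<le> 2 * Y + 2 * X"
        using large[OF 3(1)] large[OF 3(2)] by (simp add: X_def Y_def ac_simps)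
      also have "\<dots> \<le> 2 * c * (X + Y)" using mult_right_mono[OF c, of "2 * (X + Y)"] XY
          by (simp add: algebra_simps)
      finally show ?thesis .
    qed
  qed
  also have "2 * c * (X + Y) = C * 2 powr (1 + \<bar>\<mu> - \<rho>\<bar>) * \<bar>\<tau>\<bar> powr t * (japanese x powr q
      + japanese ?y powr q)"
    by (simp add: X_def Y_def c_def powr_add algebra_simps)
  finally show ?thesis by (simp add: q_def)
qed

text \<open>A shift of \<open>\<xi>\<close> by half a period, \<open>h = (\<pi> / (z \<bullet> v)) v\<close>, changes the sign of the phase, so \<open>B\<close> may be
  replaced by half of a difference of \<open>B\<close>.\<close>

lemma oscillatory_fractional_bound:
  fixes B B' :: "real^'n \<Rightarrow> complex"
  assumes cont: "continuous_on UNIV B" and supp: "\<And>x. R < norm x \<Longrightarrow> B x = 0"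
    and der: "\<And>x. ((\<lambda>t. B (x + t *\<^sub>R v)) has_vector_derivative B' x) (at 0)" and v: "norm v = 1"
    and bd: "\<And>x. cmod (B x) \<le> C * japanese x powr \<mu>" "\<And>x. cmod (B' x) \<le> C * japanese x powr (\<mu> - \<rho>)"
    and C: "0 \<le> C" and rho: "0 \<le> \<rho>" "\<rho> \<le> 1" and t: "0 \<le> t" "t \<le> 1"
    and q: "\<mu> - \<rho> * t < - real CARD('n)" and zv: "z \<bullet> v \<noteq> 0"
  shows "\<bar>z \<bullet> v\<bar> powr t * cmod (LINT \<xi>|lborel. B \<xi> * phase z \<xi>)
    \<le> C * (2 powr (1 + \<bar>\<mu> - \<rho>\<bar>) * pi powr t * (LINT \<xi>|lborel. japanese (\<xi> :: real^'n) powr (\<mu> - \<rho>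
        * t)))"
proof -
  define \<tau> where "\<tau> = pi / (z \<bullet> v)"
  define h where "h = \<tau> *\<^sub>R v"
  define I where "I = (LINT \<xi>|lborel. B \<xi> * phase z \<xi>)"
  define G where "G x = japanese (x :: real^'n) powr (\<mu> - \<rho> * t)" for x
  have G: "integrable lborel G" unfolding G_def by (rule integrable_japanese_powr[OF q])
  have [measurable]: "B \<in> borel_measurable borel" using cont
      by (auto intro: borel_measurable_continuous_onI)
  have "z \<bullet> h = pi" using zv by (simp add: h_def \<tau>_def)
  then have ph: "phase z (\<xi> + h) = - phase z \<xi>" for \<xi>
    unfolding phase_add by (simp add: phase_def exp_pi_i' mult.commute)
  have int: "integrable lborel (\<lambda>\<xi>. B \<xi> * phase z \<xi>)"
    using cont supp by (intro continuous_compact_support_integrable[of _ R] continuous_intros) auto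
  have shift: "I = (LINT \<xi>|lborel. B (\<xi> + h) * phase z (\<xi> + h))"
    unfolding I_def by (rule lborel_integral_shift[symmetric]) measurable
  have int': "integrable lborel (\<lambda>\<xi>. B (\<xi> + h) * phase z (\<xi> + h))"
    using lborel_integrable_shift[OF int, of h] .
  have "2 * I = (LINT \<xi>|lborel. B \<xi> * phase z \<xi> + B (\<xi> + h) * phase z (\<xi> + h))"
    using int int' shift by (simp add: I_def[symmetric])
  also have "\<dots> = (LINT \<xi>|lborel. - ((B (\<xi> + h) - B \<xi>) * phase z \<xi>))"
    by (rule Bochner_Integration.integral_cong) (simp_all add: ph algebra_simps)
  finally have "cmod (2 * I) = cmod (LINT \<xi>|lborel. - ((B (\<xi> + h) - B \<xi>) * phase z \<xi>))" by simp
  also have "\<dots> \<le> (LINT \<xi>|lborel. C * 2 powr (1 + \<bar>\<mu> - \<rho>\<bar>) * \<bar>\<tau>\<bar> powr t * (G \<xi> + G (\<xi> + h)))"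
  proof (rule Bochner_Integration.integral_norm_bound_integral)
    show "integrable lborel (\<lambda>\<xi>. - ((B (\<xi> + h) - B \<xi>) * phase z \<xi>))"
    proof -
      have "(\<lambda>\<xi>. - ((B (\<xi> + h) - B \<xi>) * phase z \<xi>))
          = (\<lambda>\<xi>. B \<xi> * phase z \<xi> + B (\<xi> + h) * phase z (\<xi> + h))"
        by (simp add: ph fun_eq_iff algebra_simps)
      then show ?thesis using int int' by simp
    qed
    show "integrable lborel (\<lambda>\<xi>. C * 2 powr (1 + \<bar>\<mu> - \<rho>\<bar>) * \<bar>\<tau>\<bar> powr t * (G \<xi> + G (\<xi> + h)))"
      using G lborel_integrable_shift[OF G, of h]
          by (intro integrable_mult_right Bochner_Integration.integrable_add)
    show "cmod (- ((B (x + h) - B x) * phase z x)) \<le> C * 2 powr (1 + \<bar>\<mu> - \<rho>\<bar>) * \<bar>\<tau>\<bar> powr t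
        * (G x + G (x + h))" for x
      using symbol_difference_bound[OF der v bd C rho t, of x \<tau>] unfolding G_def h_def
          by (simp add: norm_mult)
  qed
  also have "\<dots> = C * 2 powr (1 + \<bar>\<mu> - \<rho>\<bar>) * \<bar>\<tau>\<bar> powr t * ((LINT \<xi>|lborel. G \<xi>)
      + (LINT \<xi>|lborel. G (\<xi> + h)))"
    using G lborel_integrable_shift[OF G, of h] by simp
  also have "(LINT \<xi>|lborel. G (\<xi> + h)) = (LINT \<xi>|lborel. G \<xi>)"
  proof -
    have [measurable]: "G \<in> borel_measurable borel" unfolding G_def by measurable
    have "(LINT x|lborel. G x) = (LINT x|distr lborel borel ((+) h). G x)"
        by (simp add: lborel_distr_plus)
    also have "\<dots> = (LINT x|lborel. G (h + x))" by (intro integral_distr) auto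
    finally show ?thesis by (simp add: add.commute)
  qed
  finally have "cmod I \<le> C * 2 powr (1 + \<bar>\<mu> - \<rho>\<bar>) * \<bar>\<tau>\<bar> powr t * (LINT \<xi>|lborel. G \<xi>)"
    by (simp add: norm_mult)
  then have "\<bar>z \<bullet> v\<bar> powr t * cmod I \<le> \<bar>z \<bullet> v\<bar> powr t * (C * 2 powr (1 + \<bar>\<mu> - \<rho>\<bar>) * \<bar>\<tau>\<bar> powr t
      * (LINT \<xi>|lborel. G \<xi>))"
    by (intro mult_left_mono) auto
  also have "\<dots> = C * 2 powr (1 + \<bar>\<mu> - \<rho>\<bar>) * (\<bar>z \<bullet> v\<bar> powr t * \<bar>\<tau>\<bar> powr t) * (LINT \<xi>|lborel. G \<xi>)"
    by (simp only: ac_simps)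
  also have "\<bar>z \<bullet> v\<bar> powr t * \<bar>\<tau>\<bar> powr t = pi powr t"
    using zv by (simp add: powr_mult[symmetric] \<tau>_def abs_mult[symmetric])
  finally show ?thesis unfolding I_def G_def by (simp only: ac_simps)
qed

section \<open>Leibniz' rule and rescaled cutoffs\<close>

lemma leibniz_sum:
  fixes a b :: "nat \<Rightarrow> complex"
  shows "(\<Sum>j\<le>k. of_nat (k choose j) * (a (Suc j) * b (k - j) + a j * b (Suc (k - j)))) =
    (\<Sum>j\<le>Suc k. of_nat (Suc k choose j) * (a j * b (Suc k - j)))"
proof -
  have "(\<Sum>j\<le>Suc k. of_nat (Suc k choose j) * (a j * b (Suc k - j))) =
      a 0 * b (Suc k) + (\<Sum>j\<le>k. of_nat (k choose j) * (a (Suc j) * b (k - j)))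
          + (\<Sum>j\<le>k. of_nat (k choose Suc j) * (a (Suc j) * b (k - j)))"
    by (subst sum.atMost_Suc_shift) (simp add: distrib_right sum.distrib add.assoc)
  also have "a 0 * b (Suc k) + (\<Sum>j\<le>k. of_nat (k choose j) * (a (Suc j) * b (k - j)))
      + (\<Sum>j\<le>k. of_nat (k choose Suc j) * (a (Suc j) * b (k - j))) =
      (\<Sum>j\<le>k. of_nat (k choose j) * (a (Suc j) * b (k - j))) + (\<Sum>j\<le>Suc k. of_nat (k choose j)
          * (a j * b (Suc k - j)))"
  proof -
    have "(\<Sum>j\<le>Suc k. of_nat (k choose j) * (a j * b (Suc k - j))) =
        a 0 * b (Suc k) + (\<Sum>j\<le>k. of_nat (k choose Suc j) * (a (Suc j) * b (k - j)))"
      by (subst sum.atMost_Suc_shift) simp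
    then show ?thesis by (simp only: add.commute add.left_commute)
  qed
  also have "(\<Sum>j\<le>Suc k. of_nat (k choose j) * (a j * b (Suc k - j)))
      = (\<Sum>j\<le>k. of_nat (k choose j) * (a j * b (Suc (k - j))))"
    by (simp add: Suc_diff_le)
  finally show ?thesis by (simp add: distrib_left sum.distrib)
qed

definition leibniz :: "(nat \<Rightarrow> 'a \<Rightarrow> complex) \<Rightarrow> (nat \<Rightarrow> 'a \<Rightarrow> complex) \<Rightarrow> nat \<Rightarrow> 'a \<Rightarrow> complex" where
  "leibniz A B k x = (\<Sum>j\<le>k. of_nat (k choose j) * (A j x * B (k - j) x))"

lemma line_seq_leibniz:
  assumes A: "line_seq v A" and B: "line_seq v B"
  shows "line_seq v (leibniz A B)"
  unfolding line_seq_def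
proof (intro allI)
  fix k x
  have "((\<lambda>t. \<Sum>j\<le>k. of_nat (k choose j) * (A j (x + t *\<^sub>R v) * B (k - j) (x + t *\<^sub>R v)))
      has_vector_derivative
      (\<Sum>j\<le>k. of_nat (k choose j) * (A (Suc j) x * B (k - j) x + A j x * B (Suc (k - j)) x))) (at 0)"
  proof (intro has_vector_derivative_sum has_vector_derivative_mult_right)
    fix j
    have "((\<lambda>t. A j (x + t *\<^sub>R v)) has_vector_derivative A (Suc j) x) (at 0)"
      "((\<lambda>t. B (k - j) (x + t *\<^sub>R v)) has_vector_derivative B (Suc (k - j)) x) (at 0)"
      using A B by (auto simp: line_seq_def)
    from has_vector_derivative_mult[OF this]
    show "((\<lambda>t. A j (x + t *\<^sub>R v) * B (k - j) (x + t *\<^sub>R v)) has_vector_derivative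
        (A (Suc j) x * B (k - j) x + A j x * B (Suc (k - j)) x)) (at 0)"
      by (simp add: add.commute)
  qed
  then show "((\<lambda>t. leibniz A B k (x + t *\<^sub>R v)) has_vector_derivative leibniz A B (Suc k) x) (at 0)"
    unfolding leibniz_def leibniz_sum[of k "\<lambda>j. A j x" "\<lambda>j. B j x"] .
qed

lemma line_seq_scale:
  assumes "line_seq v F"
  shows "line_seq v (\<lambda>k x. of_real (\<epsilon> ^ k) * F k (\<epsilon> *\<^sub>R x))"
  unfolding line_seq_def
proof (intro allI)
  fix k x
  have "((\<lambda>t. F k (\<epsilon> *\<^sub>R x + t *\<^sub>R v)) has_vector_derivative F (Suc k) (\<epsilon> *\<^sub>R x)) (at (0 * \<epsilon>))"
    using assms by (simp add: line_seq_def)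
  moreover have "((\<lambda>t. t * \<epsilon>) has_vector_derivative \<epsilon>) (at 0)"
    by (auto intro!: derivative_eq_intros simp:
        has_real_derivative_iff_has_vector_derivative[symmetric])
  ultimately have "((\<lambda>t. F k (\<epsilon> *\<^sub>R x + t *\<^sub>R v)) \<circ> (\<lambda>t. t * \<epsilon>) has_vector_derivative \<epsilon> *\<^sub>R F
      (Suc k) (\<epsilon> *\<^sub>R x)) (at 0)"
    by (intro vector_diff_chain_at)
  then have "((\<lambda>t. F k (\<epsilon> *\<^sub>R (x + t *\<^sub>R v))) has_vector_derivative \<epsilon> *\<^sub>R F (Suc k) (\<epsilon> *\<^sub>R x))
      (at 0)"
    by (simp add: o_def scaleR_add_right mult.commute)
  then have "((\<lambda>t. of_real (\<epsilon> ^ k) * F k (\<epsilon> *\<^sub>R (x + t *\<^sub>R v))) has_vector_derivative of_real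
      (\<epsilon> ^ k) * (\<epsilon> *\<^sub>R F (Suc k) (\<epsilon> *\<^sub>R x))) (at 0)"
    by (rule has_vector_derivative_mult_right)
  then show "((\<lambda>t. of_real (\<epsilon> ^ k) * F k (\<epsilon> *\<^sub>R (x + t *\<^sub>R v))) has_vector_derivative of_real
      (\<epsilon> ^ Suc k) * F (Suc k) (\<epsilon> *\<^sub>R x)) (at 0)"
    by (simp add: scaleR_conv_of_real ac_simps)
qed

text \<open>\<open>F 0\<close> is a compactly supported cutoff and the \<open>F k\<close> are its
  derivatives along a unit vector. The direction is fixed because the kernel estimates integrate by
  parts along one axis at a time.\<close>

locale cutoff_seq =
  fixes v :: "real^'n" and F :: "nat \<Rightarrow> real^'n \<Rightarrow> complex" and R :: real
  assumes v: "norm v = 1" and F: "line_seq v F" and cont_F: "\<And>k. continuous_on UNIV (F k)"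
    and R: "0 \<le> R" and supp_F: "\<And>k x. R < norm x \<Longrightarrow> F k x = 0"
begin

text \<open>The derivatives along \<open>v\<close> of \<open>A 0\<close> times the cutoff rescaled
  by \<epsilon>. Each derivative falling on the cutoff brings a factor \<epsilon>.\<close>

definition cut :: "real \<Rightarrow> (nat \<Rightarrow> real^'n \<Rightarrow> complex) \<Rightarrow> nat \<Rightarrow> real^'n \<Rightarrow> complex" where
  "cut \<epsilon> A = leibniz A (\<lambda>k x. of_real (\<epsilon> ^ k) * F k (\<epsilon> *\<^sub>R x))"

lemma cut_0: "cut \<epsilon> A 0 x = A 0 x * F 0 (\<epsilon> *\<^sub>R x)"
  by (simp add: cut_def leibniz_def)

lemma line_seq_cut: "line_seq v A \<Longrightarrow> line_seq v (cut \<epsilon> A)"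
  unfolding cut_def by (intro line_seq_leibniz line_seq_scale F)

lemma continuous_on_F: "continuous_on S f \<Longrightarrow> continuous_on S (\<lambda>x. F k (f x))"
  by (rule continuous_on_compose2[OF cont_F]) auto

lemma continuous_on_cut: "(\<And>k. continuous_on UNIV (A k)) \<Longrightarrow> continuous_on UNIV (cut \<epsilon> A k)"
  unfolding cut_def leibniz_def by (intro continuous_intros continuous_on_F) auto

lemma cut_support: "0 < \<epsilon> \<Longrightarrow> R / \<epsilon> < norm x \<Longrightarrow> cut \<epsilon> A k x = 0"
  unfolding cut_def leibniz_def
  by (intro sum.neutral ballI) (simp add: supp_F pos_divide_less_eq mult.commute)

text \<open>Rescaled cutoffs are symbols of order 0 uniformly in \<epsilon> \<le> 1: on the support
  \<epsilon> times \<open>japanese x\<close> is at most 1 + R, so \<epsilon>^k is at most a constant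
  times \<open>japanese x\<close> to the power -k, and \<rho> \<le> 1. The constant \<open>L\<close>
  is chosen before \<open>A\<close>, \<open>C\<close> and \<epsilon>; this yields uniformity in the
  base point later.\<close>

lemma cut_bound:
  assumes rho: "0 \<le> \<rho>" "\<rho> \<le> 1"
  obtains L where "0 \<le> L" "\<And>(A :: nat \<Rightarrow> real^'n \<Rightarrow> complex) (C :: real) (\<epsilon> :: real) k x. 0 \<le> C \<Longrightarrow>
      k \<le> N \<Longrightarrow> 0 < \<epsilon> \<Longrightarrow> \<epsilon> \<le> 1 \<Longrightarrow>
    (\<And>j x. j \<le> N \<Longrightarrow> cmod (A j x) \<le> C * japanese x powr (m - \<rho> * real j)) \<Longrightarrow>
    cmod (cut \<epsilon> A k x) \<le> C * L * japanese x powr (m - \<rho> * real k)"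
proof -
  have "\<exists>B\<ge>0. \<forall>x. cmod (F k x) \<le> B" for k
    using continuous_compact_support_bounded[OF cont_F supp_F] by metis
  then obtain B where B: "\<And>k. 0 \<le> B k" "\<And>k x. cmod (F k x) \<le> B k" by metis
  define M where "M = (\<Sum>k\<le>N. B k)"
  have M: "cmod (F k x) \<le> M" if "k \<le> N" for k x
  proof -
    have "B k \<le> M" using B(1) that unfolding M_def by (intro member_le_sum) auto
    then show ?thesis using B(2)[of k x] by linarith
  qed
  have M0: "0 \<le> M" unfolding M_def using B by (intro sum_nonneg) auto
  define r where "r = 1 + R"
  have r: "1 \<le> r" using R by (simp add: r_def)
  define L where "L = 2 ^ N * (M * r ^ N)"
  have scaled: "cmod (of_real (\<epsilon> ^ k) * F k (\<epsilon> *\<^sub>R x))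
      \<le> M * r ^ N * japanese x powr (- (\<rho> * real k))"
    if e: "0 < \<epsilon>" "\<epsilon> \<le> 1" and k: "k \<le> N" for \<epsilon> k x
  proof (cases "R < norm (\<epsilon> *\<^sub>R x)")
    case True
    then show ?thesis using supp_F[OF True] M0 r by simp
  next
    case False
    then have "\<epsilon> * norm x \<le> R" using e by simp
    have J: "1 \<le> japanese x" by (rule japanese_ge_1)
    have "\<epsilon> * japanese x \<le> \<epsilon> * (1 + norm x)" using e japanese_le[of x]
        by (intro mult_left_mono) auto
    also have "\<dots> \<le> r" using e \<open>\<epsilon> * norm x \<le> R\<close> by (simp add: r_def distrib_left)
    finally have "\<epsilon> \<le> r / japanese x" using J by (simp add: pos_le_divide_eq)
    then have "\<epsilon> ^ k \<le> (r / japanese x) ^ k" using e by (intro power_mono) auto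
    also have "\<dots> = r ^ k * japanese x powr (- real k)"
      using J by (simp add: power_divide powr_minus_divide powr_realpow)
    also have "\<dots> \<le> r ^ N * japanese x powr (- (\<rho> * real k))"
    proof (rule mult_mono)
      show "r ^ k \<le> r ^ N" using r k by (intro power_increasing) auto
      have "\<rho> * real k \<le> 1 * real k" using rho by (intro mult_right_mono) auto
      then show "japanese x powr (- real k) \<le> japanese x powr (- (\<rho> * real k))" using J
          by (intro powr_mono) auto
    qed (use r in auto)
    finally have "\<epsilon> ^ k * cmod (F k (\<epsilon> *\<^sub>R x)) \<le> (r ^ N * japanese x powr (- (\<rho> * real k))) * M"
      using M[OF k] e r by (intro mult_mono) auto
    then show ?thesis using e by (simp add: norm_mult norm_power ac_simps)
  qed
  show ?thesis
  proof (rule that)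
    show "0 \<le> L" using M0 r by (simp add: L_def)
    fix A :: "nat \<Rightarrow> real^'n \<Rightarrow> complex" and C \<epsilon> :: real and k x
    assume C: "0 \<le> C" and k: "k \<le> N" and e: "0 < \<epsilon>" "\<epsilon> \<le> 1"
      and A: "\<And>j x. j \<le> N \<Longrightarrow> cmod (A j x) \<le> C * japanese x powr (m - \<rho> * real j)"
    have "cmod (cut \<epsilon> A k x)
        \<le> (\<Sum>j\<le>k. real (k choose j) * (C * (M * r ^ N) * japanese x powr (m - \<rho> * real k)))"
      unfolding cut_def leibniz_def
    proof (rule sum_norm_le)
      fix j assume "j \<in> {..k}"
      then have j: "j \<le> k" "j \<le> N" "k - j \<le> N" using k by auto
      have "cmod (A j x * (of_real (\<epsilon> ^ (k - j)) * F (k - j) (\<epsilon> *\<^sub>R x))) \<le>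
          (C * japanese x powr (m - \<rho> * real j))
              * (M * r ^ N * japanese x powr (- (\<rho> * real (k - j))))"
        unfolding norm_mult[of "A j x"] using C by (intro mult_mono A scaled j e) auto
      also have "\<dots> = C * (M * r ^ N) * (japanese x powr (m - \<rho> * real j)
          * japanese x powr (- (\<rho> * real (k - j))))"
        by (simp only: ac_simps)
      also have "japanese x powr (m - \<rho> * real j) * japanese x powr (- (\<rho> * real (k - j)))
          = japanese x powr (m - \<rho> * real k)"
        unfolding powr_add[symmetric] using j by (simp add: of_nat_diff algebra_simps)
      finally show "cmod (of_nat (k choose j)
          * (A j x * (of_real (\<epsilon> ^ (k - j)) * F (k - j) (\<epsilon> *\<^sub>R x)))) \<le>
          real (k choose j) * (C * (M * r ^ N) * japanese x powr (m - \<rho> * real k))"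
        unfolding norm_mult[of "of_nat (k choose j)"] norm_of_nat by (rule mult_left_mono) simp
    qed
    also have "\<dots> = 2 ^ k * (C * (M * r ^ N) * japanese x powr (m - \<rho> * real k))"
      unfolding sum_distrib_right[symmetric] of_nat_sum[symmetric] choose_row_sum by simp
    also have "\<dots> \<le> 2 ^ N * (C * (M * r ^ N) * japanese x powr (m - \<rho> * real k))"
      using k C M0 r by (intro mult_right_mono power_increasing) auto
    finally show "cmod (cut \<epsilon> A k x) \<le> C * L * japanese x powr (m - \<rho> * real k)"
      by (simp add: L_def ac_simps)
  qed
qed

text \<open>N integrations by parts gain |z \<bullet> v|^N, and a half-period difference of the N-th
  derivative gains the fractional power t. The difference needs one more derivative, hence
  \<open>Suc N\<close> in the hypothesis on \<open>A\<close>. Condition \<open>q\<close> is the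
  integrability of the resulting power of the bracket.\<close>

theorem oscillatory_kernel_bound:
  assumes rho: "0 \<le> \<rho>" "\<rho> \<le> 1" and t: "0 \<le> t" "t \<le> 1"
      and q: "m - \<rho> * (real N + t) < - real CARD('n)"
  obtains K where "0 \<le> K" "\<And>(A :: nat \<Rightarrow> real^'n \<Rightarrow> complex) (C :: real) (\<epsilon> :: real) z. line_seq v A \<Longrightarrow>
      (\<And>k. continuous_on UNIV (A k)) \<Longrightarrow> 0 \<le> C \<Longrightarrow>
    (\<And>j x. j \<le> Suc N \<Longrightarrow> cmod (A j x) \<le> C * japanese x powr (m - \<rho> * real j)) \<Longrightarrow>
    0 < \<epsilon> \<Longrightarrow> \<epsilon> \<le> 1 \<Longrightarrow> z \<bullet> v \<noteq> 0 \<Longrightarrow>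
    \<bar>z \<bullet> v\<bar> powr (real N + t) * cmod (LINT \<xi>|lborel. A 0 \<xi> * F 0 (\<epsilon> *\<^sub>R \<xi>) * phase z \<xi>) \<le> C * K"
proof -
  obtain L where L: "0 \<le> L" "\<And>(A :: nat \<Rightarrow> real^'n \<Rightarrow> complex) (C :: real) (\<epsilon> :: real) k x. 0 \<le> C \<Longrightarrow>
      k \<le> Suc N \<Longrightarrow> 0 < \<epsilon> \<Longrightarrow> \<epsilon> \<le> 1 \<Longrightarrow>
    (\<And>j x. j \<le> Suc N \<Longrightarrow> cmod (A j x) \<le> C * japanese x powr (m - \<rho> * real j)) \<Longrightarrow>
    cmod (cut \<epsilon> A k x) \<le> C * L * japanese x powr (m - \<rho> * real k)"
    using cut_bound[OF rho, of "Suc N" m] by blast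
  define \<mu> where "\<mu> = m - \<rho> * real N"
  define G where "G = 2 powr (1 + \<bar>\<mu> - \<rho>\<bar>) * pi powr t * (LINT \<xi>|lborel. japanese (\<xi> :: real^'n)
      powr (\<mu> - \<rho> * t))"
  have G: "0 \<le> G" unfolding G_def by simp
  show ?thesis
  proof (rule that)
    show "0 \<le> L * G" using L G by simp
    fix A :: "nat \<Rightarrow> real^'n \<Rightarrow> complex" and C \<epsilon> :: real and z
    assume A: "line_seq v A" "\<And>k. continuous_on UNIV (A k)" and C: "0 \<le> C"
      and bd: "\<And>j x. j \<le> Suc N \<Longrightarrow> cmod (A j x) \<le> C * japanese x powr (m - \<rho> * real j)"
      and e: "0 < \<epsilon>" "\<epsilon> \<le> 1" and zv: "z \<bullet> v \<noteq> 0"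
    let ?D = "cut \<epsilon> A"
    have D: "line_seq v ?D" by (rule line_seq_cut[OF A(1)])
    have cont: "continuous_on UNIV (?D k)" for k by (rule continuous_on_cut[OF A(2)])
    have "(LINT \<xi>|lborel. ?D N \<xi> * phase z \<xi>) = (- (\<i> * of_real (z \<bullet> v))) ^ N
        * (LINT \<xi>|lborel. ?D 0 \<xi> * phase z \<xi>)"
      by (rule integral_by_parts_phase[OF D cont cut_support[OF e(1)]])
    then have ibp: "cmod (LINT \<xi>|lborel. ?D N \<xi> * phase z \<xi>)
        = \<bar>z \<bullet> v\<bar> ^ N * cmod (LINT \<xi>|lborel. ?D 0 \<xi> * phase z \<xi>)"
      by (simp add: norm_mult norm_power)
    have "\<bar>z \<bullet> v\<bar> powr t * cmod (LINT \<xi>|lborel. ?D N \<xi> * phase z \<xi>) \<le> C * L * G"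
      unfolding G_def
    proof (rule oscillatory_fractional_bound[OF cont cut_support[OF e(1)] _ v _ _ _ rho t _ zv])
      show "((\<lambda>t. ?D N (x + t *\<^sub>R v)) has_vector_derivative ?D (Suc N) x) (at 0)" for x
        using D by (simp add: line_seq_def)
      show "cmod (?D N x) \<le> C * L * japanese x powr \<mu>" for x
        unfolding \<mu>_def using bd by (intro L(2) C e) auto
      have "\<mu> - \<rho> = m - \<rho> * real (Suc N)" by (simp add: \<mu>_def algebra_simps)
      then show "cmod (?D (Suc N) x) \<le> C * L * japanese x powr (\<mu> - \<rho>)" for x
        using bd L(2)[OF C _ e, of "Suc N" A x] by simp
      show "\<mu> - \<rho> * t < - real CARD('n)" using q by (simp add: \<mu>_def algebra_simps)
    qed (use C L in auto)
    then have "\<bar>z \<bullet> v\<bar> powr t * (\<bar>z \<bullet> v\<bar> ^ N * cmod (LINT \<xi>|lborel. ?D 0 \<xi> * phase z \<xi>))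
        \<le> C * (L * G)"
      unfolding ibp by (simp only: mult.assoc)
    moreover have "\<bar>z \<bullet> v\<bar> powr (real N + t) = \<bar>z \<bullet> v\<bar> powr t * \<bar>z \<bullet> v\<bar> ^ N"
      using zv by (simp add: powr_add powr_realpow)
    ultimately show "\<bar>z \<bullet> v\<bar> powr (real N + t) * cmod (LINT \<xi>|lborel. A 0 \<xi> * F 0 (\<epsilon> *\<^sub>R \<xi>)
        * phase z \<xi>) \<le> C * (L * G)"
      unfolding cut_0 by (simp only: mult.assoc)
  qed
qed

text \<open>After N integrations by parts the integrand is dominated, uniformly in \<epsilon>, by an
  integrable power of the bracket. The limit does not mention \<open>F\<close>, so every cutoff with
  value 1 at the origin leads to the same kernel.\<close>

theorem oscillatory_kernel_limit:
  assumes rho: "0 \<le> \<rho>" "\<rho> \<le> 1" and q: "m - \<rho> * real N < - real CARD('n)" and F0: "F 0 0 = 1"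
    and A: "line_seq v A" "\<And>k. continuous_on UNIV (A k)" and C: "0 \<le> C"
    and bd: "\<And>j x. j \<le> N \<Longrightarrow> cmod (A j x) \<le> C * japanese x powr (m - \<rho> * real j)"
    and zv: "z \<bullet> v \<noteq> 0"
  shows "((\<lambda>\<epsilon>. LINT \<xi>|lborel. A 0 \<xi> * F 0 (\<epsilon> *\<^sub>R \<xi>) * phase z \<xi>) \<longlongrightarrow>
    (LINT \<xi>|lborel. A N \<xi> * phase z \<xi>) / (- (\<i> * of_real (z \<bullet> v))) ^ N) (at_right 0)"
proof -
  obtain L where L: "0 \<le> L" "\<And>(A :: nat \<Rightarrow> real^'n \<Rightarrow> complex) (C :: real) (\<epsilon> :: real) k x. 0 \<le> C \<Longrightarrow>
      k \<le> N \<Longrightarrow> 0 < \<epsilon> \<Longrightarrow> \<epsilon> \<le> 1 \<Longrightarrow>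
    (\<And>j x. j \<le> N \<Longrightarrow> cmod (A j x) \<le> C * japanese x powr (m - \<rho> * real j)) \<Longrightarrow>
    cmod (cut \<epsilon> A k x) \<le> C * L * japanese x powr (m - \<rho> * real k)"
    using cut_bound[OF rho, of N m] by blast
  \<comment> \<open>The uniform bound holds for \<epsilon> \<le> 1; the filter
    \<open>at_right 0\<close> does not see the restriction.\<close>
  have at: "at_right 0 = at 0 within {0<..1::real}"
    by (rule at_within_nhd[of 0 "{..<1}"]) auto
  have lim: "((\<lambda>\<epsilon>. LINT \<xi>|lborel. cut \<epsilon> A N \<xi> * phase z \<xi>) \<longlongrightarrow> (LINT \<xi>|lborel. A N \<xi> * phase z \<xi>))
      (at_right 0)"
    unfolding at tendsto_at_iff_sequentially
  proof (intro allI impI)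
    fix X :: "nat \<Rightarrow> real" assume X: "\<forall>i. X i \<in> {0<..1} - {0}" "X \<longlonglongrightarrow> 0"
    have meas: "(\<lambda>\<xi>. h \<xi> * phase z \<xi>) \<in> borel_measurable lborel" if "continuous_on UNIV h"
        for h :: "real^'n \<Rightarrow> complex"
      using that by (auto intro!: borel_measurable_continuous_onI continuous_intros)
    show "((\<lambda>\<epsilon>. LINT \<xi>|lborel. cut \<epsilon> A N \<xi> * phase z \<xi>) \<circ> X) \<longlonglongrightarrow> (LINT \<xi>|lborel. A N \<xi> * phase z \<xi>)"
      unfolding o_def
    proof (rule integral_dominated_convergence)
      show "integrable lborel (\<lambda>x :: real^'n. C * L * japanese x powr (m - \<rho> * real N))"
        using integrable_japanese_powr[OF q] by simp
      show "AE x in lborel. (\<lambda>i. cut (X i) A N x * phase z x) \<longlonglongrightarrow> A N x * phase z x"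
      proof (intro AE_I2 tendsto_mult tendsto_const)
        fix x
        have F: "(\<lambda>i. F k (X i *\<^sub>R x)) \<longlonglongrightarrow> F k 0" for k
        proof -
          have "isCont (F k) 0" using cont_F[of k] by (simp add: continuous_on_eq_continuous_at)
          moreover have "(\<lambda>i. X i *\<^sub>R x) \<longlonglongrightarrow> 0" using tendsto_scaleR[OF X(2) tendsto_const, of x]
              by simp
          ultimately show ?thesis by (rule isCont_tendsto_compose)
        qed
        have "(\<lambda>i. cut (X i) A N x)
            \<longlonglongrightarrow> (\<Sum>j\<le>N. of_nat (N choose j) * (A j x * (of_real (0 ^ (N - j)) * F (N - j) 0)))"
          unfolding cut_def leibniz_def by (intro tendsto_intros X(2) F)
        \<comment> \<open>Terms with a derivative on the cutoff carry a positive power of \<epsilon>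
          and vanish in the limit. Only j = N survives, where \<open>0 ^ 0 = 1\<close>.\<close>
        also have "(\<Sum>j\<le>N. of_nat (N choose j) * (A j x * (of_real (0 ^ (N - j)) * F (N - j) 0))) =
            (\<Sum>j\<le>N. if j = N then A N x else 0)"
          by (intro sum.cong refl) (auto simp: F0)
        also have "\<dots> = A N x" by simp
        finally show "(\<lambda>i. cut (X i) A N x) \<longlonglongrightarrow> A N x" .
      qed
      show "AE x in lborel. cmod (cut (X i) A N x * phase z x)
          \<le> C * L * japanese x powr (m - \<rho> * real N)" for i
        using X(1) by (intro AE_I2) (auto simp: norm_mult intro!: L(2) C bd)
    qed (intro meas continuous_on_cut A)+
  qed
  have "((\<lambda>\<epsilon>. (LINT \<xi>|lborel. cut \<epsilon> A N \<xi> * phase z \<xi>) / (- (\<i> * of_real (z \<bullet> v))) ^ N) \<longlongrightarrow>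
      (LINT \<xi>|lborel. A N \<xi> * phase z \<xi>) / (- (\<i> * of_real (z \<bullet> v))) ^ N) (at_right 0)"
    using zv by (intro tendsto_divide lim tendsto_const) simp
  then show ?thesis
  proof (rule Lim_transform_eventually)
    show "\<forall>\<^sub>F \<epsilon> in at_right 0. (LINT \<xi>|lborel. cut \<epsilon> A N \<xi> * phase z \<xi>) / (- (\<i> * of_real (z \<bullet> v)))
        ^ N =
        (LINT \<xi>|lborel. A 0 \<xi> * F 0 (\<epsilon> *\<^sub>R \<xi>) * phase z \<xi>)"
      unfolding eventually_at_right_field
    proof (intro exI[of _ 1] conjI allI impI)
      fix \<epsilon> :: real assume e: "0 < \<epsilon>" "\<epsilon> < 1"
      have "(LINT \<xi>|lborel. cut \<epsilon> A N \<xi> * phase z \<xi>) = (- (\<i> * of_real (z \<bullet> v))) ^ N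
          * (LINT \<xi>|lborel. cut \<epsilon> A 0 \<xi> * phase z \<xi>)"
        by (rule integral_by_parts_phase[OF line_seq_cut[OF A(1)] continuous_on_cut[OF A(2)]
            cut_support[OF e(1)]])
      then show "(LINT \<xi>|lborel. cut \<epsilon> A N \<xi> * phase z \<xi>) / (- (\<i> * of_real (z \<bullet> v))) ^ N =
        (LINT \<xi>|lborel. A 0 \<xi> * F 0 (\<epsilon> *\<^sub>R \<xi>) * phase z \<xi>)"
        using zv by (simp add: cut_0)
    qed simp
  qed
qed

end

section \<open>Smooth cutoffs\<close>

lemma dir_deriv_has_derivative:
  assumes "(f has_derivative D) (at x)"
  shows "((\<lambda>t. f (x + t *\<^sub>R v)) has_vector_derivative D v) (at 0)" "dir_deriv v f x = D v"
proof -
  have D: "bounded_linear D" using assms by (rule has_derivative_bounded_linear)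
  have "((\<lambda>t. x + t *\<^sub>R v) has_derivative (\<lambda>t. t *\<^sub>R v)) (at 0)"
    by (auto intro!: derivative_eq_intros)
  moreover have "(f has_derivative D) (at (x + 0 *\<^sub>R v))" using assms by simp
  ultimately have "((\<lambda>t. f (x + t *\<^sub>R v)) has_derivative (\<lambda>t. D (t *\<^sub>R v))) (at 0)"
    by (rule has_derivative_compose)
  then show 1: "((\<lambda>t. f (x + t *\<^sub>R v)) has_vector_derivative D v) (at 0)"
    using linear_scale[OF bounded_linear.linear[OF D]] by (simp add: has_vector_derivative_def)
  show "dir_deriv v f x = D v"
    unfolding dir_deriv_def using 1 by (rule vector_derivative_at)
qed

lemma smooth_line_seq:
  assumes f: "smooth f" and v: "v \<in> Basis"
  shows "line_seq v (\<lambda>k. (dir_deriv v ^^ k) f)" "continuous_on UNIV ((dir_deriv v ^^ k) f)"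
proof -
  have d: "(dir_deriv v ^^ k) f differentiable (at x)" for k x
  proof -
    have "foldr dir_deriv (replicate k v) f differentiable (at x)"
      using f v unfolding smooth_def by (metis in_listsI in_set_replicate)
    then show ?thesis by (simp add: foldr_replicate)
  qed
  show "line_seq v (\<lambda>k. (dir_deriv v ^^ k) f)"
    unfolding line_seq_def
  proof (intro allI)
    fix k x
    obtain D where "((dir_deriv v ^^ k) f has_derivative D) (at x)" using d[of k x]
        by (auto simp: differentiable_def)
    from dir_deriv_has_derivative[OF this, of v]
    show "((\<lambda>t. (dir_deriv v ^^ k) f (x + t *\<^sub>R v)) has_vector_derivative (dir_deriv v ^^ Suc k) f
        x) (at 0)"
      by simp
  qed
  show "continuous_on UNIV ((dir_deriv v ^^ k) f)"
    by (intro continuous_at_imp_continuous_on ballI differentiable_imp_continuous_within d)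
qed

lemma line_seq_support:
  fixes D :: "nat \<Rightarrow> 'a::real_normed_vector \<Rightarrow> complex"
  assumes D: "line_seq v D" and 0: "\<And>x. R < norm x \<Longrightarrow> D 0 x = 0"
  shows "R < norm x \<Longrightarrow> D k x = 0"
proof (induction k arbitrary: x)
  case (Suc k)
  have "((\<lambda>t. D k (x + t *\<^sub>R v)) has_vector_derivative D (Suc k) x) (at 0)"
    using D by (simp add: line_seq_def)
  moreover have "((\<lambda>t. D k (x + t *\<^sub>R v)) has_vector_derivative 0) (at 0)"
  proof (rule has_vector_derivative_transform_within_open)
    show "((\<lambda>t :: real. 0 :: complex) has_vector_derivative 0) (at 0)"
        by (rule has_vector_derivative_const)
    show "open ((\<lambda>t. norm (x + t *\<^sub>R v)) -` {R<..})"
      by (intro open_vimage continuous_intros open_greaterThan)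
    show "0 \<in> (\<lambda>t. norm (x + t *\<^sub>R v)) -` {R<..}" using Suc.prems by simp
    show "0 = D k (x + t *\<^sub>R v)" if "t \<in> (\<lambda>t. norm (x + t *\<^sub>R v)) -` {R<..}" for t
      using that Suc.IH by simp
  qed
  ultimately show ?case by (rule vector_derivative_unique_at)
qed (use 0 in simp)

text \<open>The functions t^(-k) exp(-1/t) behind the standard bump, extended by 0. The power is a
  parameter because differentiation leads from \<open>k\<close> to \<open>k + 1\<close> and
  \<open>k + 2\<close>, which closes the family.\<close>

definition flat :: "nat \<Rightarrow> real \<Rightarrow> real" where
  "flat k t = (if 0 < t then (1 / t) ^ k * exp (- (1 / t)) else 0)"

lemma DERIV_flat: "(flat k has_real_derivative (flat (k + 2) t - real k * flat (k + 1) t)) (at t)"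
proof -
  consider "0 < t" | "t < 0" | "t = 0" by linarith
  then show ?thesis
  proof cases
    case 1
    have "((\<lambda>t. (1 / t) ^ k * exp (- (1 / t))) has_real_derivative (flat (k + 2) t - real k
        * flat (k + 1) t)) (at t)"
    proof (cases k)
      case 0
      then show ?thesis using 1
          by (auto intro!: derivative_eq_intros simp: flat_def power2_eq_square divide_simps)
    next
      case (Suc j)
      then show ?thesis using 1
        by (auto intro!: derivative_eq_intros simp: flat_def)
            (cases j; simp add: field_simps power2_eq_square)
    qed
    then show ?thesis
      by (rule has_field_derivative_transform_within_open[where S = "{0<..}"])
          (use 1 in \<open>auto simp: flat_def\<close>)
  next
    case 2
    have "((\<lambda>t. 0) has_real_derivative (flat (k + 2) t - real k * flat (k + 1) t)) (at t)"
      using 2 by (simp add: flat_def)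
    then show ?thesis
      by (rule has_field_derivative_transform_within_open[where S = "{..<0}"])
          (use 2 in \<open>auto simp: flat_def\<close>)
  next
    case 3
    have "((\<lambda>h. (flat k (0 + h) - flat k 0) / h) \<longlongrightarrow> 0) (at 0)"
    proof (rule filterlim_split_at)
      have "((\<lambda>h. (flat k (0 + h) - flat k 0) / h) \<longlongrightarrow> 0) (at_left 0) \<longleftrightarrow> ((\<lambda>h. 0 :: real)
          \<longlongrightarrow> 0) (at_left (0::real))"
        by (intro filterlim_cong refl)
            (auto simp: flat_def eventually_at_left_field intro!: exI[of _ "-1"])
      then show "((\<lambda>h. (flat k (0 + h) - flat k 0) / h) \<longlongrightarrow> 0) (at_left 0)" by simp
      \<comment> \<open>With x = 1/h this is the difference quotient at 0 from the right.\<close>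
      have "((\<lambda>x :: real. x ^ Suc k / exp x) \<longlongrightarrow> 0) at_top" by (rule tendsto_power_div_exp_0)
      then have "((\<lambda>h :: real. (inverse h) ^ Suc k / exp (inverse h)) \<longlongrightarrow> 0) (at_right 0)"
        by (rule filterlim_compose[OF _ filterlim_inverse_at_top_right])
      moreover have "((\<lambda>h. (flat k (0 + h) - flat k 0) / h) \<longlongrightarrow> 0) (at_right 0) \<longleftrightarrow>
          ((\<lambda>h :: real. (inverse h) ^ Suc k / exp (inverse h)) \<longlongrightarrow> 0) (at_right 0)"
        by (intro filterlim_cong refl)
          (auto simp: flat_def eventually_at_right_field exp_minus field_simps intro!: exI[of _ 1])
      ultimately show "((\<lambda>h. (flat k (0 + h) - flat k 0) / h) \<longlongrightarrow> 0) (at_right 0)" by simp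
    qed
    then show ?thesis using 3 by (simp add: DERIV_def flat_def)
  qed
qed

text \<open>A class that contains the bump and is closed under directional derivatives. Smoothness,
  which speaks of all iterated derivatives, then follows by one induction without a formula for
  them.\<close>

inductive_set bump_algebra :: "('a::euclidean_space \<Rightarrow> complex) set" where
  flat: "(\<lambda>x. of_real (flat k (1 - x \<bullet> x))) \<in> bump_algebra"
| add: "f \<in> bump_algebra \<Longrightarrow> g \<in> bump_algebra \<Longrightarrow> (\<lambda>x. f x + g x) \<in> bump_algebra"
| scale: "f \<in> bump_algebra \<Longrightarrow> (\<lambda>x. c * f x) \<in> bump_algebra"
| coord: "f \<in> bump_algebra \<Longrightarrow> (\<lambda>x. of_real (x \<bullet> v) * f x) \<in> bump_algebra"

lemma bump_algebra_derivative:
  "f \<in> bump_algebra \<Longrightarrow> \<exists>D. (\<forall>x. (f has_derivative D x) (at x)) \<and> (\<forall>v. (\<lambda>x. D x v) \<in> bump_algebra)"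
proof (induction rule: bump_algebra.induct)
  case (flat k)
  define d where "d t = flat (k + 2) t - real k * flat (k + 1) t" for t
  define D where "D x v = complex_of_real (x \<bullet> v) * ((- 2) * of_real (flat (k + 2) (1 - x \<bullet> x)) + 2
      * of_nat k * of_real (flat (k + 1) (1 - x \<bullet> x)))"
    for x v :: 'a
  have "((\<lambda>x. complex_of_real (flat k (1 - x \<bullet> x))) has_derivative D x) (at x)" for x :: 'a
  proof -
    have "((\<lambda>x. 1 - x \<bullet> x) has_derivative (\<lambda>v. - (2 * (x \<bullet> v)))) (at x)"
      by (auto intro!: derivative_eq_intros simp: inner_commute)
    moreover have "(flat k has_derivative (\<lambda>s. s * d (1 - x \<bullet> x))) (at (1 - x \<bullet> x))"
      using DERIV_flat[of k "1 - x \<bullet> x"]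
          by (simp add: has_field_derivative_def d_def mult_commute_abs)
    ultimately have "((\<lambda>x. flat k (1 - x \<bullet> x)) has_derivative (\<lambda>v. - (2 * (x \<bullet> v)) * d (1 - x \<bullet> x)))
        (at x)"
      by (rule has_derivative_compose)
    then have "((\<lambda>x. complex_of_real (flat k (1 - x \<bullet> x))) has_derivative
        (\<lambda>v. of_real (- (2 * (x \<bullet> v)) * d (1 - x \<bullet> x)))) (at x)"
      by (rule has_derivative_of_real)
    moreover have "(\<lambda>v. complex_of_real (- (2 * (x \<bullet> v)) * d (1 - x \<bullet> x))) = D x"
      by (simp add: D_def d_def fun_eq_iff algebra_simps)
    ultimately show ?thesis by simp
  qed
  moreover have "(\<lambda>x. D x v) \<in> bump_algebra" for v
    unfolding D_def by (intro bump_algebra.intros)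
  ultimately show ?case by blast
next
  case (add f g)
  then obtain D E where "\<forall>x. (f has_derivative D x) (at x)" "\<forall>v. (\<lambda>x. D x v) \<in> bump_algebra"
    "\<forall>x. (g has_derivative E x) (at x)" "\<forall>v. (\<lambda>x. E x v) \<in> bump_algebra" by blast
  then show ?case
    by (intro exI[of _ "\<lambda>x v. D x v + E x v"]) (auto intro: has_derivative_add bump_algebra.add)
next
  case (scale f c)
  then obtain D where "\<forall>x. (f has_derivative D x) (at x)" "\<forall>v. (\<lambda>x. D x v) \<in> bump_algebra" by blast
  then show ?case
    by (intro exI[of _ "\<lambda>x v. c * D x v"])
        (auto intro: has_derivative_mult_right bump_algebra.scale)
next
  case (coord f u)
  then obtain D where D: "\<forall>x. (f has_derivative D x) (at x)" "\<forall>v. (\<lambda>x. D x v) \<in> bump_algebra"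
      by blast
  have "((\<lambda>x. of_real (x \<bullet> u) * f x) has_derivative (\<lambda>v. of_real (x \<bullet> u) * D x v + of_real (v \<bullet> u)
      * f x)) (at x)" for x
  proof -
    have "((\<lambda>x. x \<bullet> u) has_derivative (\<lambda>v. v \<bullet> u)) (at x)" by (auto intro!: derivative_eq_intros)
    then have "((\<lambda>x. complex_of_real (x \<bullet> u)) has_derivative (\<lambda>v. of_real (v \<bullet> u))) (at x)"
      by (rule has_derivative_of_real)
    from has_derivative_mult[OF this D(1)[rule_format]] show ?thesis .
  qed
  moreover have "(\<lambda>x. of_real (x \<bullet> u) * D x v + of_real (v \<bullet> u) * f x) \<in> bump_algebra" for v
    using D(2) coord.hyps by (intro bump_algebra.intros) auto
  ultimately show ?case
    by (intro exI[of _ "\<lambda>x v. of_real (x \<bullet> u) * D x v + of_real (v \<bullet> u) * f x"]) blast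
qed

lemma bump_algebra_smooth:
  assumes "f \<in> bump_algebra"
  shows "smooth f"
proof -
  have "foldr dir_deriv vs f \<in> bump_algebra" for vs
  proof (induction vs)
    case (Cons v vs)
    obtain D where D: "\<forall>x. (foldr dir_deriv vs f has_derivative D x) (at x)" "\<forall>v. (\<lambda>x. D x v)
        \<in> bump_algebra"
      using bump_algebra_derivative[OF Cons.IH] by blast
    have "foldr dir_deriv (v # vs) f = (\<lambda>x. D x v)"
      using dir_deriv_has_derivative(2)[OF D(1)[rule_format]] by (simp add: fun_eq_iff)
    then show ?case using D(2) by simp
  qed (use assms in simp)
  then show ?thesis
    unfolding smooth_def using bump_algebra_derivative by (meson differentiable_def)
qed

text \<open>\<open>pdo\<close> is a definite description over all cutoffs: without a single cutoff,
  \<open>pdo_limit\<close> would hold for every number and nothing would be determined. The factor e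
  in the construction normalises the value exp (-1) at the origin.\<close>

lemma exists_test_function:
  obtains \<phi> :: "'a::euclidean_space \<Rightarrow> complex" where "test_function \<phi>" "\<phi> 0 = 1"
proof -
  define \<phi> where "\<phi> x = of_real (exp 1) * complex_of_real (flat 0 (1 - x \<bullet> x))" for x :: 'a
  have "\<phi> \<in> bump_algebra" unfolding \<phi>_def by (intro bump_algebra.intros)
  moreover have "bounded {x. \<phi> x \<noteq> 0}"
  proof (rule bounded_subset[OF bounded_ball[of 0 1]])
    show "{x. \<phi> x \<noteq> 0} \<subseteq> ball 0 1"
      by (auto simp: \<phi>_def flat_def norm_eq_sqrt_inner split: if_splits)
  qed
  ultimately have "test_function \<phi>"
    unfolding test_function_def compact_closure by (simp add: bump_algebra_smooth)
  moreover have "\<phi> 0 = 1"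
      by (simp add: \<phi>_def flat_def of_real_mult[symmetric] exp_add[symmetric] del: of_real_mult)
  ultimately show ?thesis using that by blast
qed

section \<open>Amplitudes and their kernels\<close>

lemma coords_props: "distinct (coords :: 'n::finite list)" "set (coords :: 'n list) = UNIV"
proof -
  obtain xs :: "'n list" where "set xs = UNIV" "distinct xs"
    using finite_distinct_list[OF finite_class.finite_UNIV] by blast
  then have "\<exists>xs :: 'n list. distinct xs \<and> set xs = UNIV" by blast
  then have "distinct (coords :: 'n list) \<and> set (coords :: 'n list) = UNIV"
    unfolding coords_def by (rule someI_ex)
  then show "distinct (coords :: 'n list)" "set (coords :: 'n list) = UNIV" by auto
qed

lemma multi_deriv_0 [simp]: "multi_deriv (\<lambda>_. 0) f = f"
proof -
  have "foldr (\<lambda>i. dir_deriv (axis i 1) ^^ 0) is f = f" for "is" :: "'a list"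
    by (induction "is") auto
  then show ?thesis by (simp add: multi_deriv_def)
qed

lemma multi_deriv_single: "multi_deriv (\<lambda>j. if j = i then k else 0) f
    = (dir_deriv (axis i 1) ^^ k) f"
proof -
  have notin: "foldr (\<lambda>j. dir_deriv (axis j 1) ^^ (if j = i then k else 0)) is f = f"
      if "i \<notin> set is" for "is"
    using that by (induction "is") auto
  have "foldr (\<lambda>j. dir_deriv (axis j 1) ^^ (if j = i then k else 0)) is f
      = (dir_deriv (axis i 1) ^^ k) f"
    if "i \<in> set is" "distinct is" for "is"
    using that
  proof (induction "is")
    case (Cons j js)
    then show ?case using notin[of js] by (cases "j = i") auto
  qed simp
  from this[OF _ coords_props(1)] show ?thesis by (simp add: multi_deriv_def coords_props)
qed

lemma multi_order_single: "multi_order (\<lambda>j. if j = i then k else 0) = k" "multi_order (\<lambda>_. 0) = 0"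
  by (simp_all add: multi_order_def)

text \<open>A \<xi>-derivative at fixed \<open>y\<close> is a derivative of the joint function of
  (y, \<xi>) along (0, v). In this way joint smoothness gives joint continuity of the
  \<xi>-derivatives.\<close>

lemma dir_deriv_slice:
  fixes h :: "'a::euclidean_space \<Rightarrow> 'b::euclidean_space \<Rightarrow> complex"
  shows "(dir_deriv (0, v) ^^ k) (\<lambda>(y, \<xi>). h y \<xi>) (y, \<xi>) = (dir_deriv v ^^ k) (h y) \<xi>"
proof (induction k arbitrary: \<xi>)
  case (Suc k)
  then show ?case by (simp add: dir_deriv_def)
qed simp

section \<open>Joint measurability, and symbol bounds for almost every x\<close>

lemma continuous_le_on_dense:
  fixes g h :: "'a::topological_space \<Rightarrow> real"
  assumes cont: "continuous_on UNIV g" "continuous_on UNIV h"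
    and dense: "\<And>X. open X \<Longrightarrow> X \<noteq> {} \<Longrightarrow> \<exists>d\<in>S. d \<in> X" and le: "\<And>d. d \<in> S \<Longrightarrow> g d \<le> h d"
  shows "g p \<le> h p"
proof (rule ccontr)
  assume "\<not> g p \<le> h p"
  then have "p \<in> {p. h p < g p}" by simp
  then have "{p. h p < g p} \<noteq> {}" by blast
  moreover have "open {p. h p < g p}" using cont by (intro open_Collect_less)
  ultimately obtain d where "d \<in> S" "h d < g d" using dense by blast
  then show False using le[of d] by simp
qed

text \<open>The second argument is rounded to the first point of a dense sequence within 1 / (j +
  1). The rounding takes countably many values, so the rounded function is jointly measurable, and
  continuity in the second argument recovers \<open>h\<close> in the limit.\<close>

lemma Caratheodory_measurable:
  fixes h :: "'a \<Rightarrow> 'b::{second_countable_topology, metric_space} \<Rightarrow> complex"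
  assumes meas: "\<And>p. (\<lambda>x. h x p) \<in> borel_measurable M" and cont: "\<And>x. continuous_on UNIV (h x)"
  shows "(\<lambda>(x, p). h x p) \<in> borel_measurable (M \<Otimes>\<^sub>M borel)"
proof -
  obtain D :: "'b set" where D: "countable D" "\<And>X. open X \<Longrightarrow> X \<noteq> {} \<Longrightarrow> \<exists>d\<in>D. d \<in> X"
    using countable_dense_exists by blast
  have "D \<noteq> {}" using D(2)[of UNIV] by auto
  define d where "d = from_nat_into D"
  have d: "range d = D" unfolding d_def using D \<open>D \<noteq> {}\<close> by (intro range_from_nat_into)
  define idx where "idx j p = (LEAST i. dist (d i) p < 1 / real (Suc j))" for j p
  have near: "dist (d (idx j p)) p < 1 / real (Suc j)" for j p
    unfolding idx_def
  proof (rule LeastI_ex)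
    obtain x where "x \<in> D" "x \<in> ball p (1 / real (Suc j))"
        using D(2)[of "ball p (1 / real (Suc j))"] by auto
    then show "\<exists>i. dist (d i) p < 1 / real (Suc j)" using d by (auto simp: dist_commute)
  qed
  have idxm: "(\<lambda>z. idx j (snd z)) \<in> M \<Otimes>\<^sub>M borel \<rightarrow>\<^sub>M count_space UNIV" for j
    unfolding idx_def by measurable
  show ?thesis
  proof (rule borel_measurable_LIMSEQ_metric)
    fix j
    have "(\<lambda>z. (\<lambda>i z. h (fst z) (d i)) (idx j (snd z)) z) \<in> borel_measurable (M \<Otimes>\<^sub>M borel)"
      by (rule measurable_compose_countable[OF _ idxm])
          (rule measurable_compose[OF measurable_fst meas])
    then show "(\<lambda>z. h (fst z) (d (idx j (snd z)))) \<in> borel_measurable (M \<Otimes>\<^sub>M borel)" .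
  next
    fix z :: "'a \<times> 'b"
    have "(\<lambda>j. d (idx j (snd z))) \<longlonglongrightarrow> snd z"
    proof (rule tendsto_dist_iff[THEN iffD2], rule tendsto_sandwich[of "\<lambda>_. 0" _ _
        "\<lambda>j. 1 / real (Suc j)"])
      show "(\<lambda>j. 1 / real (Suc j)) \<longlonglongrightarrow> 0" using LIMSEQ_Suc[OF lim_1_over_n[where 'a = real]] by simp
      show "\<forall>\<^sub>F j in sequentially. dist (d (idx j (snd z))) (snd z) \<le> 1 / real (Suc j)"
        using near by (intro always_eventually allI less_imp_le)
    qed (auto intro: always_eventually)
    then have "(\<lambda>j. h (fst z) (d (idx j (snd z)))) \<longlonglongrightarrow> h (fst z) (snd z)"
      using continuous_on_tendsto_compose[OF cont[of "fst z"]] by simp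
    then show "(\<lambda>j. h (fst z) (d (idx j (snd z)))) \<longlonglongrightarrow> (case z of (x, p) \<Rightarrow> h x p)"
      by (simp add: case_prod_beta)
  qed
qed

locale amplitude =
  fixes a :: "real^'n \<Rightarrow> real^'n \<Rightarrow> real^'n \<Rightarrow> complex" and m \<rho> \<delta> :: real
  assumes rho: "0 \<le> \<rho>" "\<rho> \<le> 1" and m: "m < real CARD('n) * (\<rho> - 1)"
    and amp: "a \<in> amplitude_class m \<rho> \<delta>"
begin

definition dxi :: "'n \<Rightarrow> nat \<Rightarrow> real^'n \<Rightarrow> real^'n \<Rightarrow> real^'n \<Rightarrow> complex" where
  "dxi i k x y = (dir_deriv (axis i 1) ^^ k) (a x y)"

lemma axis_Basis: "(axis i 1 :: real^'n) \<in> Basis"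
  by (simp add: axis_in_Basis_iff)

lemma smooth_a: "smooth (\<lambda>(y, \<xi>). a x y \<xi>)"
  using amp by (simp add: amplitude_class_def)

lemma measurable_a: "(\<lambda>x. a x y \<xi>) \<in> borel_measurable lebesgue"
  using amp by (simp add: amplitude_class_def)

lemma continuous_on_dxi_joint: "continuous_on UNIV (\<lambda>(y, \<xi>). dxi i k x y \<xi>)"
proof -
  have "(0, axis i 1) \<in> (Basis :: ((real^'n) \<times> (real^'n)) set)"
    using axis_Basis by (simp add: Basis_prod_def)
  then have "continuous_on UNIV ((dir_deriv (0, axis i 1) ^^ k) (\<lambda>(y, \<xi>). a x y \<xi>))"
    by (rule smooth_line_seq(2)[OF smooth_a])
  moreover have "(dir_deriv (0, axis i 1) ^^ k) (\<lambda>(y, \<xi>). a x y \<xi>) = (\<lambda>(y, \<xi>). dxi i k x y \<xi>)"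
    by (auto simp: dxi_def dir_deriv_slice fun_eq_iff)
  ultimately show ?thesis by simp
qed

lemma continuous_on_dxi: "continuous_on UNIV (dxi i k x y)"
  using continuous_on_compose2[OF continuous_on_dxi_joint[of i k x], of UNIV "\<lambda>\<xi>. (y, \<xi>)"]
  by (simp add: continuous_on_Pair)

lemma line_seq_dxi: "line_seq (axis i 1) (\<lambda>k. dxi i k x y)"
  unfolding line_seq_def
proof (intro allI)
  fix k \<xi>
  have "(0, axis i 1) \<in> (Basis :: ((real^'n) \<times> (real^'n)) set)"
    using axis_Basis by (simp add: Basis_prod_def)
  from smooth_line_seq(1)[OF smooth_a this, of x]
  have "((\<lambda>t. (dir_deriv (0, axis i 1) ^^ k) (\<lambda>(y, \<xi>). a x y \<xi>) ((y, \<xi>) + t *\<^sub>R (0, axis i 1)))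
      has_vector_derivative
      (dir_deriv (0, axis i 1) ^^ Suc k) (\<lambda>(y, \<xi>). a x y \<xi>) (y, \<xi>)) (at 0)"
    unfolding line_seq_def by blast
  then have "((\<lambda>t. (dir_deriv (0, axis i 1) ^^ k) (\<lambda>(y, \<xi>). a x y \<xi>) (y, \<xi> + t *\<^sub>R axis i 1))
      has_vector_derivative
      (dir_deriv (0, axis i 1) ^^ Suc k) (\<lambda>(y, \<xi>). a x y \<xi>) (y, \<xi>)) (at 0)"
    by simp
  then show "((\<lambda>t. dxi i k x y (\<xi> + t *\<^sub>R axis i 1)) has_vector_derivative dxi i (Suc k) x y \<xi>)
      (at 0)"
    unfolding dir_deriv_slice dxi_def .
qed

text \<open>The class bounds an essential supremum in \<open>x\<close> for each (y, \<xi>)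
  separately, with an exceptional set that depends on the pair. A countable dense set of pairs
  leaves a single null set, and joint continuity extends the bound to all pairs off it.\<close>

lemma dxi_AE_bound_single:
  "\<exists>C. AE x in lebesgue. \<forall>y \<xi>. cmod (dxi i k x y \<xi>) \<le> C * japanese \<xi> powr (m - \<rho> * real k)"
proof -
  define \<alpha> where "\<alpha> = (\<lambda>j. if j = i then k else 0)"
  have "\<exists>C. \<forall>y \<xi>. esssup lebesgue
          (\<lambda>x. ereal (norm (multi_deriv \<alpha> (\<lambda>\<eta>. multi_deriv (\<lambda>_. 0) (\<lambda>z. a x z \<eta>) y) \<xi>)))
        \<le> ereal (C * japanese \<xi> powr (m - \<rho> * multi_order \<alpha> + \<delta> * multi_order (\<lambda>_ :: 'n. 0)))"
    using amp unfolding amplitude_class_def by blast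
  then obtain C where C: "\<And>y \<xi>. esssup lebesgue (\<lambda>x. ereal (cmod (dxi i k x y \<xi>)))
      \<le> ereal (C * japanese \<xi> powr (m - \<rho> * real k))"
    unfolding \<alpha>_def multi_deriv_0 multi_deriv_single multi_order_single dxi_def by auto
  have pt: "AE x in lebesgue. cmod (dxi i k x y \<xi>) \<le> C * japanese \<xi> powr (m - \<rho> * real k)" for y \<xi>
    using esssup_AE[of "\<lambda>x. ereal (cmod (dxi i k x y \<xi>))" lebesgue]
  proof eventually_elim
    case (elim x)
    then have "ereal (cmod (dxi i k x y \<xi>)) \<le> ereal (C * japanese \<xi> powr (m - \<rho> * real k))"
      using C[of y \<xi>] by (rule order_trans)
    then show ?case by simp
  qed
  obtain D :: "((real^'n) \<times> (real^'n)) set" where D: "countable D" "\<And>X. open X \<Longrightarrow> X \<noteq> {} \<Longrightarrow> \<exists>d\<in>D. d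
      \<in> X"
    using countable_dense_exists by blast
  have "AE x in lebesgue. \<forall>p\<in>D. cmod (dxi i k x (fst p) (snd p))
      \<le> C * japanese (snd p) powr (m - \<rho> * real k)"
    using D(1) pt by (subst AE_ball_countable) auto
  then have "AE x in lebesgue. \<forall>y \<xi>. cmod (dxi i k x y \<xi>) \<le> C * japanese \<xi> powr (m - \<rho> * real k)"
  proof eventually_elim
    case (elim x)
    have "cmod (dxi i k x (fst p) (snd p)) \<le> C * japanese (snd p) powr (m - \<rho> * real k)" for p
    proof (rule continuous_le_on_dense[OF _ _ D(2)])
      show "continuous_on UNIV (\<lambda>p. cmod (dxi i k x (fst p) (snd p)))"
        using continuous_on_dxi_joint[of i k x] unfolding case_prod_beta
            by (rule continuous_on_norm)
      show "continuous_on UNIV (\<lambda>p :: (real^'n) \<times> (real^'n). C * japanese (snd p) powr (m - \<rho>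
          * real k))"
        using japanese_pos[THEN less_imp_neq, THEN not_sym] by (intro continuous_intros) auto
    qed (use elim in auto)
    then show ?case by (metis fst_conv snd_conv)
  qed
  then show ?thesis by blast
qed

text \<open>The good points \<open>x\<close>, with one constant for all axes and all orders up to
  \<open>N\<close>. Later arguments fix such a point and then hold without exceptional sets in
  \<open>y\<close> and \<xi>.\<close>

definition xi_bounds :: "nat \<Rightarrow> real \<Rightarrow> real^'n \<Rightarrow> bool" where
  "xi_bounds N C x \<longleftrightarrow> (\<forall>i. \<forall>k\<le>N. \<forall>y \<xi>. cmod (dxi i k x y \<xi>) \<le> C * japanese \<xi> powr (m - \<rho> * real k))"

lemma AE_xi_bounds: obtains C where "0 \<le> C" "AE x in lebesgue. xi_bounds N C x"
proof -
  define c where "c i k = (SOME C. AE x in lebesgue. \<forall>y \<xi>. cmod (dxi i k x y \<xi>)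
      \<le> C * japanese \<xi> powr (m - \<rho> * real k))"
    for i k
  have c: "AE x in lebesgue. \<forall>y \<xi>. cmod (dxi i k x y \<xi>) \<le> c i k * japanese \<xi> powr (m - \<rho> * real k)"
      for i k
    unfolding c_def by (rule someI_ex[OF dxi_AE_bound_single])
  define C where "C = (\<Sum>i\<in>UNIV. \<Sum>k\<le>N. \<bar>c i k\<bar>)"
  have le: "c i k \<le> C" if "k \<le> N" for i k
  proof -
    have "\<bar>c i k\<bar> \<le> (\<Sum>k\<le>N. \<bar>c i k\<bar>)" using that by (intro member_le_sum) auto
    also have "\<dots> \<le> C" unfolding C_def by (rule member_le_sum) (auto intro: sum_nonneg)
    finally show ?thesis by linarith
  qed
  have "AE x in lebesgue. \<forall>i k. \<forall>y \<xi>. cmod (dxi i k x y \<xi>)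
      \<le> c i k * japanese \<xi> powr (m - \<rho> * real k)"
    unfolding AE_all_countable using c by blast
  then have "AE x in lebesgue. xi_bounds N C x"
  proof eventually_elim
    case (elim x)
    show ?case unfolding xi_bounds_def
    proof (intro allI impI)
      fix i k y \<xi> assume k: "k \<le> N"
      have "cmod (dxi i k x y \<xi>) \<le> c i k * japanese \<xi> powr (m - \<rho> * real k)" using elim by blast
      also have "\<dots> \<le> C * japanese \<xi> powr (m - \<rho> * real k)" by (intro mult_right_mono le k) simp
      finally show "cmod (dxi i k x y \<xi>) \<le> C * japanese \<xi> powr (m - \<rho> * real k)" .
    qed
  qed
  moreover have "0 \<le> C" unfolding C_def by (intro sum_nonneg) auto
  ultimately show ?thesis using that by blast
qed

text \<open>The asymmetry between \<open>f\<close> and \<open>g\<close>, \<open>h\<close> reflects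
  the class: amplitudes are Lebesgue measurable in x but continuous in (y, \<xi>).\<close>

lemma measurable_a_joint:
  assumes "f \<in> M \<rightarrow>\<^sub>M lebesgue" "g \<in> borel_measurable M" "h \<in> borel_measurable M"
  shows "(\<lambda>z. a (f z) (g z) (h z)) \<in> borel_measurable M"
proof -
  have "(\<lambda>(x, p). (\<lambda>(y, \<xi>). a x y \<xi>) p) \<in> borel_measurable (lebesgue \<Otimes>\<^sub>M borel)"
    by (rule Caratheodory_measurable) (auto simp: case_prod_beta measurable_a
        intro: smooth_imp_continuous[OF smooth_a, unfolded case_prod_beta])
  moreover have "(\<lambda>z. (f z, (g z, h z))) \<in> M \<rightarrow>\<^sub>M lebesgue \<Otimes>\<^sub>M borel"
    using assms by (intro measurable_Pair borel_measurable_Pair)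
  ultimately show ?thesis by (auto dest: measurable_compose[rotated])
qed

end

text \<open>Supplies the axis along which to integrate by parts: in that direction the phase
  oscillates at a rate comparable to |x - y|.\<close>

lemma exists_max_component:
  fixes z :: "real^'n"
  shows "\<exists>i. norm z \<le> real CARD('n) * \<bar>z $ i\<bar>"
proof -
  have "Max (range (\<lambda>i. \<bar>z $ i\<bar>)) \<in> range (\<lambda>i. \<bar>z $ i\<bar>)" by (intro Max_in) auto
  then obtain i where i: "\<bar>z $ i\<bar> = Max (range (\<lambda>i. \<bar>z $ i\<bar>))"
      by (metis (mono_tags, lifting) imageE)
  have "\<bar>z $ j\<bar> \<le> \<bar>z $ i\<bar>" for j unfolding i by (intro Max_ge) auto
  then have "(\<Sum>j\<in>UNIV. \<bar>z $ j\<bar>) \<le> (\<Sum>j\<in>(UNIV :: 'n set). \<bar>z $ i\<bar>)" by (intro sum_mono) auto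
  then have "norm z \<le> real CARD('n) * \<bar>z $ i\<bar>" using norm_le_l1_cart[of z] by simp
  then show ?thesis ..
qed

lemma one_over_Suc_at_right: "filterlim (\<lambda>j. 1 / real (Suc j)) (at_right 0) sequentially"
  unfolding filterlim_at using LIMSEQ_Suc[OF lim_1_over_n[where 'a = real]]
      by (simp add: always_eventually)

section \<open>Truncated kernels and their limit\<close>

context amplitude
begin

definition kern :: "(real^'n \<Rightarrow> complex) \<Rightarrow> real \<Rightarrow> real^'n \<Rightarrow> real^'n \<Rightarrow> complex" where
  "kern \<phi> \<epsilon> x y = (LINT \<xi>|lborel. a x y \<xi> * \<phi> (\<epsilon> *\<^sub>R \<xi>) * phase (x - y) \<xi>)"

definition bump :: "real^'n \<Rightarrow> complex" where
  "bump = (SOME \<phi>. test_function \<phi> \<and> \<phi> 0 = 1)"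

lemma bump: "test_function bump" "bump 0 = 1"
proof -
  have "\<exists>\<phi> :: real^'n \<Rightarrow> complex. test_function \<phi> \<and> \<phi> 0 = 1" using exists_test_function by metis
  then have "test_function bump \<and> bump 0 = 1" unfolding bump_def by (rule someI_ex)
  then show "test_function bump" "bump 0 = 1" by auto
qed

text \<open>The limit along one cutoff and one sequence of \<epsilon>, so that joint measurability
  follows from that of the truncated kernels. By \<open>kern_tendsto\<close> it is, for almost every
  \<open>x\<close> and all y \<noteq> x, the limit for every cutoff.\<close>

definition Kern :: "real^'n \<Rightarrow> real^'n \<Rightarrow> complex" where
  "Kern x y = lim (\<lambda>j. kern bump (1 / real (Suc j)) x y)"

lemma cutoff_seq_test_function:
  fixes \<phi> :: "real^'n \<Rightarrow> complex"
  assumes "test_function \<phi>"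
  obtains R where "\<And>i. cutoff_seq (axis i 1) (\<lambda>k. (dir_deriv (axis i 1) ^^ k) \<phi>) R"
proof -
  obtain R where R: "0 \<le> R" "\<And>x. R < norm x \<Longrightarrow> \<phi> x = 0" using test_function_support[OF assms]
      by blast
  have sm: "smooth \<phi>" using assms by (simp add: test_function_def)
  have "cutoff_seq (axis i 1) (\<lambda>k. (dir_deriv (axis i 1) ^^ k) \<phi>) R" for i
  proof
    show "line_seq (axis i 1) (\<lambda>k. (dir_deriv (axis i 1) ^^ k) \<phi>)"
        by (rule smooth_line_seq(1)[OF sm axis_Basis])
    then show "(dir_deriv (axis i 1) ^^ k) \<phi> x = 0" if "R < norm x" for k x
      by (rule line_seq_support[where k = k, OF _ _ that]) (use R in simp)
  qed (use R in \<open>auto intro: smooth_line_seq(2)[OF sm axis_Basis]\<close>)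
  then show ?thesis using that by blast
qed

lemma dxi_0: "dxi i 0 x y = a x y"
  by (simp add: dxi_def)

text \<open>The axis depends on x - y, so the constants of all axes are summed. \<open>K\<close> is
  independent of \<epsilon>, \<open>x\<close> and \<open>y\<close>; what depends on \<open>x\<close>
  is confined to the constant of \<open>xi_bounds\<close>.\<close>

lemma kern_bound:
  assumes \<phi>: "test_function \<phi>" and t: "0 < t" "t \<le> 1"
      and q: "m - \<rho> * (real N + t) < - real CARD('n)"
  obtains K where "0 \<le> K" "\<And>C x \<epsilon> y. 0 \<le> C \<Longrightarrow> xi_bounds (Suc N) C x \<Longrightarrow> 0 < \<epsilon> \<Longrightarrow> \<epsilon> \<le> 1 \<Longrightarrow> y \<noteq> x \<Longrightarrow>
    cmod (kern \<phi> \<epsilon> x y) \<le> C * K * dist x y powr - (real N + t)"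
proof -
  obtain R where R: "\<And>i. cutoff_seq (axis i 1) (\<lambda>k. (dir_deriv (axis i 1) ^^ k) \<phi>) R"
    using cutoff_seq_test_function[OF \<phi>] by blast
  define s where "s = real N + t"
  have s: "0 < s" using t by (simp add: s_def)
  have "\<exists>K. 0 \<le> K \<and> (\<forall>C x \<epsilon> y. 0 \<le> C \<longrightarrow> xi_bounds (Suc N) C x \<longrightarrow> 0 < \<epsilon> \<longrightarrow> \<epsilon> \<le> 1 \<longrightarrow> (x - y) $ i \<noteq> 0 \<longrightarrow>
      \<bar>(x - y) $ i\<bar> powr s * cmod (kern \<phi> \<epsilon> x y) \<le> C * K)" for i
  proof -
    interpret cutoff_seq "axis i 1 :: real^'n" "\<lambda>k. (dir_deriv (axis i 1) ^^ k) \<phi>" R by (rule R)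
    obtain K where K: "0 \<le> K" "\<And>(A :: nat \<Rightarrow> real^'n \<Rightarrow> complex) (C :: real) (\<epsilon> :: real) z. line_seq
        (axis i 1) A \<Longrightarrow> (\<And>k. continuous_on UNIV (A k)) \<Longrightarrow> 0 \<le> C \<Longrightarrow>
      (\<And>j x. j \<le> Suc N \<Longrightarrow> cmod (A j x) \<le> C * japanese x powr (m - \<rho> * real j)) \<Longrightarrow>
      0 < \<epsilon> \<Longrightarrow> \<epsilon> \<le> 1 \<Longrightarrow> z \<bullet> axis i 1 \<noteq> 0 \<Longrightarrow>
      \<bar>z \<bullet> axis i 1\<bar> powr (real N + t) * cmod (LINT \<xi>|lborel. A 0 \<xi> * (dir_deriv (axis i 1) ^^ 0) \<phi>
          (\<epsilon> *\<^sub>R \<xi>) * phase z \<xi>) \<le> C * K"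
      using oscillatory_kernel_bound[OF rho less_imp_le[OF t(1)] t(2) q] by blast
    have "\<bar>(x - y) $ i\<bar> powr s * cmod (kern \<phi> \<epsilon> x y) \<le> C * K"
      if C: "0 \<le> C" and g: "xi_bounds (Suc N) C x" and e: "0 < \<epsilon>" "\<epsilon> \<le> 1" and z: "(x - y) $ i \<noteq> 0"
          for C x \<epsilon> y
    proof -
      have zi: "(x - y) \<bullet> axis i 1 = (x - y) $ i" by (simp add: inner_axis)
      show ?thesis
        using K(2)[of "\<lambda>k. dxi i k x y" C \<epsilon> "x - y", OF line_seq_dxi continuous_on_dxi C _ e] g z
        unfolding zi by (simp add: xi_bounds_def dxi_0 kern_def s_def)
    qed
    then show ?thesis using K(1) by blast
  qed
  then obtain K where K: "\<And>i. 0 \<le> K i" "\<And>i C x \<epsilon> y. 0 \<le> C \<Longrightarrow> xi_bounds (Suc N) C x \<Longrightarrow> 0 < \<epsilon> \<Longrightarrow> \<epsilon> \<le> 1 \<Longrightarrow>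
      (x - y) $ i \<noteq> 0 \<Longrightarrow>
      \<bar>(x - y) $ i\<bar> powr s * cmod (kern \<phi> \<epsilon> x y) \<le> C * K i"
    by metis
  define n where "n = real CARD('n)"
  define K' where "K' = n powr s * (\<Sum>i\<in>UNIV. K i)"
  show ?thesis
  proof (rule that)
    show "0 \<le> K'" unfolding K'_def using K by (intro mult_nonneg_nonneg sum_nonneg) auto
    fix C \<epsilon> :: real and x y :: "real^'n" assume C: "0 \<le> C" and g: "xi_bounds (Suc N) C x"
        and e: "0 < \<epsilon>" "\<epsilon> \<le> 1" and "y \<noteq> x"
    obtain i where i: "norm (x - y) \<le> n * \<bar>(x - y) $ i\<bar>" using exists_max_component[of "x - y"]
        by (auto simp: n_def)
    have d: "0 < dist x y" using \<open>y \<noteq> x\<close> by simp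
    then have z: "(x - y) $ i \<noteq> 0" using i by (auto simp: dist_norm)
    have "dist x y powr s * cmod (kern \<phi> \<epsilon> x y) \<le> (n * \<bar>(x - y) $ i\<bar>) powr s * cmod (kern \<phi> \<epsilon> x y)"
      using i s by (intro mult_right_mono powr_mono2) (auto simp: dist_norm)
    also have "\<dots> = n powr s * (\<bar>(x - y) $ i\<bar> powr s * cmod (kern \<phi> \<epsilon> x y))"
      by (simp only: powr_mult mult.assoc)
    also have "\<dots> \<le> n powr s * (C * K i)" by (intro mult_left_mono K(2) C g e z) simp
    also have "\<dots> \<le> n powr s * (C * (\<Sum>i\<in>UNIV. K i))"
      using C K(1) by (intro mult_left_mono member_le_sum) auto
    also have "\<dots> = C * K'" by (simp add: K'_def)
    finally have "cmod (kern \<phi> \<epsilon> x y) * dist x y powr s \<le> C * K'" by (simp only: mult.commute)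
    then have "cmod (kern \<phi> \<epsilon> x y) \<le> C * K' / dist x y powr s"
      using d by (simp add: pos_le_divide_eq)
    then show "cmod (kern \<phi> \<epsilon> x y) \<le> C * K' * dist x y powr - (real N + t)"
      unfolding s_def[symmetric] by (simp add: powr_minus_divide)
  qed
qed

text \<open>Here n integrations by parts suffice, since m - \<rho> n < -n. The fractional step
  concerns the size of the kernel, not the existence of the limit.\<close>

lemma kern_limit_exists:
  assumes C: "0 \<le> C" and g: "xi_bounds CARD('n) C x" and xy: "y \<noteq> x"
  obtains L where "\<And>\<phi>. test_function \<phi> \<Longrightarrow> \<phi> 0 = 1 \<Longrightarrow> ((\<lambda>\<epsilon>. kern \<phi> \<epsilon> x y) \<longlongrightarrow> L) (at_right 0)"
proof -
  obtain i where "norm (x - y) \<le> real CARD('n) * \<bar>(x - y) $ i\<bar>" using exists_max_component by blast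
  then have z: "(x - y) $ i \<noteq> 0" using xy by auto
  have zi: "(x - y) \<bullet> axis i 1 = (x - y) $ i" by (simp add: inner_axis)
  have q: "m - \<rho> * real CARD('n) < - real CARD('n)" using m by (simp add: algebra_simps)
  show ?thesis
  proof (rule that)
    fix \<phi> :: "real^'n \<Rightarrow> complex" assume \<phi>: "test_function \<phi>" "\<phi> 0 = 1"
    obtain R where R: "\<And>i. cutoff_seq (axis i 1) (\<lambda>k. (dir_deriv (axis i 1) ^^ k) \<phi>) R"
      using cutoff_seq_test_function[OF \<phi>(1)] by blast
    interpret cutoff_seq "axis i 1 :: real^'n" "\<lambda>k. (dir_deriv (axis i 1) ^^ k) \<phi>" R by (rule R)
    show "((\<lambda>\<epsilon>. kern \<phi> \<epsilon> x y) \<longlongrightarrow> (LINT \<xi>|lborel. dxi i CARD('n) x y \<xi> * phase (x - y) \<xi>)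
        / (- (\<i> * of_real ((x - y) \<bullet> axis i 1))) ^ CARD('n)) (at_right 0)"
      using oscillatory_kernel_limit[OF rho q _ line_seq_dxi continuous_on_dxi C, of x y
          "x - y"] g z \<phi>(2)
      unfolding zi by (simp add: xi_bounds_def dxi_0 kern_def)
  qed
qed

lemma kern_tendsto:
  assumes "0 \<le> C" "xi_bounds CARD('n) C x" "y \<noteq> x" and \<phi>: "test_function \<phi>" "\<phi> 0 = 1"
  shows "((\<lambda>\<epsilon>. kern \<phi> \<epsilon> x y) \<longlongrightarrow> Kern x y) (at_right 0)"
proof -
  obtain L where L: "\<And>\<phi>. test_function \<phi> \<Longrightarrow> \<phi> 0 = 1 \<Longrightarrow> ((\<lambda>\<epsilon>. kern \<phi> \<epsilon> x y) \<longlongrightarrow> L) (at_right 0)"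
    using kern_limit_exists[OF assms(1-3)] by blast
  have "(\<lambda>j. kern bump (1 / real (Suc j)) x y) \<longlonglongrightarrow> L"
    by (rule filterlim_compose[OF L[OF bump] one_over_Suc_at_right])
  then have "Kern x y = L" unfolding Kern_def by (rule limI)
  then show ?thesis using L[OF \<phi>] by simp
qed

lemma Kern_bound:
  assumes t: "0 < t" "t \<le> 1" and q: "m - \<rho> * (real N + t) < - real CARD('n)"
  obtains C where "AE x in lebesgue. \<forall>y. y \<noteq> x \<longrightarrow> cmod (Kern x y) \<le> C * dist x y powr - (real N + t)"
proof -
  obtain K where K: "0 \<le> K" "\<And>C x \<epsilon> y. 0 \<le> C \<Longrightarrow> xi_bounds (Suc N) C x \<Longrightarrow> 0 < \<epsilon> \<Longrightarrow> \<epsilon> \<le> 1 \<Longrightarrow> y \<noteq> x \<Longrightarrow>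
    cmod (kern bump \<epsilon> x y) \<le> C * K * dist x y powr - (real N + t)"
    using kern_bound[OF bump(1) t q] by blast
  obtain C1 where C1: "0 \<le> C1" "AE x in lebesgue. xi_bounds (Suc N) C1 x" using AE_xi_bounds
      by blast
  obtain C2 where C2: "0 \<le> C2" "AE x in lebesgue. xi_bounds CARD('n) C2 x" using AE_xi_bounds
      by blast
  have "AE x in lebesgue. \<forall>y. y \<noteq> x \<longrightarrow> cmod (Kern x y) \<le> C1 * K * dist x y powr - (real N + t)"
    using C1(2) C2(2)
  proof eventually_elim
    case (elim x)
    show ?case
    proof (intro allI impI)
      fix y assume y: "y \<noteq> x"
      have "((\<lambda>\<epsilon>. cmod (kern bump \<epsilon> x y)) \<longlongrightarrow> cmod (Kern x y)) (at_right 0)"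
        by (intro tendsto_norm kern_tendsto[OF C2(1) elim(2) y] bump)
      then show "cmod (Kern x y) \<le> C1 * K * dist x y powr - (real N + t)"
      proof (rule tendsto_upperbound)
        show "\<forall>\<^sub>F \<epsilon> in at_right 0. cmod (kern bump \<epsilon> x y) \<le> C1 * K * dist x y powr - (real N + t)"
          unfolding eventually_at_right_field using K(2)[OF C1(1) elim(1) _ _ y]
              by (intro exI[of _ 1]) auto
      qed simp
    qed
  qed
  then show ?thesis using that by blast
qed

lemma kern_measurable:
  assumes \<phi>: "continuous_on UNIV \<phi>"
  shows "(\<lambda>(x, y). kern \<phi> \<epsilon> x y) \<in> borel_measurable (lebesgue \<Otimes>\<^sub>M lebesgue)"
proof -
  let ?M = "(lebesgue \<Otimes>\<^sub>M lebesgue) \<Otimes>\<^sub>M (lborel :: (real^'n) measure)"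
  have x: "(\<lambda>z. fst (fst z)) \<in> ?M \<rightarrow>\<^sub>M lebesgue" "(\<lambda>z. snd (fst z)) \<in> ?M \<rightarrow>\<^sub>M lebesgue" by simp_all
  have [measurable]: "(\<lambda>z. fst (fst z)) \<in> borel_measurable ?M" "(\<lambda>z. snd (fst z))
      \<in> borel_measurable ?M"
    using x by (auto intro: measurable_lebesgue_borel)
  have [measurable]: "snd \<in> borel_measurable ?M"
      using measurable_snd[of "lebesgue \<Otimes>\<^sub>M lebesgue" "lborel :: (real^'n) measure"] by simp
  have [measurable]: "\<phi> \<in> borel_measurable borel" using \<phi> by (intro borel_measurable_continuous_onI)
  have [measurable]: "(\<lambda>z. a (fst (fst z)) (snd (fst z)) (snd z)) \<in> borel_measurable ?M"
    by (rule measurable_a_joint[OF x(1)]) measurable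
  have "(\<lambda>z. a (fst (fst z)) (snd (fst z)) (snd z) * \<phi> (\<epsilon> *\<^sub>R snd z) * phase (fst (fst z)
      - snd (fst z)) (snd z)) \<in> borel_measurable ?M"
    unfolding phase_def by measurable
  then show ?thesis
    unfolding kern_def case_prod_beta
    by (intro lborel.borel_measurable_lebesgue_integral) (simp add: case_prod_beta)
qed

lemma continuous_bump: "continuous_on UNIV bump"
  using bump(1) by (simp add: test_function_def smooth_imp_continuous)

lemma Kern_measurable: "(\<lambda>(x, y). Kern x y) \<in> borel_measurable (lebesgue \<Otimes>\<^sub>M lebesgue)"
  unfolding Kern_def case_prod_beta
  using kern_measurable[OF continuous_bump] unfolding case_prod_beta
      by (intro borel_measurable_lim_metric)

definition fourier_const :: complex where
  "fourier_const = 1 / (2 * of_real pi) ^ CARD('n)"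

text \<open>The definition integrates in \<open>y\<close> first. With the cutoff the double
  integrand is dominated by |\<open>\<psi> \<xi>\<close>| |f y|, an integrable product, so Fubini's
  theorem exchanges the order and the inner integral becomes the truncated kernel.\<close>

lemma pdo_cutoff_eq:
  assumes C: "0 \<le> C" and g: "xi_bounds N C x" and \<phi>: "test_function \<phi>" and e: "0 < \<epsilon>"
      and f: "integrable lebesgue f"
  shows "pdo_cutoff a \<phi> \<epsilon> f x = fourier_const * (LINT y|lebesgue. kern \<phi> \<epsilon> x y * f y)"
proof -
  have cont\<phi>: "continuous_on UNIV \<phi>" using \<phi> by (simp add: test_function_def smooth_imp_continuous)
  have fm [measurable]: "f \<in> borel_measurable lebesgue" using f
      by (rule borel_measurable_integrable)
  obtain R where R: "\<And>x. R < norm x \<Longrightarrow> \<phi> x = 0" using test_function_support[OF \<phi>] by blast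
  define \<psi> where "\<psi> \<xi> = complex_of_real (C * japanese \<xi> powr m) * \<phi> (\<epsilon> *\<^sub>R \<xi>)" for \<xi>
  have "integrable lborel \<psi>"
  proof (rule continuous_compact_support_integrable)
    have "continuous_on UNIV (\<lambda>\<xi>. \<phi> (\<epsilon> *\<^sub>R \<xi>))"
      by (rule continuous_on_compose2[OF cont\<phi>]) (auto intro!: continuous_intros)
    moreover have "continuous_on UNIV (\<lambda>\<xi> :: real^'n. japanese \<xi> powr m)"
      using japanese_pos[THEN less_imp_neq, THEN not_sym] by (intro continuous_intros) auto
    ultimately show "continuous_on UNIV \<psi>" unfolding \<psi>_def
      by (intro continuous_on_mult continuous_on_of_real continuous_on_const)
    show "\<psi> \<xi> = 0" if "R / \<epsilon> < norm \<xi>" for \<xi>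
      using that e R[of "\<epsilon> *\<^sub>R \<xi>"] by (simp add: \<psi>_def pos_divide_less_eq mult.commute)
  qed
  then have "integrable lebesgue \<psi>" by (subst integrable_completion) auto
  then have psi: "(\<integral>\<^sup>+\<xi>. ennreal (cmod (\<psi> \<xi>)) \<partial>lebesgue) < top"
      and psim [measurable]: "\<psi> \<in> borel_measurable lebesgue"
    by (auto simp: integrable_iff_bounded infinity_ennreal_def)
  have ff: "(\<integral>\<^sup>+y. ennreal (cmod (f y)) \<partial>lebesgue) < top" using f
      by (auto simp: integrable_iff_bounded infinity_ennreal_def)
  let ?M = "(lebesgue :: (real^'n) measure) \<Otimes>\<^sub>M (lebesgue :: (real^'n) measure)"
  define h where "h \<xi> y = a x y \<xi> * \<phi> (\<epsilon> *\<^sub>R \<xi>) * phase (x - y) \<xi>" for \<xi> y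
  have [measurable]: "fst \<in> borel_measurable ?M" "snd \<in> borel_measurable ?M"
    by (auto intro: measurable_lebesgue_borel)
  have [measurable]: "\<phi> \<in> borel_measurable borel" using cont\<phi>
      by (intro borel_measurable_continuous_onI)
  have xM: "(\<lambda>z. x) \<in> N' \<rightarrow>\<^sub>M lebesgue" for N' :: "'z measure" by simp
  have [measurable]: "(\<lambda>z. a x (snd z) (fst z)) \<in> borel_measurable ?M"
    by (rule measurable_a_joint[OF xM]) measurable
  have hm: "(\<lambda>(\<xi>, y). h \<xi> y) \<in> borel_measurable ?M"
    unfolding h_def phase_def case_prod_beta by measurable
  then have hfm: "(\<lambda>(\<xi>, y). h \<xi> y * f y) \<in> borel_measurable ?M" unfolding case_prod_beta
      by measurable
  have hb: "cmod (h \<xi> y) \<le> cmod (\<psi> \<xi>)" for \<xi> y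
  proof -
    \<comment> \<open>At order 0 all axes give the same function, so any index will do.\<close>
    have "cmod (dxi undefined 0 x y \<xi>) \<le> C * japanese \<xi> powr (m - \<rho> * real 0)"
      using g unfolding xi_bounds_def by blast
    then have "cmod (a x y \<xi>) \<le> C * japanese \<xi> powr m" by (simp add: dxi_0)
    then show ?thesis using C by (simp add: h_def \<psi>_def norm_mult mult_right_mono)
  qed
  have "integrable ?M (\<lambda>(\<xi>, y). h \<xi> y * f y)"
  proof (rule integrableI_bounded[OF hfm])
    have "(\<integral>\<^sup>+z. ennreal (norm (case z of (\<xi>, y) \<Rightarrow> h \<xi> y * f y)) \<partial>?M)
        \<le> (\<integral>\<^sup>+z. ennreal (cmod (\<psi> (fst z))) * ennreal (cmod (f (snd z))) \<partial>?M)"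
      using hb by (intro nn_integral_mono)
          (auto simp: norm_mult case_prod_beta ennreal_mult[symmetric] intro!: ennreal_leI
          mult_right_mono)
    also have "\<dots> = (\<integral>\<^sup>+\<xi>. \<integral>\<^sup>+y. ennreal (cmod (\<psi> \<xi>)) * ennreal (cmod (f y)) \<partial>lebesgue \<partial>lebesgue)"
      by (subst lebesgue.nn_integral_fst[symmetric]) auto
    also have "\<dots> = (\<integral>\<^sup>+\<xi>. ennreal (cmod (\<psi> \<xi>)) \<partial>lebesgue) * (\<integral>\<^sup>+y. ennreal (cmod (f y)) \<partial>lebesgue)"
      by (simp add: nn_integral_cmult nn_integral_multc)
    also have "\<dots> < top" using psi ff by (simp add: ennreal_mult_less_top)
    finally show "(\<integral>\<^sup>+z. ennreal (norm (case z of (\<xi>, y) \<Rightarrow> h \<xi> y * f y)) \<partial>?M) < \<infinity>"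
        by (simp add: infinity_ennreal_def)
  qed
  then have "(LINT \<xi>|lebesgue. LINT y|lebesgue. h \<xi> y * f y)
      = (LINT y|lebesgue. LINT \<xi>|lebesgue. h \<xi> y * f y)"
    by (rule lebesgue_pair.Fubini_integral[symmetric])
  also have "\<dots> = (LINT y|lebesgue. kern \<phi> \<epsilon> x y * f y)"
  proof (rule Bochner_Integration.integral_cong[OF refl])
    fix y
    have "continuous_on UNIV (a x y)"
      using continuous_on_dxi[of undefined 0 x y] by (simp add: dxi_def)
    moreover have "continuous_on UNIV (\<lambda>\<xi>. \<phi> (\<epsilon> *\<^sub>R \<xi>))"
      by (rule continuous_on_compose2[OF cont\<phi>]) (auto intro!: continuous_intros)
    ultimately have "continuous_on UNIV (\<lambda>\<xi>. h \<xi> y)"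
      unfolding h_def by (intro continuous_on_mult continuous_on_phase continuous_on_const
          continuous_on_id)
    then have "(\<lambda>\<xi>. h \<xi> y) \<in> borel_measurable lborel"
      using borel_measurable_continuous_onI by simp
    then have "(LINT \<xi>|lebesgue. h \<xi> y) = kern \<phi> \<epsilon> x y" unfolding kern_def h_def
        by (rule integral_completion)
    then show "(LINT \<xi>|lebesgue. h \<xi> y * f y) = kern \<phi> \<epsilon> x y * f y" by simp
  qed
  finally show ?thesis unfolding pdo_cutoff_def fourier_const_def h_def phase_def by (simp only:)
qed

text \<open>Dominated convergence in \<open>y\<close>: for all \<epsilon> \<le> 1 the truncated
  kernels obey one bound by a multiple of \<open>dist x y powr - s\<close>, which \<open>fin\<close>
  makes integrable against \<open>f\<close>. No smoothness of \<open>f\<close> enters, so the lemma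
  serves both a test function and its product with \<open>b\<close>.\<close>

lemma pdo_eq:
  assumes C: "0 \<le> C" and g: "xi_bounds CARD('n) C x" and f: "integrable lebesgue f"
    and t: "0 < t" "t \<le> 1" and q: "m - \<rho> * (real (CARD('n) - 1) + t) < - real CARD('n)"
    and fin: "(\<integral>\<^sup>+y. ennreal (dist x y powr - (real (CARD('n) - 1) + t)) * ennreal (cmod (f y))
        \<partial>lebesgue) < top"
  shows "pdo a f x = fourier_const * (LINT y|lebesgue. Kern x y * f y)"
      "integrable lebesgue (\<lambda>y. Kern x y * f y)"
proof -
  define s where "s = real (CARD('n) - 1) + t"
  \<comment> \<open>The kernel bound with N = n - 1 uses derivatives up to order N + 1 = n, as does
    the existence of the limit; one hypothesis on \<open>x\<close> covers both.\<close>
  have SN: "Suc (CARD('n) - 1) = CARD('n)" by simp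
  have fm [measurable]: "f \<in> borel_measurable lebesgue" using f
      by (rule borel_measurable_integrable)
  have dm [measurable]: "(\<lambda>y. dist x y) \<in> borel_measurable lebesgue"
    by (intro measurable_completion) simp
  have dom: "integrable lebesgue (\<lambda>y. B * (dist x y powr - s * cmod (f y)))" for B
  proof (intro integrable_mult_right integrableI_bounded)
    show "(\<integral>\<^sup>+y. ennreal (norm (dist x y powr - s * cmod (f y))) \<partial>lebesgue) < \<infinity>"
      using fin unfolding s_def[symmetric] by (simp add: ennreal_mult infinity_ennreal_def)
  qed measurable
  have ae: "AE y in lebesgue. y \<noteq> x" by (rule AE_not_in[of "{x}", simplified]) simp
  have Kern_x: "Kern x \<in> borel_measurable lebesgue" using measurable_Pair2[OF Kern_measurable, of x]
      by simp
  have kernb: "\<exists>B. \<forall>\<epsilon> y. 0 < \<epsilon> \<longrightarrow> \<epsilon> \<le> 1 \<longrightarrow> y \<noteq> x \<longrightarrow> cmod (kern \<phi> \<epsilon> x y) \<le> B * dist x y powr - s"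
      if \<phi>: "test_function \<phi>" for \<phi>
  proof -
    obtain K where "0 \<le> K" and K: "\<And>C x \<epsilon> y. 0 \<le> C \<Longrightarrow> xi_bounds (Suc (CARD('n) - 1)) C x \<Longrightarrow> 0 < \<epsilon> \<Longrightarrow>
        \<epsilon> \<le> 1 \<Longrightarrow> y \<noteq> x \<Longrightarrow>
        cmod (kern \<phi> \<epsilon> x y) \<le> C * K * dist x y powr - (real (CARD('n) - 1) + t)"
      by (rule kern_bound[OF \<phi> t q]) (rule that)
    have g': "xi_bounds (Suc (CARD('n) - 1)) C x" unfolding SN by (rule g)
    show ?thesis
      by (intro exI[of _ "C * K"] allI impI) (rule K[OF C g', folded s_def])
  qed
  have lim: "pdo_limit a f x (fourier_const * (LINT y|lebesgue. Kern x y * f y))"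
    unfolding pdo_limit_def
  proof (intro allI impI)
    fix \<phi> :: "real^'n \<Rightarrow> complex" assume \<phi>: "test_function \<phi> \<and> \<phi> 0 = 1"
    have cont\<phi>: "continuous_on UNIV \<phi>" using \<phi>
        by (simp add: test_function_def smooth_imp_continuous)
    obtain B where B: "\<And>\<epsilon> y. 0 < \<epsilon> \<Longrightarrow> \<epsilon> \<le> 1 \<Longrightarrow> y \<noteq> x \<Longrightarrow> cmod (kern \<phi> \<epsilon> x y) \<le> B * dist x y powr - s"
      using kernb[of \<phi>] \<phi> by blast
    have at: "at_right 0 = at 0 within {0<..1::real}"
      by (rule at_within_nhd[of 0 "{..<1}"]) auto
    have kx: "kern \<phi> \<epsilon> x \<in> borel_measurable lebesgue" for \<epsilon>
      using measurable_Pair2[OF kern_measurable[OF cont\<phi>, of \<epsilon>], of x] by simp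
    show "((\<lambda>\<epsilon>. pdo_cutoff a \<phi> \<epsilon> f x) \<longlongrightarrow> fourier_const * (LINT y|lebesgue. Kern x y * f y))
        (at_right 0)"
      unfolding at tendsto_at_iff_sequentially
    proof (intro allI impI)
      fix X :: "nat \<Rightarrow> real" assume X: "\<forall>i. X i \<in> {0<..1} - {0}" "X \<longlonglongrightarrow> 0"
      have X0: "X i \<in> {0<..} \<and> X i \<noteq> 0" for i using X(1)[rule_format, of i] by auto
      have Xr: "filterlim X (at_right 0) sequentially"
        unfolding filterlim_at by (intro conjI always_eventually allI X(2) X0)
      have "(\<lambda>i. LINT y|lebesgue. kern \<phi> (X i) x y * f y) \<longlonglongrightarrow> (LINT y|lebesgue. Kern x y * f y)"
      proof (rule integral_dominated_convergence[OF _ _ dom[of B]])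
        show "(\<lambda>y. Kern x y * f y) \<in> borel_measurable lebesgue" using Kern_x by measurable
        show "(\<lambda>y. kern \<phi> (X i) x y * f y) \<in> borel_measurable lebesgue" for i using kx by measurable
        show "AE y in lebesgue. (\<lambda>i. kern \<phi> (X i) x y * f y) \<longlonglongrightarrow> Kern x y * f y"
          using ae
        proof eventually_elim
          case (elim y)
          show ?case
            by (intro tendsto_mult tendsto_const filterlim_compose[OF kern_tendsto[OF C g elim] Xr])
                (use \<phi> in auto)
        qed
        show "AE y in lebesgue. norm (kern \<phi> (X i) x y * f y)
            \<le> B * (dist x y powr - s * cmod (f y))" for i
          using ae
        proof eventually_elim
          case (elim y)
          have "cmod (kern \<phi> (X i) x y) \<le> B * dist x y powr - s" using X(1) by (intro B elim) auto
          then show ?case unfolding norm_mult mult.assoc[symmetric] by (intro mult_right_mono) auto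
        qed
      qed
      then have "(\<lambda>i. fourier_const * (LINT y|lebesgue. kern \<phi> (X i) x y * f y))
          \<longlonglongrightarrow> fourier_const * (LINT y|lebesgue. Kern x y * f y)"
        by (intro tendsto_mult tendsto_const)
      moreover have "pdo_cutoff a \<phi> (X i) f x = fourier_const * (LINT y|lebesgue. kern \<phi> (X i) x y
          * f y)" for i
        using X(1) \<phi> by (intro pdo_cutoff_eq[OF C g _ _ f]) auto
      ultimately show "((\<lambda>\<epsilon>. pdo_cutoff a \<phi> \<epsilon> f x) \<circ> X) \<longlonglongrightarrow> fourier_const * (LINT y|lebesgue. Kern x y
          * f y)"
        by (simp add: o_def)
    qed
  qed
  show "pdo a f x = fourier_const * (LINT y|lebesgue. Kern x y * f y)"
    unfolding pdo_def
  proof (rule the_equality)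
    show "pdo_limit a f x (fourier_const * (LINT y|lebesgue. Kern x y * f y))" by (rule lim)
    \<comment> \<open>A competing limit is compared with the first one on the single cutoff
      \<open>bump\<close>.\<close>
    fix L assume "pdo_limit a f x L"
    then have "((\<lambda>\<epsilon>. pdo_cutoff a bump \<epsilon> f x) \<longlongrightarrow> L) (at_right 0)"
      using bump unfolding pdo_limit_def by blast
    moreover have "((\<lambda>\<epsilon>. pdo_cutoff a bump \<epsilon> f x) \<longlongrightarrow> fourier_const * (LINT y|lebesgue. Kern x y
        * f y)) (at_right 0)"
      using lim bump unfolding pdo_limit_def by blast
    ultimately show "L = fourier_const * (LINT y|lebesgue. Kern x y * f y)"
      by (rule tendsto_unique[rotated]) simp
  qed
  obtain B where B: "\<And>\<epsilon> y. 0 < \<epsilon> \<Longrightarrow> \<epsilon> \<le> 1 \<Longrightarrow> y \<noteq> x \<Longrightarrow> cmod (kern bump \<epsilon> x y) \<le> B * dist x y powr - s"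
    using kernb[OF bump(1)] by blast
  show "integrable lebesgue (\<lambda>y. Kern x y * f y)"
  proof (rule Bochner_Integration.integrable_bound[OF dom[of B]])
    show "(\<lambda>y. Kern x y * f y) \<in> borel_measurable lebesgue" using Kern_x by measurable
    show "AE y in lebesgue. norm (Kern x y * f y) \<le> norm (B * (dist x y powr - s * cmod (f y)))"
      using ae
    proof eventually_elim
      case (elim y)
      have "((\<lambda>\<epsilon>. cmod (kern bump \<epsilon> x y)) \<longlongrightarrow> cmod (Kern x y)) (at_right 0)"
        by (intro tendsto_norm kern_tendsto[OF C g elim] bump)
      then have "cmod (Kern x y) \<le> B * dist x y powr - s"
        by (rule tendsto_upperbound)
            (auto simp: eventually_at_right_field intro!: exI[of _ 1] B elim)
      then have "cmod (Kern x y) * cmod (f y) \<le> B * dist x y powr - s * cmod (f y)"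
          by (intro mult_right_mono) auto
      then show ?case by (simp add: norm_mult mult.assoc)
    qed
  qed
qed

end

text \<open>For b = 0 the oscillation factor 1 + |b x - b y| equals 1, so the operator itself falls
  under the estimates made for the commutator.\<close>

lemma zero_in_BMO_inf: "(\<lambda>_. 0) \<in> BMO_inf"
proof -
  have "(\<lambda>_. 0) \<in> BMO 1"
    unfolding BMO_def locally_integrable_def ball_mean_def set_integrable_def
        set_lebesgue_integral_def
    by (auto intro!: exI[of _ 0])
  then show ?thesis by (force simp: BMO_inf_def)
qed

lemma integrable_BMO_times_test_function:
  fixes b f :: "real^'n \<Rightarrow> complex"
  assumes b: "locally_integrable b" and f: "test_function f"
  shows "integrable lebesgue (\<lambda>y. b y * f y)"
proof -
  have cont: "continuous_on UNIV f" using f by (simp add: test_function_def smooth_imp_continuous)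
  have [measurable]: "f \<in> borel_measurable lebesgue"
    by (intro measurable_completion) (use cont in \<open>simp add: borel_measurable_continuous_onI\<close>)
  have [measurable]: "b \<in> borel_measurable lebesgue"
      by (rule borel_measurable_locally_integrable[OF b])
  obtain R where R: "\<And>x. R < norm x \<Longrightarrow> f x = 0" using test_function_support[OF f] by blast
  obtain B where B: "0 \<le> B" "\<And>x. cmod (f x) \<le> B"
    using continuous_compact_support_bounded[OF cont R] by blast
  have "set_integrable lebesgue (cball 0 R) b" using b by (simp add: locally_integrable_def)
  then have "integrable lebesgue (\<lambda>x. B * cmod (indicator (cball 0 R) x *\<^sub>R b x))"
    unfolding set_integrable_def by (intro integrable_mult_right integrable_norm)
  then show ?thesis
  proof (rule Bochner_Integration.integrable_bound)
    show "AE x in lebesgue. norm (b x * f x) \<le> norm (B * cmod (indicator (cball 0 R) x *\<^sub>R b x))"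
    proof (intro AE_I2)
      fix x
      show "norm (b x * f x) \<le> norm (B * cmod (indicator (cball 0 R) x *\<^sub>R b x))"
      proof (cases "norm x \<le> R")
        case True
        then show ?thesis using B(1) mult_left_mono[OF B(2)[of x], of "cmod (b x)"]
          by (simp add: norm_mult mult.commute)
      next
        case False
        then show ?thesis using R[of x] by simp
      qed
    qed
  qed measurable
qed

lemma integrable_test_function:
  fixes f :: "real^'n \<Rightarrow> complex"
  assumes "test_function f"
  shows "integrable lebesgue f"
proof -
  have cont: "continuous_on UNIV f" using assms
      by (simp add: test_function_def smooth_imp_continuous)
  obtain R where R: "\<And>x. R < norm x \<Longrightarrow> f x = 0" using test_function_support[OF assms] by blast
  have "integrable lborel f" by (rule continuous_compact_support_integrable[OF cont R])
  then show ?thesis by (subst integrable_completion) auto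
qed

section \<open>Representation by the kernel and weighted boundedness\<close>

context amplitude
begin

text \<open>\<open>e\<close> is the gap n (\<rho> - 1) - m > 0. Lowering the order from n to n - 1 +
  t costs \<rho> (1 - t) \<le> e / 2, and the minimum with 1/2 keeps t positive.\<close>

lemma fractional_order:
  obtains t where "0 < t" "t < 1" "m - \<rho> * (real (CARD('n) - 1) + t) < - real CARD('n)"
proof -
  define e where "e = - real CARD('n) - (m - \<rho> * real CARD('n))"
  have e: "0 < e" using m by (simp add: e_def algebra_simps)
  define t where "t = 1 - min (1 / 2) (e / 2)"
  have "\<rho> * (1 - t) \<le> 1 * (1 - t)" using rho e by (intro mult_right_mono) (auto simp: t_def)
  also have "\<dots> < e" using e by (simp add: t_def)
  finally have "\<rho> * (1 - t) < e" .
  moreover have "real (CARD('n) - 1) = real CARD('n) - 1" by (simp add: of_nat_diff Suc_leI)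
  ultimately have "m - \<rho> * (real (CARD('n) - 1) + t) < - real CARD('n)"
    by (simp add: e_def algebra_simps)
  moreover have "0 < t" "t < 1" using e by (auto simp: t_def)
  ultimately show ?thesis using that by blast
qed

text \<open>Finiteness of the truncated kernel \<open>\<bar>x - y\<bar>\<^sup>-\<^sup>\<sigma> (1 + \<bar>b(x) - b(y)\<bar>)\<close> against a test function is what
  licenses the passage to the limit in the oscillatory integral, for \<open>f\<close> and for \<open>b f\<close> at once.\<close>

lemma kernel_representation:
  assumes w: "locally_integrable w" "\<And>x. 0 \<le> w x" and wp: "weight_pair p w s C \<theta>"
      and b: "b \<in> BMO_inf"
    and f: "test_function f"
  shows "AE x in weighted w. pdo a f x = fourier_const * (LINT y|lebesgue. Kern x y * f y) \<and>
    commutator b (pdo a) f x = fourier_const * (LINT y|lebesgue. Kern x y * (b x - b y) * f y)"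
proof -
  have p: "1 < p" using wp by (simp add: weight_pair_def)
  have li: "locally_integrable b" using b by (auto simp: BMO_inf_def BMO_def)
  have wm [measurable]: "w \<in> borel_measurable lebesgue"
      by (rule borel_measurable_locally_integrable[OF w(1)])
  have bm [measurable]: "b \<in> borel_measurable lebesgue"
      by (rule borel_measurable_locally_integrable[OF li])
  have fI: "integrable lebesgue f" by (rule integrable_test_function[OF f])
  have bfI: "integrable lebesgue (\<lambda>y. b y * f y)"
      by (rule integrable_BMO_times_test_function[OF li f])
  have fm [measurable]: "f \<in> borel_measurable lebesgue" using fI
      by (rule borel_measurable_integrable)
  obtain t where t: "0 < t" "t < 1" and q: "m - \<rho> * (real (CARD('n) - 1) + t) < - real CARD('n)"
    using fractional_order by blast
  define \<sigma> where "\<sigma> = real (CARD('n) - 1) + t"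
  have "1 \<le> real CARD('n)" "real (CARD('n) - 1) = real CARD('n) - 1"
    by (simp_all add: Suc_leI of_nat_diff)
  then have sig: "0 < \<sigma>" "\<sigma> < real CARD('n)"
    using t unfolding \<sigma>_def by linarith+
  define u where "u x y = 1 + cmod (b x - b y)" for x y
  \<comment> \<open>The kernel bound near the diagonal, weighted by the oscillation of
    \<open>b\<close>. Cut off at distance 1, it satisfies both hypotheses of
    \<open>kernel_operator_bound\<close>.\<close>
  define G where "G x y = (if dist x y < 1 then ennreal (1 * dist x y powr - \<sigma> * u x y) else 0)"
      for x y :: "real^'n"
  have u0: "0 \<le> u x y" for x y by (simp add: u_def)
  have near: "AE x in lebesgue. \<forall>y. y \<noteq> x \<longrightarrow>
      G x y \<le> ennreal (1 * dist x y powr - \<sigma> * (1 + cmod (b x - b y)))"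
    by (simp add: G_def u_def)
  \<comment> \<open>At distances below 1 a larger exponent gives a larger bound, so every exponent
    from \<sigma> on is admissible.\<close>
  have far: "\<exists>M'\<ge>M. \<exists>C2. AE x in lebesgue. \<forall>y. y \<noteq> x \<longrightarrow>
      G x y \<le> ennreal (C2 * dist x y powr - M' * (1 + cmod (b x - b y)))" for M
  proof (rule exI[of _ "max M \<sigma>"], intro conjI, simp, rule exI[of _ 1], intro AE_I2 allI impI)
    fix x y :: "real^'n" assume "y \<noteq> x"
    show "G x y \<le> ennreal (1 * dist x y powr - max M \<sigma> * (1 + cmod (b x - b y)))"
    proof (cases "dist x y < 1")
      case True
      have "dist x y powr - \<sigma> \<le> dist x y powr - max M \<sigma>"
        using True \<open>y \<noteq> x\<close> by (intro powr_mono') auto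
      then show ?thesis using True unfolding G_def u_def
          by (auto intro!: ennreal_leI mult_right_mono)
    qed (simp add: G_def)
  qed
  obtain K where "kernel_bounded p w G K"
    by (rule kernel_operator_bound[OF wp b near sig far]) (rule that)
  then have K: "(\<integral>\<^sup>+x. epowr (\<integral>\<^sup>+y. G x y * f y \<partial>lebesgue) p \<partial>weighted w)
      \<le> ennreal K * (\<integral>\<^sup>+y. epowr (f y) p \<partial>weighted w)"
    if "f \<in> borel_measurable lebesgue" for f
    using that unfolding kernel_bounded_def by blast
  note mw = measurable_cong_sets[OF sets_weighted refl]
  define U where "U x = (\<integral>\<^sup>+y. G x y * ennreal (cmod (f y)) \<partial>lebesgue)" for x
  have Gm [measurable]: "(\<lambda>(x, y). G x y) \<in> borel_measurable (lebesgue \<Otimes>\<^sub>M lebesgue)"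
  proof -
    have [measurable]: "fst \<in> borel_measurable (lebesgue \<Otimes>\<^sub>M lebesgue)" "snd
        \<in> borel_measurable (lebesgue \<Otimes>\<^sub>M lebesgue)"
      by (auto intro: measurable_lebesgue_borel)
    show ?thesis unfolding G_def u_def case_prod_beta by measurable
  qed
  have Um: "U \<in> borel_measurable lebesgue" unfolding U_def by measurable
  have "f \<in> Lp p w" using test_function_Lp[OF f w] p by simp
  then have fin: "(\<integral>\<^sup>+x. ennreal (cmod (f x) powr p) \<partial>weighted w) < top"
    by (auto simp: Lp_def integrable_iff_bounded infinity_ennreal_def)
  have "(\<integral>\<^sup>+x. epowr (U x) p \<partial>weighted w) \<le> ennreal K * (\<integral>\<^sup>+x. ennreal (cmod (f x) powr p) \<partial>weighted
      w)"
    using K[of "\<lambda>y. ennreal (cmod (f y))"] by (simp add: U_def)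
  also have "\<dots> < top" using fin by (simp add: ennreal_mult_less_top)
  finally have "(\<integral>\<^sup>+x. epowr (U x) p \<partial>weighted w) < top" .
  then have "AE x in weighted w. epowr (U x) p \<noteq> \<infinity>"
    using Um by (intro nn_integral_PInf_AE) (auto simp: mw infinity_ennreal_def)
  moreover obtain C' where C': "0 \<le> C'" "AE x in lebesgue. xi_bounds CARD('n) C' x"
      using AE_xi_bounds by blast
  have "AE x in weighted w. xi_bounds CARD('n) C' x" by (rule AE_weighted[OF wm C'(2)])
  ultimately show ?thesis
  proof eventually_elim
    case (elim x)
    then have Ufin: "U x < top" by (simp add: infinity_ennreal_def less_top)
    have dm [measurable]: "(\<lambda>y. dist x y) \<in> borel_measurable lebesgue"
      by (intro measurable_completion) simp
    have Gx [measurable]: "G x \<in> borel_measurable lebesgue" using measurable_Pair2[OF Gm, of x]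
        by simp
    have f1: "(\<integral>\<^sup>+y. ennreal (cmod (f y)) \<partial>lebesgue) < top"
        "(\<integral>\<^sup>+y. ennreal (cmod (b y * f y)) \<partial>lebesgue) < top"
      using fI bfI by (auto simp: integrable_iff_bounded infinity_ennreal_def)
    \<comment> \<open>Near the diagonal the integrand is at most \<open>A\<close> times the one
      defining \<open>U x\<close>. At distance 1 and beyond, the power of the distance is at most 1
      and the integrability of \<open>h\<close> suffices.\<close>
    have fin: "(\<integral>\<^sup>+y. ennreal (dist x y powr - \<sigma>) * ennreal (cmod (h y)) \<partial>lebesgue) < top"
      if h: "\<And>y. cmod (h y) \<le> A * u x y * cmod (f y)" and A: "0 \<le> A"
          and hI: "(\<integral>\<^sup>+y. ennreal (cmod (h y)) \<partial>lebesgue) < top"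
        and [measurable]: "h \<in> borel_measurable lebesgue" for h A
    proof -
      have "(\<integral>\<^sup>+y. ennreal (dist x y powr - \<sigma>) * ennreal (cmod (h y)) \<partial>lebesgue) \<le>
          (\<integral>\<^sup>+y. ennreal A * (G x y * ennreal (cmod (f y))) + ennreal (cmod (h y)) \<partial>lebesgue)"
      proof (rule nn_integral_mono)
        fix y
        show "ennreal (dist x y powr - \<sigma>) * ennreal (cmod (h y))
            \<le> ennreal A * (G x y * ennreal (cmod (f y))) + ennreal (cmod (h y))"
        proof (cases "dist x y < 1")
          case True
          have "dist x y powr - \<sigma> * cmod (h y) \<le> dist x y powr - \<sigma> * (A * u x y * cmod (f y))"
            by (intro mult_left_mono h) simp
          also have "\<dots> = A * (1 * dist x y powr - \<sigma> * u x y * cmod (f y))" by simp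
          finally have "ennreal (dist x y powr - \<sigma> * cmod (h y))
              \<le> ennreal (A * (1 * dist x y powr - \<sigma> * u x y * cmod (f y)))"
            by (rule ennreal_leI)
          also have "\<dots> = ennreal A * (G x y * ennreal (cmod (f y)))"
            unfolding G_def using True A u0[of x y] by (simp add: ennreal_mult)
          finally show ?thesis by (simp add: ennreal_mult add_increasing2)
        next
          case False
          then have "dist x y powr - \<sigma> \<le> 1 powr - \<sigma>" using sig by (intro powr_mono2') auto
          then have "ennreal (dist x y powr - \<sigma>) * ennreal (cmod (h y))
              \<le> ennreal 1 * ennreal (cmod (h y))"
            by (intro mult_right_mono ennreal_leI) auto
          then show ?thesis by (simp add: add_increasing)
        qed
      qed
      also have "\<dots> = ennreal A * U x + (\<integral>\<^sup>+y. ennreal (cmod (h y)) \<partial>lebesgue)"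
        unfolding U_def by (subst nn_integral_add) (auto simp: nn_integral_cmult)
      also have "\<dots> < top" using Ufin hI by (simp add: ennreal_mult_less_top)
      finally show ?thesis .
    qed
    have "(\<integral>\<^sup>+y. ennreal (dist x y powr - \<sigma>) * ennreal (cmod (f y)) \<partial>lebesgue) < top"
    proof (rule fin[of _ 1])
      show "cmod (f y) \<le> 1 * u x y * cmod (f y)" for y
        by (simp add: u_def algebra_simps)
    qed (use f1 in auto)
    note 1 = pdo_eq[OF C'(1) elim(2) fI t(1) less_imp_le[OF t(2)] q, folded \<sigma>_def, OF this]
    have "(\<integral>\<^sup>+y. ennreal (dist x y powr - \<sigma>) * ennreal (cmod (b y * f y)) \<partial>lebesgue) < top"
    proof (rule fin[of _ "1 + cmod (b x)"])
      \<comment> \<open>From |b y| \<le> |b x| + |b x - b y|. The constant may depend on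
        \<open>x\<close>, which is fixed here.\<close>
      show "cmod (b y * f y) \<le> (1 + cmod (b x)) * u x y * cmod (f y)" for y
      proof -
        have "cmod (b y) \<le> cmod (b x) + cmod (b x - b y)"
          using norm_triangle_ineq4[of "b x" "b x - b y"] by simp
        also have "\<dots> \<le> (1 + cmod (b x)) * u x y" by (simp add: u_def algebra_simps)
        finally show ?thesis unfolding norm_mult by (intro mult_right_mono) auto
      qed
    qed (use f1 in auto)
    note 2 = pdo_eq[OF C'(1) elim(2) bfI t(1) less_imp_le[OF t(2)] q, folded \<sigma>_def, OF this]
    have "(LINT y|lebesgue. Kern x y * (b x - b y) * f y) = (LINT y|lebesgue. b x * (Kern x y * f y)
        - Kern x y * (b y * f y))"
      by (rule Bochner_Integration.integral_cong) (simp_all add: algebra_simps)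
    also have "\<dots> = b x * (LINT y|lebesgue. Kern x y * f y) - (LINT y|lebesgue. Kern x y
        * (b y * f y))"
      using 1(2) 2(2) by simp
    finally have e: "(LINT y|lebesgue. Kern x y * (b x - b y) * f y) =
        b x * (LINT y|lebesgue. Kern x y * f y) - (LINT y|lebesgue. Kern x y * (b y * f y))" .
    have "commutator b (pdo a) f x = fourier_const * (LINT y|lebesgue. Kern x y * (b x - b y)
        * f y)"
      unfolding commutator_def 1(1) 2(1) e
          by (simp only: right_diff_distrib mult.left_commute[of "b x" fourier_const])
    then show ?case using 1(1) by blast
  qed
qed

text \<open>Near the diagonal the kernel bound is used with N = n - 1, which gives \<sigma> = n - 1
  + t < n. Far away N is as large as desired: since \<rho> \<ge> 0, the integrability condition for
  n - 1 persists for all larger N.\<close>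

lemma kernel_operator_Kern_bound:
  fixes H :: "real^'n \<Rightarrow> real^'n \<Rightarrow> complex"
  assumes wp: "weight_pair p w s C \<theta>" and b: "b \<in> BMO_inf"
    and H: "\<And>x y. cmod (H x y) \<le> cmod fourier_const * cmod (Kern x y) * (1 + cmod (b x - b y))"
  obtains K where "kernel_bounded p w (\<lambda>x y. ennreal (cmod (H x y))) K"
proof -
  obtain t where t: "0 < t" "t < 1" and q: "m - \<rho> * (real (CARD('n) - 1) + t) < - real CARD('n)"
    using fractional_order by blast
  define \<sigma> where "\<sigma> = real (CARD('n) - 1) + t"
  have "1 \<le> real CARD('n)" "real (CARD('n) - 1) = real CARD('n) - 1"
    by (simp_all add: Suc_leI of_nat_diff)
  then have sig: "0 < \<sigma>" "\<sigma> < real CARD('n)"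
    using t unfolding \<sigma>_def by linarith+
  have bd: "\<exists>C2. AE x in lebesgue. \<forall>y. y \<noteq> x \<longrightarrow> ennreal (cmod (H x y))
      \<le> ennreal (C2 * dist x y powr - (real N + t) * (1 + cmod (b x - b y)))"
    if N: "CARD('n) - 1 \<le> N" for N
  proof -
    have "\<rho> * (real (CARD('n) - 1) + t) \<le> \<rho> * (real N + t)" using N rho
        by (intro mult_left_mono) auto
    then have qN: "m - \<rho> * (real N + t) < - real CARD('n)" using q by linarith
    obtain C0 where C0: "AE x in lebesgue. \<forall>y. y \<noteq> x \<longrightarrow> cmod (Kern x y) \<le> C0 * dist x y powr
        - (real N + t)"
      using Kern_bound[OF t(1) less_imp_le[OF t(2)] qN] by blast
    have "AE x in lebesgue. \<forall>y. y \<noteq> x \<longrightarrow> ennreal (cmod (H x y)) \<le> ennreal ((cmod fourier_const * C0)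
        * dist x y powr - (real N + t) * (1 + cmod (b x - b y)))"
      using C0
    proof eventually_elim
      case (elim x)
      show ?case
      proof (intro allI impI ennreal_leI)
        fix y assume y: "y \<noteq> x"
        have "cmod (H x y) \<le> cmod fourier_const * cmod (Kern x y) * (1 + cmod (b x - b y))"
            by (rule H)
        also have "\<dots> \<le> cmod fourier_const * (C0 * dist x y powr - (real N + t))
            * (1 + cmod (b x - b y))"
          using elim y by (intro mult_right_mono mult_left_mono) auto
        finally show "cmod (H x y) \<le> (cmod fourier_const * C0) * dist x y powr - (real N + t)
            * (1 + cmod (b x - b y))"
          by (simp only: mult.assoc)
      qed
    qed
    then show ?thesis by blast
  qed
  obtain C1 where near: "AE x in lebesgue. \<forall>y. y \<noteq> x \<longrightarrow> ennreal (cmod (H x y))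
      \<le> ennreal (C1 * dist x y powr - \<sigma> * (1 + cmod (b x - b y)))"
    using bd[OF order_refl] unfolding \<sigma>_def by blast
  have far: "\<exists>M'\<ge>M. \<exists>C2. AE x in lebesgue. \<forall>y. y \<noteq> x \<longrightarrow> ennreal (cmod (H x y))
      \<le> ennreal (C2 * dist x y powr - M' * (1 + cmod (b x - b y)))" for M
  proof -
    define N where "N = max (CARD('n) - 1) (nat \<lceil>M\<rceil>)"
    have "M \<le> real (nat \<lceil>M\<rceil>)" by (rule real_nat_ceiling_ge)
    also have "\<dots> \<le> real N" by (simp add: N_def)
    finally have "M \<le> real N + t" using t by simp
    moreover have "CARD('n) - 1 \<le> N" by (simp add: N_def)
    ultimately show ?thesis using bd[of N] by blast
  qed
  show ?thesis
    by (rule kernel_operator_bound[OF wp b near sig far]) (rule that)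
qed

theorem bounded_on_Lp_pdo_commutator:
  assumes p: "1 < p" and w: "w \<in> A_weight_inf p" and b: "b \<in> BMO_inf"
  shows "bounded_on_Lp p w (pdo a)" "bounded_on_Lp p w (commutator b (pdo a))"
proof -
  have li: "locally_integrable w" and w0: "\<And>x. 0 \<le> w x"
    using w unfolding A_weight_inf_def A_weight_def by auto
  have wm: "w \<in> borel_measurable lebesgue" by (rule borel_measurable_locally_integrable[OF li])
  have bm [measurable]: "b \<in> borel_measurable lebesgue"
    using b by (intro borel_measurable_locally_integrable) (auto simp: BMO_inf_def BMO_def)
  note [measurable] = Kern_measurable
  consider (zero) "AE x in lebesgue. w x = 0" | (pair) s C \<theta> where "weight_pair p w s C \<theta>"
    using A_weight_cases[OF w p] by blast
  then have "bounded_on_Lp p w (pdo a) \<and> bounded_on_Lp p w (commutator b (pdo a))"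
  proof cases
    case zero
    then show ?thesis using bounded_on_Lp_if_weight_zero[OF wm] by blast
  next
    case (pair s C \<theta>)
    \<comment> \<open>One argument for both operators: \<beta> = 0 for \<open>pdo a\<close> and
      \<beta> = \<open>b\<close> for the commutator.\<close>
    have main: "bounded_on_Lp p w T"
      if "\<beta> \<in> BMO_inf" and Hm: "(\<lambda>(x, y). H x y) \<in> borel_measurable (lebesgue \<Otimes>\<^sub>M lebesgue)"
        and Hb: "\<And>x y. cmod (H x y) \<le> cmod fourier_const * cmod (Kern x y) * (1 + cmod (\<beta> x - \<beta> y))"
        and agree: "\<And>f. test_function f \<Longrightarrow> AE x in weighted w. T f x
            = (LINT y|lebesgue. H x y * f y)"
      for H T and \<beta> :: "real^'n \<Rightarrow> complex"
    proof -
      obtain K where K: "kernel_bounded p w (\<lambda>x y. ennreal (cmod (H x y))) K"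
        by (rule kernel_operator_Kern_bound[OF pair \<open>\<beta> \<in> BMO_inf\<close> Hb]) (rule that)
      show ?thesis by (rule bounded_on_Lp_kernel[OF li w0 p Hm K agree])
    qed
    note rep = kernel_representation[OF li w0 pair b]
    have "bounded_on_Lp p w (pdo a)"
    proof (rule main[where H = "\<lambda>x y. fourier_const * Kern x y", OF zero_in_BMO_inf])
      show "(\<lambda>(x, y). fourier_const * Kern x y) \<in> borel_measurable (lebesgue \<Otimes>\<^sub>M lebesgue)"
          by measurable
      show "AE x in weighted w. pdo a f x = (LINT y|lebesgue. fourier_const * Kern x y * f y)"
          if "test_function f" for f
        using rep[OF that] by eventually_elim (simp add: mult.assoc)
    qed (simp add: norm_mult)
    moreover have "bounded_on_Lp p w (commutator b (pdo a))"
    proof (rule main[where H = "\<lambda>x y. fourier_const * (Kern x y * (b x - b y))", OF b])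
      show "(\<lambda>(x, y). fourier_const * (Kern x y * (b x - b y)))
          \<in> borel_measurable (lebesgue \<Otimes>\<^sub>M lebesgue)" by measurable
      show "cmod (fourier_const * (Kern x y * (b x - b y))) \<le> cmod fourier_const * cmod (Kern x y)
          * (1 + cmod (b x - b y))" for x y
        unfolding norm_mult mult.assoc by (intro mult_left_mono) auto
      show "AE x in weighted w. commutator b (pdo a) f x
          = (LINT y|lebesgue. fourier_const * (Kern x y * (b x - b y)) * f y)"
        if "test_function f" for f
        using rep[OF that] by eventually_elim (simp add: mult.assoc)
    qed
    ultimately show ?thesis ..
  qed
  then show "bounded_on_Lp p w (pdo a)" "bounded_on_Lp p w (commutator b (pdo a))" by auto
qed

end

theorem corollary1p6:
  fixes a :: "real^'n \<Rightarrow> real^'n \<Rightarrow> real^'n \<Rightarrow> complex" and m \<rho> \<delta> :: real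
  assumes "0 \<le> \<rho>" "\<rho> \<le> 1" and "0 \<le> \<delta>" "\<delta> \<le> 1"
    and "m < real CARD('n) * (\<rho> - 1)"
    and "a \<in> amplitude_class m \<rho> \<delta>"
  shows "(\<forall>p>1. \<forall>w \<in> A_weight_inf p. bounded_on_Lp p w (pdo a)) \<and>
         (\<forall>b \<in> BMO_inf. \<forall>p>1. \<forall>w \<in> A_weight_inf p. bounded_on_Lp p w (commutator b (pdo a)))"
proof -
  interpret amplitude a m \<rho> \<delta>
    using assms by unfold_locales
  \<comment> \<open>The operator bound was proved alongside the commutator bound for some
    \<open>b\<close>; the first claim instantiates it with the zero function.\<close>
  show ?thesis
    using bounded_on_Lp_pdo_commutator zero_in_BMO_inf by blast
qed

end
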